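(* For every integer $N\ge 2$, $$\inf_{u\in W_{\mu_N}(\mathbb{R}^N)}I(u)=\inf_{u\in W^{1,N}_0(B_1)}J(u)+\sum_{k=1}^{N-1}\frac1k.$$
   Context: $\omega_{N-1}$ is the $(N-1)$-dimensional measure of the unit sphere of $\mathbb{R}^N$, $V_N$ is the volume of the unit ball, and $B_1$ is the open unit ball of $\mathbb{R}^N$ centered at the origin. Define $$\widetilde{\omega_N}:=N^N\left(\frac{N}{N-1}\right)^{N-1}\omega_{N-1},\qquad \mu_N(x):=\frac{1}{V_N\left(1+|x|^{\frac{N}{N-1}}\right)^N},\qquad d\mu_N:=\mu_N(x)\,dx,\qquad v_N:=\ln\mu_N,$$ $$H_N(u,\mu_N):=|\nabla v_N+\nabla u|^N-|\nabla v_N|^N-N|\nabla v_N|^{N-2}\nabla v_N\cdot\nabla u.$$ When $N=2$, $|\nabla v_N|^{N-2}$ is understood as $1$. With $\nabla u$ denoting the weak (distributional) gradient, $$W_{\mu_N}(\mathbb{R}^N):=\{u\in L^1(\mathbb{R}^N,d\mu_N):\ |\nabla u|\in L^N(\mathbb{R}^N,dx),\ |\nabla u|^2|\nabla v_N|^{N-2}\in L^1(\mathbb{R}^N,dx)\}$$ (real-valued functions). The functionals $I:W_{\mu_N}(\mathbb{R}^N)\to\mathbb{R}$ and $J:W^{1,N}_0(B_1)\to\mathbb{R}$ are $$I(u):=\frac{1}{\widetilde{\omega_N}}\int_{\mathbb{R}^N}H_N(u,\mu_N)\,dx+\int_{\mathbb{R}^N}u\,d\mu_N-\ln\left(\int_{\mathbb{R}^N}e^u\,d\mu_N\right),$$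 $$J(u):=\frac{1}{\widetilde{\omega_N}}\int_{B_1}|\nabla u|^N\,dx-\ln\left(\frac{1}{V_N}\int_{B_1}e^u\,dx\right).$$ *)

theory Defs
  imports "HOL-Analysis.Analysis"
begin

text \<open>
  The space \<open>\<real>\<^sup>N\<close> is an arbitrary Euclidean space \<open>'a\<close> with \<open>N = DIM('a)\<close>.  Elements of the
  function spaces are represented by functions (not classes modulo null sets), and
  integrability is meant with respect to \<open>lborel\<close>; every class has such a representative.
\<close>

text \<open>
  Surface measure on the unit sphere, as it occurs in integration in polar coordinates:
  \<open>\<sigma>(E) = N \<cdot> |{t x | 0 < t \<le> 1, x \<in> E}|\<close>.
\<close>
definition sphere_measure :: "'a::euclidean_space measure" where
  "sphere_measure =
     scale_measure (of_nat DIM('a))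
       (distr (restrict_space lborel (cball 0 1 - {0})) (restrict_space borel (sphere 0 1))
              (\<lambda>x. x /\<^sub>R norm x))"

definition sphere_area :: "'a::euclidean_space itself \<Rightarrow> real" where
  "sphere_area _ = measure (sphere_measure :: 'a measure) (sphere 0 1)"

definition ball_volume :: "'a::euclidean_space itself \<Rightarrow> real" where
  "ball_volume _ = measure lborel (ball (0::'a) 1)"

definition omega_tilde :: "'a::euclidean_space itself \<Rightarrow> real" where
  "omega_tilde T =
     real DIM('a) ^ DIM('a) * (real DIM('a) / (real DIM('a) - 1)) ^ (DIM('a) - 1) * sphere_area T"

fun C_k :: "nat \<Rightarrow> ('a::euclidean_space \<Rightarrow> real) \<Rightarrow> bool" where
  "C_k 0 f \<longleftrightarrow> continuous_on UNIV f"
| "C_k (Suc k) f \<longleftrightarrow>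
     f differentiable_on UNIV \<and> (\<forall>b\<in>Basis. C_k k (\<lambda>x. frechet_derivative f (at x) b))"

definition test_functions :: "'a::euclidean_space set \<Rightarrow> ('a \<Rightarrow> real) set" where
  "test_functions \<Omega> =
     {\<phi>. (\<forall>k. C_k k \<phi>) \<and> compact (closure {x. \<phi> x \<noteq> 0}) \<and> closure {x. \<phi> x \<noteq> 0} \<subseteq> \<Omega>}"

definition grad :: "('a::euclidean_space \<Rightarrow> real) \<Rightarrow> 'a \<Rightarrow> 'a" where
  "grad f x = (THE D. GDERIV f x :> D)"

definition locally_integrable_on ::
    "('a::euclidean_space \<Rightarrow> 'b::euclidean_space) \<Rightarrow> 'a set \<Rightarrow> bool" where
  "locally_integrable_on f \<Omega> \<longleftrightarrow> (\<forall>K. compact K \<and> K \<subseteq> \<Omega> \<longrightarrow> set_integrable lborel K f)"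

definition has_weak_grad ::
    "'a::euclidean_space set \<Rightarrow> ('a \<Rightarrow> real) \<Rightarrow> ('a \<Rightarrow> 'a) \<Rightarrow> bool" where
  "has_weak_grad \<Omega> u G \<longleftrightarrow>
     locally_integrable_on u \<Omega> \<and> locally_integrable_on G \<Omega> \<and>
     (\<forall>\<phi>\<in>test_functions \<Omega>.
        (LINT x:\<Omega>|lborel. u x *\<^sub>R grad \<phi> x) = - (LINT x:\<Omega>|lborel. \<phi> x *\<^sub>R G x))"

definition weakly_differentiable :: "'a::euclidean_space set \<Rightarrow> ('a \<Rightarrow> real) \<Rightarrow> bool" where
  "weakly_differentiable \<Omega> u \<longleftrightarrow> (\<exists>G. has_weak_grad \<Omega> u G)"

text \<open>The weak gradient is unique only almost everywhere on \<open>\<Omega>\<close>; this picks a representative.\<close>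
definition weak_grad :: "'a::euclidean_space set \<Rightarrow> ('a \<Rightarrow> real) \<Rightarrow> 'a \<Rightarrow> 'a" where
  "weak_grad \<Omega> u = (SOME G. has_weak_grad \<Omega> u G)"

definition sobolev :: "nat \<Rightarrow> 'a::euclidean_space set \<Rightarrow> ('a \<Rightarrow> real) set" where
  "sobolev p \<Omega> =
     {u. weakly_differentiable \<Omega> u \<and>
         set_integrable lborel \<Omega> (\<lambda>x. \<bar>u x\<bar> ^ p) \<and>
         set_integrable lborel \<Omega> (\<lambda>x. norm (weak_grad \<Omega> u x) ^ p)}"

definition sobolev_norm :: "nat \<Rightarrow> 'a::euclidean_space set \<Rightarrow> ('a \<Rightarrow> real) \<Rightarrow> real" where
  "sobolev_norm p \<Omega> u =
     root p ((LINT x:\<Omega>|lborel. \<bar>u x\<bar> ^ p) + (LINT x:\<Omega>|lborel. norm (weak_grad \<Omega> u x) ^ p))"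

text \<open>The closure of the test functions in \<open>sobolev p \<Omega>\<close>; values outside \<open>\<Omega>\<close> are irrelevant.\<close>
definition sobolev0 :: "nat \<Rightarrow> 'a::euclidean_space set \<Rightarrow> ('a \<Rightarrow> real) set" where
  "sobolev0 p \<Omega> =
     {u \<in> sobolev p \<Omega>.
        \<forall>\<epsilon>>0. \<exists>\<phi>\<in>test_functions \<Omega>. sobolev_norm p \<Omega> (\<lambda>x. u x - \<phi> x) < \<epsilon>}"

definition mu_dens :: "'a::euclidean_space \<Rightarrow> real" where
  "mu_dens x =
     1 / (ball_volume TYPE('a) *
          (1 + norm x powr (real DIM('a) / (real DIM('a) - 1))) ^ DIM('a))"

definition mu :: "'a::euclidean_space measure" where
  "mu = density lborel (\<lambda>x. ennreal (mu_dens x))"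

definition v :: "'a::euclidean_space \<Rightarrow> real" where
  "v x = ln (mu_dens x)"

text \<open>For \<open>N = 2\<close> the exponent \<open>DIM('a) - 2\<close> is \<open>0\<close>, and \<open>0 ^ 0 = 1\<close> gives the intended factor 1.\<close>
definition H :: "('a::euclidean_space \<Rightarrow> real) \<Rightarrow> 'a \<Rightarrow> real" where
  "H u x =
     norm (grad v x + weak_grad UNIV u x) ^ DIM('a) - norm (grad v x) ^ DIM('a)
     - real DIM('a) * norm (grad v x) ^ (DIM('a) - 2) * (grad v x \<bullet> weak_grad UNIV u x)"

definition W_mu :: "('a::euclidean_space \<Rightarrow> real) set" where
  "W_mu =
     {u. integrable mu u \<and> weakly_differentiable UNIV u \<and>
         integrable lborel (\<lambda>x. norm (weak_grad UNIV u x) ^ DIM('a)) \<and>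
         integrable lborel (\<lambda>x. (norm (weak_grad UNIV u x))\<^sup>2 * norm (grad v x) ^ (DIM('a) - 2))}"

definition I_fun :: "('a::euclidean_space \<Rightarrow> real) \<Rightarrow> real" where
  "I_fun u =
     1 / omega_tilde TYPE('a) * (LINT x|lborel. H u x) + (LINT x|mu. u x)
     - ln (LINT x|mu. exp (u x))"

definition J_fun :: "('a::euclidean_space \<Rightarrow> real) \<Rightarrow> real" where
  "J_fun u =
     1 / omega_tilde TYPE('a) * (LINT x:ball 0 1|lborel. norm (weak_grad (ball 0 1) u x) ^ DIM('a))
     - ln (1 / ball_volume TYPE('a) * (LINT x:ball 0 1|lborel. exp (u x)))"

end

theory Submission
  imports Defs "HOL-Computational_Algebra.Polynomial"
begin

text \<open>
  Let \<open>X = \<bar>\<nabla>v\<bar>\<^sup>N\<^sup>-\<^sup>2 \<nabla>v\<close>, which is a \<open>C\<^sup>1\<close> vector field with divergence \<open>-(\<omega>~/N) \<mu>\<close>. If \<open>f\<close> has compact support,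
  integration by parts turns the linear terms of \<open>I\<close> into each other, so that
  \<open>I(f) = 1/\<omega>~ \<integral>(\<bar>\<nabla>(v + f)\<bar>\<^sup>N - \<bar>\<nabla>v\<bar>\<^sup>N) - ln \<integral>exp(v + f)\<close>. If moreover \<open>f\<close> vanishes outside the ball \<open>B\<close> of
  radius \<open>R\<close>, then \<open>z = v + f - v(R)\<close> vanishes on its boundary, and \<open>I(f)\<close> differs from \<open>J\<close> of the rescaled
  \<open>z\<close> by an explicit radial integral, which tends to \<open>1 + 1/2 + ... + 1/(N - 1)\<close> as \<open>R\<close> tends to infinity,
  and by the logarithm of the ratio of \<open>\<integral>exp(v + f)\<close> over the whole space and over \<open>B\<close>.
  That ratio is at least \<open>1\<close>, which gives \<open>\<le>\<close>; for fixed \<open>f\<close> it tends to \<open>1\<close>, which gives \<open>\<ge>\<close>.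
  General elements of both function spaces are approximated by smooth or bounded compactly supported
  ones: the gradient terms converge, and Fatou's lemma controls the exponential terms in the right
  direction, so no Moser-Trudinger inequality is needed.
\<close>

section \<open>Smooth functions and test functions\<close>

text \<open>The function v solves Liouville's equation for the N-Laplacian, with a multiple of exp v
  = mu on the right; hence the divergence of X. The harmonic sum has this origin: with s =
  R^(N/(N-1)) and t = s/(1+s), the energy of v on the ball of radius R, divided by omega~, is
  ln(1+s) minus the sum of t^k/k for 0 < k < N. As ln(1+s) = -ln(1-t), this removes the head of a
  logarithmic series. The terms growing like ln R cancel against v(R) and the volume of the ball,
  and t tends to 1. Exponent and dimension agree, so dilations preserve the gradient term and balls
  of all sizes can be compared with the unit ball. The obstacle in passing to general functions is
  that the integral of a non-integrable function is 0 by convention: a divergent exponential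
  integral would silently enter the logarithm as 0. Every lower bound on I or J therefore has to
  come with integrability of the exponential, and the bound on the approximants itself supplies it.
  Both infima are extended reals, since their finiteness is not known in advance.\<close>

lemma GDERIV_unique: "GDERIV f x :> D \<Longrightarrow> GDERIV f x :> E \<Longrightarrow> D = E"
  unfolding gderiv_def
  by (metis has_derivative_unique inner_commute inner_eq_zero_iff inner_left_distrib inner_diff_left right_minus_eq)

lemma grad_eqI: "GDERIV f x :> D \<Longrightarrow> grad f x = D"
  unfolding grad_def using GDERIV_unique by blast

lemma differentiable_GDERIV:
  assumes "f differentiable (at x)"
  shows "GDERIV f x :> (\<Sum>b\<in>Basis. frechet_derivative f (at x) b *\<^sub>R b)"
proof -
  let ?f = "frechet_derivative f (at x)"
  have d: "(f has_derivative ?f) (at x)"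
    using assms frechet_derivative_works by blast
  then have "linear ?f" by (rule has_derivative_linear)
  then have "?f h = h \<bullet> (\<Sum>b\<in>Basis. ?f b *\<^sub>R b)" for h
    by (subst euclidean_representation[of h, symmetric])
       (simp add: linear_sum linear_scale inner_sum_right mult.commute del: euclidean_representation)
  then have "?f = (\<lambda>h. h \<bullet> (\<Sum>b\<in>Basis. ?f b *\<^sub>R b))" by blast
  with d show ?thesis unfolding gderiv_def by simp
qed

lemma GDERIV_imp_frechet: "GDERIV f x :> D \<Longrightarrow> frechet_derivative f (at x) = (\<lambda>h. h \<bullet> D)"
  unfolding gderiv_def by (metis frechet_derivative_at)

text \<open>The recursion of \<open>C_k\<close> through \<open>frechet_derivative\<close> is recast
  with \<open>grad\<close>, so that each closure property below is an induction on the order that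
  uses only the calculus rules for \<open>GDERIV\<close>. The original recursive equation then
  leaves the simplifier.\<close>

lemma C_k_Suc_iff:
  "C_k (Suc k) f \<longleftrightarrow> (\<forall>x. GDERIV f x :> grad f x) \<and> (\<forall>b\<in>Basis. C_k k (\<lambda>x. grad f x \<bullet> b))"
proof -
  have "f differentiable_on UNIV \<longleftrightarrow> (\<forall>x. GDERIV f x :> grad f x)"
    unfolding differentiable_on_def
    by (auto dest!: differentiable_GDERIV intro: grad_eqI[THEN ssubst])
       (auto simp: differentiable_def gderiv_def)
  moreover have "frechet_derivative f (at x) b = grad f x \<bullet> b" if "GDERIV f x :> grad f x" for x b
    using GDERIV_imp_frechet[OF that] by (simp add: inner_commute)
  ultimately show ?thesis by (auto cong: arg_cong[where f = "C_k k"])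
qed

declare C_k.simps(2) [simp del]

lemma C_k_SucI:
  assumes "\<And>x. GDERIV f x :> D x" "\<And>b. b \<in> Basis \<Longrightarrow> C_k k (\<lambda>x. D x \<bullet> b)"
  shows "C_k (Suc k) f"
proof -
  have "grad f = D" using assms(1) grad_eqI by blast
  then show ?thesis using assms by (simp add: C_k_Suc_iff)
qed

lemma C_k_SucD: "C_k (Suc k) f \<Longrightarrow> C_k k f"
proof (induction k arbitrary: f)
  case 0
  then show ?case
    by (auto simp: C_k_Suc_iff gderiv_def intro!: continuous_at_imp_continuous_on has_derivative_continuous)
next
  case (Suc k)
  then show ?case by (subst C_k_Suc_iff) (auto simp: C_k_Suc_iff[of "Suc k"])
qed

lemma C_k_const: "C_k k (\<lambda>x. c)"
proof (induction k arbitrary: c)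
  case (Suc k)
  show ?case by (rule C_k_SucI[where D = "\<lambda>_. 0"]) (auto simp: Suc GDERIV_const)
qed simp

lemma C_k_add: "C_k k f \<Longrightarrow> C_k k g \<Longrightarrow> C_k k (\<lambda>x. f x + g x)"
proof (induction k arbitrary: f g)
  case (Suc k)
  show ?case
    by (rule C_k_SucI[where D = "\<lambda>x. grad f x + grad g x"])
       (use Suc in \<open>auto simp: C_k_Suc_iff inner_add_left intro!: GDERIV_add\<close>)
qed (auto intro: continuous_intros)

lemma C_k_mult: "C_k k f \<Longrightarrow> C_k k g \<Longrightarrow> C_k k (\<lambda>x. f x * g x)"
proof (induction k arbitrary: f g)
  case (Suc k)
  show ?case
  proof (rule C_k_SucI[where D = "\<lambda>x. f x *\<^sub>R grad g x + g x *\<^sub>R grad f x"])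
    fix b :: 'a assume b: "b \<in> Basis"
    have "C_k k f" "C_k k g" "C_k k (\<lambda>x. grad f x \<bullet> b)" "C_k k (\<lambda>x. grad g x \<bullet> b)"
      using Suc.prems b by (auto dest: C_k_SucD) (auto simp: C_k_Suc_iff)
    then show "C_k k (\<lambda>x. (f x *\<^sub>R grad g x + g x *\<^sub>R grad f x) \<bullet> b)"
      by (auto simp: inner_add_left intro!: C_k_add Suc.IH)
  qed (use Suc.prems in \<open>auto simp: C_k_Suc_iff intro!: GDERIV_mult\<close>)
qed (auto intro: continuous_intros)

lemma C_k_inner: "C_k k (\<lambda>x. x \<bullet> a)"
proof (cases k)
  case (Suc k)
  show ?thesis unfolding Suc
    by (rule C_k_SucI[where D = "\<lambda>_. a"])
       (auto simp: C_k_const gderiv_def intro!: derivative_eq_intros)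
qed (auto intro: continuous_intros)

lemma GDERIV_affine:
  assumes "GDERIV f (a + c *\<^sub>R x) :> D"
  shows "GDERIV (\<lambda>x. f (a + c *\<^sub>R x)) x :> c *\<^sub>R D"
proof -
  have "((\<lambda>x. a + c *\<^sub>R x) has_derivative (\<lambda>h. c *\<^sub>R h)) (at x)"
    by (auto intro!: derivative_eq_intros)
  from has_derivative_compose[OF this assms[unfolded gderiv_def]] show ?thesis
    by (simp add: gderiv_def)
qed

lemma C_k_affine: "C_k k f \<Longrightarrow> C_k k (\<lambda>x. f (a + c *\<^sub>R x))"
proof (induction k arbitrary: f)
  case (Suc k)
  show ?case
  proof (rule C_k_SucI[where D = "\<lambda>x. c *\<^sub>R grad f (a + c *\<^sub>R x)"])
    show "GDERIV (\<lambda>x. f (a + c *\<^sub>R x)) x :> c *\<^sub>R grad f (a + c *\<^sub>R x)" for x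
      using Suc.prems by (intro GDERIV_affine) (auto simp: C_k_Suc_iff)
    show "C_k k (\<lambda>x. (c *\<^sub>R grad f (a + c *\<^sub>R x)) \<bullet> b)" if "b \<in> Basis" for b
      using Suc.IH[of "\<lambda>x. grad f x \<bullet> b"] Suc.prems that
      by (auto simp: C_k_Suc_iff intro!: C_k_mult C_k_const)
  qed
qed (auto intro!: continuous_intros intro: continuous_on_compose2)

section \<open>A smooth bump function\<close>

definition flat_exp :: "real poly \<Rightarrow> real \<Rightarrow> real" where
  "flat_exp p t = (if t > 0 then poly p (1 / t) * exp (- (1 / t)) else 0)"

lemma flat_exp_tendsto_0: "(flat_exp p \<longlongrightarrow> 0) (at 0)"
proof -
  have "((\<lambda>x. \<Sum>i\<le>degree p. coeff p i * (x ^ i / exp x)) \<longlongrightarrow> (\<Sum>i\<le>degree p. coeff p i * 0)) at_top"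
    by (intro tendsto_intros tendsto_power_div_exp_0)
  then have "((\<lambda>x. poly p x * exp (- x)) \<longlongrightarrow> 0) at_top"
    by (simp add: poly_altdef sum_distrib_right exp_minus divide_inverse mult.assoc)
  then have "((\<lambda>t. poly p (inverse t) * exp (- inverse t)) \<longlongrightarrow> 0) (at_right 0)"
    by (rule filterlim_compose[OF _ filterlim_inverse_at_top_right])
  then have "(flat_exp p \<longlongrightarrow> 0) (at_right 0)"
    by (rule Lim_transform_eventually)
       (auto simp: eventually_at_filter flat_exp_def inverse_eq_divide)
  moreover have "(flat_exp p \<longlongrightarrow> 0) (at_left 0)"
    by (rule tendsto_eventually) (auto simp: eventually_at_filter flat_exp_def)
  ultimately show ?thesis by (simp add: filterlim_at_split)
qed

text \<open>Differentiating p(1/t) exp(-1/t) gives t^(-2) (p(1/t) - p'(1/t)) exp(-1/t), and t^(-2)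
  is absorbed as X^2 into the polynomial. The family is closed under differentiation; this is why
  \<open>flat_exp\<close> carries a polynomial parameter.\<close>

lemma flat_exp_deriv:
  "(flat_exp p has_real_derivative flat_exp ([:0, 0, 1:] * (p - pderiv p)) t) (at t)"
proof (rule linorder_cases[of t 0])
  assume "t < 0"
  have "((\<lambda>_. 0) has_real_derivative 0) (at t)" by simp
  then have "(flat_exp p has_real_derivative 0) (at t)"
    by (rule has_field_derivative_transform_within_open[of _ _ _ "{..<0}"])
       (use \<open>t < 0\<close> in \<open>auto simp: flat_exp_def\<close>)
  then show ?thesis using \<open>t < 0\<close> by (simp add: flat_exp_def)
next
  assume "t > 0"
  have "((\<lambda>t. poly p (1 / t) * exp (- (1 / t))) has_real_derivative
      flat_exp ([:0, 0, 1:] * (p - pderiv p)) t) (at t)"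
    using \<open>t > 0\<close>
    by (auto intro!: derivative_eq_intros DERIV_chain2[where f = "poly p", OF poly_DERIV]
        simp: flat_exp_def field_simps power2_eq_square)
  then show ?thesis
    by (rule has_field_derivative_transform_within_open[of _ _ _ "{0<..}"])
       (use \<open>t > 0\<close> in \<open>auto simp: flat_exp_def\<close>)
next
  assume [simp]: "t = 0"
  \<comment> \<open>Dividing by h multiplies the polynomial by X, so the difference quotient at 0 is
    again a member of the family and tends to 0.\<close>
  have "((\<lambda>h. (flat_exp p h - flat_exp p 0) / (h - 0)) \<longlongrightarrow> 0) (at 0)"
    by (rule Lim_transform_eventually[OF flat_exp_tendsto_0[of "pCons 0 p"]])
       (auto simp: eventually_at_filter flat_exp_def field_simps)
  then show ?thesis by (simp add: has_field_derivative_iff flat_exp_def)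
qed

text \<open>Composition with 1 - x . x confines the support to the closed unit ball. The induction
  runs over all polynomials at once, because the gradient changes the polynomial.\<close>

lemma C_k_flat_exp: "C_k k (\<lambda>x::'a::euclidean_space. flat_exp p (1 - x \<bullet> x))"
proof (induction k arbitrary: p)
  case 0
  have "continuous_on UNIV (flat_exp p)"
    using flat_exp_deriv by (metis DERIV_continuous_on has_field_derivative_at_within)
  moreover have "continuous_on UNIV (\<lambda>x::'a. 1 - x \<bullet> x)" by (intro continuous_intros)
  ultimately have "continuous_on UNIV (\<lambda>x::'a. flat_exp p (1 - x \<bullet> x))"
    by (rule continuous_on_compose2) simp
  then show ?case by simp
next
  case (Suc k)
  let ?q = "[:0, 0, 1:] * (p - pderiv p)"
  show ?case
  proof (rule C_k_SucI[where D = "\<lambda>x. flat_exp ?q (1 - x \<bullet> x) *\<^sub>R (-2 *\<^sub>R x)"])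
    have "GDERIV (\<lambda>x::'a. 1 - x \<bullet> x) x :> -2 *\<^sub>R x" for x
    proof -
      have "((\<lambda>x::'a. 1 - x \<bullet> x) has_derivative (\<lambda>h. 0 - (x \<bullet> h + h \<bullet> x))) (at x)"
        by (intro has_derivative_diff has_derivative_const has_derivative_inner has_derivative_ident)
      moreover have "(\<lambda>h. 0 - (x \<bullet> h + h \<bullet> x)) = (\<lambda>h. h \<bullet> (-2 *\<^sub>R x))"
        by (rule ext) (simp add: inner_commute)
      ultimately show ?thesis by (simp only: gderiv_def)
    qed
    from GDERIV_DERIV_compose[OF this flat_exp_deriv]
    show "GDERIV (\<lambda>x. flat_exp p (1 - x \<bullet> x)) x :> flat_exp ?q (1 - x \<bullet> x) *\<^sub>R (-2 *\<^sub>R x)" for x::'a .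
    show "C_k k (\<lambda>x::'a. (flat_exp ?q (1 - x \<bullet> x) *\<^sub>R (-2 *\<^sub>R x)) \<bullet> b)" for b
    proof -
      have "C_k k (\<lambda>x::'a. flat_exp ?q (1 - x \<bullet> x) * (-2 * (x \<bullet> b)))"
        by (intro C_k_mult Suc.IH C_k_const C_k_inner)
      then show ?thesis by (simp only: inner_scaleR_left)
    qed
  qed
qed

section \<open>Test functions and their gradients\<close>

lemma test_functionsI_cball:
  assumes "\<And>k. C_k k \<phi>" "\<And>x. x \<notin> cball c r \<Longrightarrow> \<phi> x = 0" "cball c r \<subseteq> \<Omega>"
  shows "\<phi> \<in> test_functions \<Omega>"
proof -
  have "{x. \<phi> x \<noteq> 0} \<subseteq> cball c r" using assms(2) by force
  then have "bounded {x. \<phi> x \<noteq> 0}" "closure {x. \<phi> x \<noteq> 0} \<subseteq> cball c r"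
    by (rule bounded_subset[OF bounded_cball], intro closure_minimal) auto
  with assms show ?thesis unfolding test_functions_def by auto
qed

lemma test_functionsI:
  assumes "\<And>k. C_k k \<phi>" "\<And>x. norm x > r \<Longrightarrow> \<phi> x = 0" "cball 0 r \<subseteq> \<Omega>"
  shows "\<phi> \<in> test_functions \<Omega>"
  using assms by (intro test_functionsI_cball[of \<phi> 0 r]) auto

lemma test_functions_GDERIV: "\<phi> \<in> test_functions \<Omega> \<Longrightarrow> GDERIV \<phi> x :> grad \<phi> x"
  using C_k_Suc_iff[of 0 \<phi>] by (auto simp: test_functions_def simp del: C_k.simps)

lemma GDERIV_eq_0_transform:
  assumes "GDERIV f x :> D" "open S" "x \<in> S" "\<And>y. y \<in> S \<Longrightarrow> f y = 0"
  shows "D = 0"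
proof -
  have "GDERIV (\<lambda>_. 0) x :> D"
    unfolding gderiv_def
    by (rule has_derivative_transform_within_open[OF assms(1)[unfolded gderiv_def] assms(2,3)])
       (use assms(4) in auto)
  then show ?thesis using GDERIV_const GDERIV_unique by blast
qed

lemma C_k_grad: "(\<And>k. C_k k \<phi>) \<Longrightarrow> b \<in> Basis \<Longrightarrow> C_k k (\<lambda>x. grad \<phi> x \<bullet> b)"
  using C_k_Suc_iff[of k \<phi>] by blast

lemma C_k_imp_continuous: "C_k k f \<Longrightarrow> continuous_on S f"
proof (induction k arbitrary: f)
  case (Suc k)
  then show ?case using C_k_SucD by blast
qed (auto intro: continuous_on_subset)

lemma C_k_continuous_grad: 
  assumes "C_k 1 f" shows "continuous_on S (grad f)"
  using assms C_k_imp_continuous[of 0]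
  by (subst continuous_on_componentwise) (auto simp: C_k_Suc_iff simp del: C_k.simps)

section \<open>Mollification\<close>

lemma nn_integral_lborel_affine:
  fixes t :: "'a::euclidean_space"
  assumes [measurable]: "f \<in> borel_measurable borel" and "c \<noteq> 0"
  shows "(\<integral>\<^sup>+x. f x \<partial>lborel) = ennreal (\<bar>c\<bar> ^ DIM('a)) * (\<integral>\<^sup>+x. f (t + c *\<^sub>R x) \<partial>lborel)"
  by (subst lborel_affine[OF assms(2), of t])
     (simp add: nn_integral_density nn_integral_distr nn_integral_cmult)

lemma integral_lborel_affine:
  fixes t :: "'a::euclidean_space" and f :: "'a \<Rightarrow> 'b::euclidean_space"
  assumes [measurable]: "f \<in> borel_measurable borel" and "c \<noteq> 0"
  shows "(\<integral>x. f x \<partial>lborel) = \<bar>c\<bar> ^ DIM('a) *\<^sub>R (\<integral>x. f (t + c *\<^sub>R x) \<partial>lborel)"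
  by (subst lborel_affine[OF assms(2), of t])
     (simp add: integral_density integral_distr)

lemma integrable_lborel_affine:
  fixes t :: "'a::euclidean_space" and f :: "'a \<Rightarrow> 'b::euclidean_space"
  assumes "integrable lborel f" and "c \<noteq> 0"
  shows "integrable lborel (\<lambda>x. f (t + c *\<^sub>R x))"
proof -
  have [measurable]: "f \<in> borel_measurable borel" using assms(1) by auto
  have "integrable (density (distr lborel borel (\<lambda>x. t + c *\<^sub>R x)) (\<lambda>_. ennreal (\<bar>c\<bar> ^ DIM('a)))) f"
    using assms by (subst (asm) lborel_affine[OF assms(2), of t]) simp
  then have "integrable lborel (\<lambda>x. \<bar>c\<bar> ^ DIM('a) *\<^sub>R f (t + c *\<^sub>R x))"
    by (simp add: integrable_density integrable_distr_eq)
  then have "integrable lborel (\<lambda>x. (1 / \<bar>c\<bar> ^ DIM('a)) *\<^sub>R (\<bar>c\<bar> ^ DIM('a) *\<^sub>R f (t + c *\<^sub>R x)))"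
    by (rule integrable_scaleR_right)
  moreover have "(1 / \<bar>c\<bar> ^ DIM('a)) * \<bar>c\<bar> ^ DIM('a) = 1" using assms(2) by simp
  ultimately show ?thesis by (simp only: scaleR_scaleR scaleR_one)
qed

lemma integral_lborel_reflect:
  fixes f :: "'a::euclidean_space \<Rightarrow> 'b::euclidean_space"
  assumes "f \<in> borel_measurable borel"
  shows "(\<integral>y. f (x - y) \<partial>lborel) = (\<integral>y. f y \<partial>lborel)"
  using integral_lborel_affine[OF assms, of "-1" x] by simp

lemma nn_integral_lborel_translate:
  fixes f :: "'a::euclidean_space \<Rightarrow> ennreal"
  assumes "f \<in> borel_measurable borel"
  shows "(\<integral>\<^sup>+x. f (x - y) \<partial>lborel) = (\<integral>\<^sup>+x. f x \<partial>lborel)"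
  using nn_integral_lborel_affine[OF assms, of 1 "-y"] by simp

lemma integral_lborel_translate:
  fixes f :: "'a::euclidean_space \<Rightarrow> 'b::euclidean_space"
  assumes "f \<in> borel_measurable borel"
  shows "(\<integral>x. f (x + y) \<partial>lborel) = (\<integral>x. f x \<partial>lborel)"
  using integral_lborel_affine[OF assms, of 1 y] by (simp add: add.commute)

lemma locally_integrable_onD:
  assumes "locally_integrable_on f UNIV"
  shows "integrable lborel (\<lambda>x. indicator (cball c r) x *\<^sub>R f x)"
  using assms unfolding locally_integrable_on_def set_integrable_def by auto

text \<open>Local integrability yields measurability only after restriction to compact sets. Along
  an exhaustion the restricted functions are eventually constant at every point, so the limit is
  measurable.\<close>

lemma borel_measurable_indicator_limit:
  assumes "\<And>n. (\<lambda>x. indicator (A n) x *\<^sub>R f x) \<in> borel_measurable borel"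
    and "\<And>x. eventually (\<lambda>n. x \<in> A n \<longleftrightarrow> x \<in> S) sequentially"
  shows "(\<lambda>x. indicator S x *\<^sub>R (f x :: 'b::euclidean_space)) \<in> borel_measurable borel"
proof (rule borel_measurable_LIMSEQ_metric)
  show "(\<lambda>x. indicator (A n) x *\<^sub>R f x) \<in> borel_measurable borel" for n by (rule assms)
  show "(\<lambda>n. indicator (A n) x *\<^sub>R f x) \<longlonglongrightarrow> indicator S x *\<^sub>R f x" for x
    by (rule tendsto_eventually, rule eventually_mono[OF assms(2)[of x]]) (auto simp: indicator_def)
qed

lemma eventually_norm_le: "eventually (\<lambda>n. norm (x::'a::real_normed_vector) \<le> real n) sequentially"
  using eventually_ge_at_top[of "nat \<lceil>norm x\<rceil>"]
  by eventually_elim (auto simp: nat_le_iff ceiling_le_iff)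

lemma locally_integrable_borel:
  fixes f :: "'a::euclidean_space \<Rightarrow> 'b::euclidean_space"
  assumes "locally_integrable_on f UNIV"
  shows "f \<in> borel_measurable borel"
proof -
  have "(\<lambda>x. indicator UNIV x *\<^sub>R f x) \<in> borel_measurable borel"
    by (rule borel_measurable_indicator_limit[where A = "\<lambda>n. cball 0 (real n)"])
       (use locally_integrable_onD[OF assms] eventually_norm_le in \<open>auto simp: borel_measurable_integrable\<close>)
  then show ?thesis by simp
qed

lemma integrable_bounded_cball:
  fixes f :: "'a::euclidean_space \<Rightarrow> 'b::euclidean_space"
  assumes "f \<in> borel_measurable borel" "AE x in lborel. norm (f x) \<le> B" "\<And>x. norm x > r \<Longrightarrow> f x = 0"
  shows "integrable lborel f"
proof (rule Bochner_Integration.integrable_bound)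
  show "integrable lborel (\<lambda>x::'a. indicator (cball 0 r) x * B)"
    by (intro integrable_mult_left integrable_real_indicator)
       (use emeasure_lborel_cball_finite[of "0::'a" r] in \<open>auto simp: infinity_ennreal_def\<close>)
  show "AE x in lborel. norm (f x) \<le> norm (indicator (cball 0 r) x * B)"
    using assms(2) by eventually_elim (use assms(3) in \<open>force simp: indicator_def\<close>)
qed (use assms in auto)

lemma continuous_bounded_support:
  fixes f :: "'a::euclidean_space \<Rightarrow> 'b::euclidean_space"
  assumes "continuous_on UNIV f" "\<And>x. norm x > r \<Longrightarrow> f x = 0"
  obtains M where "M > 0" "\<And>x. norm (f x) \<le> M"
proof -
  have "compact (f ` cball 0 r)"
    using assms(1) by (intro compact_continuous_image continuous_on_subset[OF assms(1)]) auto
  then obtain M where "\<And>y. y \<in> f ` cball 0 r \<Longrightarrow> norm y \<le> M"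
    using compact_imp_bounded bounded_iff by metis
  then have "norm (f x) \<le> max M 1" for x
    by (cases "norm x \<le> r") (use assms(2)[of x] in \<open>force simp: not_le le_max_iff_disj\<close>)+
  then show ?thesis by (intro that[of "max M 1"]) auto
qed

text \<open>Uniform continuity on the ball of radius r + 1 suffices: two points at distance less
  than 1 that do not both lie in that ball both lie outside the support.\<close>

lemma continuous_uniform_support:
  fixes f :: "'a::euclidean_space \<Rightarrow> 'b::euclidean_space"
  assumes "continuous_on UNIV f" "\<And>x. norm x > r \<Longrightarrow> f x = 0" "e > 0"
  obtains d where "d > 0" "d \<le> 1" "\<And>x y. dist x y < d \<Longrightarrow> dist (f x) (f y) < e"
proof -
  have "uniformly_continuous_on (cball 0 (r + 1)) f"
    by (intro compact_uniformly_continuous continuous_on_subset[OF assms(1)]) auto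
  then obtain d where d: "d > 0" "\<And>x y. x \<in> cball 0 (r + 1) \<Longrightarrow> y \<in> cball 0 (r + 1) \<Longrightarrow> dist x y < d \<Longrightarrow> dist (f x) (f y) < e"
    using assms(3) unfolding uniformly_continuous_on_def by (metis dist_commute)
  have "dist (f x) (f y) < e" if "dist x y < min d 1" for x y
  proof (cases "norm x \<le> r + 1 \<and> norm y \<le> r + 1")
    case True
    then show ?thesis using d that by auto
  next
    case False
    have "norm x \<le> norm y + dist x y" "norm y \<le> norm x + dist x y"
      using norm_triangle_sub[of x y] norm_triangle_sub[of y x] by (simp_all add: dist_norm norm_minus_commute)
    then have "norm x > r" "norm y > r" using False that by auto
    then show ?thesis using assms by simp
  qed
  then show ?thesis using d by (intro that[of "min d 1"]) auto
qed

text \<open>Convolution with a kernel. Vector values are allowed so that one operator acts on a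
  function and on its weak gradient.\<close>

definition moll :: "('a::euclidean_space \<Rightarrow> real) \<Rightarrow> ('a \<Rightarrow> 'b::euclidean_space) \<Rightarrow> 'a \<Rightarrow> 'b" where
  "moll \<rho> u x = (\<integral>y. \<rho> (x - y) *\<^sub>R u y \<partial>lborel)"

lemma compact_support_cball:
  fixes K :: "'a::real_normed_vector set"
  assumes "compact K" obtains r where "r > 0" "K \<subseteq> cball 0 r"
proof -
  obtain r where "r > 0" "\<And>x. x \<in> K \<Longrightarrow> norm x \<le> r"
    using compact_imp_bounded[OF assms] unfolding bounded_pos by blast
  then show ?thesis by (intro that[of r]) auto
qed

lemma locally_integrable_indicator:
  assumes "locally_integrable_on f \<Omega>" "compact K" "K \<subseteq> \<Omega>"
  shows "integrable lborel (\<lambda>x. indicator K x *\<^sub>R f x)"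
  using assms unfolding locally_integrable_on_def set_integrable_def by auto

text \<open>There are two versions because the scalar factor of \<open>*\<^sub>R\<close> is the
  locally integrable function on one side of the weak gradient identity and the test function on the
  other.\<close>

lemma integrable_test_scaleR:
  fixes f :: "'a::euclidean_space \<Rightarrow> real" and g :: "'a \<Rightarrow> 'b::euclidean_space"
  assumes f: "locally_integrable_on f \<Omega>" and K: "compact K" "K \<subseteq> \<Omega>"
    and g: "continuous_on UNIV g" "\<And>x. x \<notin> K \<Longrightarrow> g x = 0"
  shows "integrable lborel (\<lambda>x. f x *\<^sub>R g x)"
proof -
  obtain r where r: "K \<subseteq> cball 0 r" using compact_support_cball[OF K(1)] by blast
  have g0: "g x = 0" if "norm x > r" for x using that r by (intro g(2)) auto
  obtain M where M: "M > 0" "\<And>x. norm (g x) \<le> M"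
    using continuous_bounded_support[OF g(1) g0] by blast
  have iK: "integrable lborel (\<lambda>x. indicator K x *\<^sub>R f x)" by (rule locally_integrable_indicator[OF f K])
  have [measurable]: "g \<in> borel_measurable borel" "(\<lambda>x. indicator K x *\<^sub>R f x) \<in> borel_measurable borel"
    using borel_measurable_continuous_onI[OF g(1)] iK by auto
  have eq: "f x *\<^sub>R g x = (indicator K x *\<^sub>R f x) *\<^sub>R g x" for x using g(2) by (auto simp: indicator_def)
  show ?thesis
  proof (rule Bochner_Integration.integrable_bound)
    show "integrable lborel (\<lambda>x. M *\<^sub>R (indicator K x *\<^sub>R f x))" using iK by (rule integrable_scaleR_right)
    show "(\<lambda>x. f x *\<^sub>R g x) \<in> borel_measurable lborel" unfolding eq by measurable
    show "AE x in lborel. norm (f x *\<^sub>R g x) \<le> norm (M *\<^sub>R (indicator K x *\<^sub>R f x))"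
      using M g(2) by (intro AE_I2) (auto simp: indicator_def abs_mult mult.commute[of M] intro!: mult_left_mono)
  qed
qed

lemma integrable_test_scaleR':
  fixes f :: "'a::euclidean_space \<Rightarrow> 'b::euclidean_space" and g :: "'a \<Rightarrow> real"
  assumes f: "locally_integrable_on f \<Omega>" and K: "compact K" "K \<subseteq> \<Omega>"
    and g: "continuous_on UNIV g" "\<And>x. x \<notin> K \<Longrightarrow> g x = 0"
  shows "integrable lborel (\<lambda>x. g x *\<^sub>R f x)"
proof -
  obtain r where r: "K \<subseteq> cball 0 r" using compact_support_cball[OF K(1)] by blast
  have g0: "g x = 0" if "norm x > r" for x using that r by (intro g(2)) auto
  obtain M where M: "M > 0" "\<And>x. norm (g x) \<le> M"
    using continuous_bounded_support[OF g(1) g0] by blast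
  have iK: "integrable lborel (\<lambda>x. indicator K x *\<^sub>R f x)" by (rule locally_integrable_indicator[OF f K])
  have [measurable]: "g \<in> borel_measurable borel" "(\<lambda>x. indicator K x *\<^sub>R f x) \<in> borel_measurable borel"
    using borel_measurable_continuous_onI[OF g(1)] iK by auto
  have eq: "g x *\<^sub>R f x = g x *\<^sub>R (indicator K x *\<^sub>R f x)" for x using g(2) by (auto simp: indicator_def)
  show ?thesis
  proof (rule Bochner_Integration.integrable_bound)
    show "integrable lborel (\<lambda>x. M *\<^sub>R (indicator K x *\<^sub>R f x))" using iK by (rule integrable_scaleR_right)
    show "(\<lambda>x. g x *\<^sub>R f x) \<in> borel_measurable lborel" unfolding eq by measurable
    show "AE x in lborel. norm (g x *\<^sub>R f x) \<le> norm (M *\<^sub>R (indicator K x *\<^sub>R f x))"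
      using M g(2) by (intro AE_I2) (auto simp: indicator_def intro!: mult_right_mono)
  qed
qed

lemma integrable_moll:
  fixes u :: "'a::euclidean_space \<Rightarrow> 'b::euclidean_space"
  assumes u: "locally_integrable_on u UNIV" and \<rho>: "continuous_on UNIV \<rho>" "\<And>x. norm x > r \<Longrightarrow> \<rho> x = 0"
  shows "integrable lborel (\<lambda>y. \<rho> (x - y) *\<^sub>R u y)"
  by (rule integrable_test_scaleR'[OF u, of "cball x r"])
     (auto simp: dist_norm intro!: \<rho>(2) continuous_intros continuous_on_compose2[OF \<rho>(1)])

lemma borel_measurable_moll [measurable]:
  fixes u :: "'a::euclidean_space \<Rightarrow> 'b::euclidean_space"
  assumes [measurable]: "u \<in> borel_measurable borel" "\<rho> \<in> borel_measurable borel"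
  shows "moll \<rho> u \<in> borel_measurable borel"
  unfolding moll_def by measurable

lemma moll_cong_cball:
  assumes "\<And>x. norm x > s \<Longrightarrow> \<rho> x = 0" "norm x \<le> r"
  shows "moll \<rho> u x = moll \<rho> (\<lambda>y. indicator (cball 0 (r + s)) y *\<^sub>R u y) x"
  unfolding moll_def
proof (intro Bochner_Integration.integral_cong refl)
  fix y
  have "norm y \<le> norm x + norm (x - y)" using norm_triangle_sub[of y x] by (simp add: norm_minus_commute)
  then show "\<rho> (x - y) *\<^sub>R u y = \<rho> (x - y) *\<^sub>R (indicator (cball 0 (r + s)) y *\<^sub>R u y)"
    using assms(1)[of "x - y"] assms(2) by (cases "norm (x - y) \<le> s") (auto simp: indicator_def)
qed

lemma moll_eq_0:
  assumes "\<And>x. norm x > s \<Longrightarrow> \<rho> x = 0" "\<And>y. norm y > r \<Longrightarrow> u y = 0" "norm x > r + s"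
  shows "moll \<rho> u x = 0"
proof -
  have "\<rho> (x - y) *\<^sub>R u y = 0" for y
    using assms(1)[of "x - y"] assms(2)[of y] assms(3) norm_triangle_sub[of x y]
    by (cases "norm y > r") (auto simp: add.commute)
  then show ?thesis unfolding moll_def by (simp only: integral_zero)
qed

lemma integrable_kernel:
  fixes u :: "'a::euclidean_space \<Rightarrow> real" and g :: "'a \<Rightarrow> 'b::euclidean_space"
  assumes u: "locally_integrable_on u UNIV" and g: "continuous_on UNIV g" "\<And>x. norm x > r \<Longrightarrow> g x = 0"
  shows "integrable lborel (\<lambda>y. u y *\<^sub>R g (x - y))"
  by (rule integrable_test_scaleR[OF u, of "cball x r"])
     (auto simp: dist_norm intro!: g(2) continuous_intros continuous_on_compose2[OF g(1)])

text \<open>Differentiation under the integral by a direct estimate: \<open>grad \<rho>\<close> is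
  uniformly continuous, so the linearisation error of the kernel is at most e' |h| at every point,
  and it is integrated against |u| over one fixed ball.\<close>

lemma GDERIV_moll:
  fixes u :: "'a::euclidean_space \<Rightarrow> real"
  assumes u: "locally_integrable_on u UNIV" and \<rho>: "C_k 1 \<rho>" "\<And>x. norm x > r \<Longrightarrow> \<rho> x = 0"
  shows "GDERIV (moll \<rho> u) x :> (\<integral>y. u y *\<^sub>R grad \<rho> (x - y) \<partial>lborel)"
proof -
  have G: "GDERIV \<rho> x :> grad \<rho> x" for x using \<rho>(1) C_k_Suc_iff[of 0 \<rho>] by auto
  have G0: "grad \<rho> x = 0" if "norm x > r" for x
    by (rule GDERIV_eq_0_transform[OF G, of "- cball 0 r"]) (use that \<rho>(2) in auto)
  have Gc: "continuous_on UNIV (grad \<rho>)" using \<rho>(1) by (rule C_k_continuous_grad)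
  have \<rho>c: "continuous_on UNIV \<rho>" using \<rho>(1) by (rule C_k_imp_continuous)
  have [measurable]: "u \<in> borel_measurable borel" "\<rho> \<in> borel_measurable borel" "grad \<rho> \<in> borel_measurable borel"
    using locally_integrable_borel[OF u] borel_measurable_continuous_onI[OF \<rho>c] borel_measurable_continuous_onI[OF Gc] by auto
  have i1: "integrable lborel (\<lambda>y. \<rho> (z - y) * u y)" for z
    using integrable_moll[OF u \<rho>c \<rho>(2)] by simp
  have i2: "integrable lborel (\<lambda>y. u y *\<^sub>R grad \<rho> (x - y))"
    by (rule integrable_kernel[OF u Gc G0])
  \<comment> \<open>Increments satisfy |h| < 1, so all translated kernels live in the ball of radius
    r + 1 around x.\<close>
  define C where "C = (\<integral>y. indicator (cball x (r + 1)) y * \<bar>u y\<bar> \<partial>lborel)"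
  have iC: "integrable lborel (\<lambda>y. indicator (cball x (r + 1)) y * \<bar>u y\<bar>)"
    using integrable_norm[OF locally_integrable_onD[OF u, of x "r + 1"]] by (simp add: abs_mult)
  have C0: "C \<ge> 0" unfolding C_def by (intro Bochner_Integration.integral_nonneg) auto
  let ?D = "\<integral>y. u y *\<^sub>R grad \<rho> (x - y) \<partial>lborel"
  show ?thesis
    unfolding gderiv_def has_derivative_at_alt
  proof (intro conjI allI impI)
    show "bounded_linear (\<lambda>h. h \<bullet> ?D)" by (rule bounded_linear_inner_left)
    fix e :: real assume "e > 0"
    \<comment> \<open>The summand 1 keeps the quotient meaningful when u vanishes on the
      ball.\<close>
    define e' where "e' = e / (C + 1)"
    have e': "e' > 0" "e' * C \<le> e" using \<open>e > 0\<close> C0 by (auto simp: e'_def field_simps)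
    obtain d where d: "d > 0" "d \<le> 1" "\<And>x y. dist x y < d \<Longrightarrow> dist (grad \<rho> x) (grad \<rho> y) < e'"
      using continuous_uniform_support[OF Gc G0 e'(1)] by blast
    have lin: "\<bar>\<rho> (z + h) - \<rho> z - h \<bullet> grad \<rho> z\<bar> \<le> norm h * e'" if "norm h < d" for z h
    proof -
      have "norm (\<rho> (z + h) - \<rho> z - (z + h - z) \<bullet> grad \<rho> z) \<le> norm (z + h - z) * e'"
      proof (rule differentiable_bound_linearization[of z "z + h" "ball z d" \<rho> "\<lambda>w k. k \<bullet> grad \<rho> w" z e'])
        show "z + t *\<^sub>R (z + h - z) \<in> ball z d" if "t \<in> {0..1}" for t
        proof -
          have "\<bar>t\<bar> * norm h \<le> 1 * norm h" using that by (intro mult_right_mono) auto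
          then show ?thesis using \<open>norm h < d\<close> by (simp add: dist_norm)
        qed
        show "(\<rho> has_derivative (\<lambda>k. k \<bullet> grad \<rho> w)) (at w within ball z d)" for w
          using G[of w] unfolding gderiv_def by (rule has_derivative_at_withinI)
        show "onorm ((\<lambda>k. k \<bullet> grad \<rho> w) - (\<lambda>k. k \<bullet> grad \<rho> z)) \<le> e'" if "w \<in> ball z d" for w
        proof (rule onorm_le)
          fix k
          have "\<bar>k \<bullet> (grad \<rho> w - grad \<rho> z)\<bar> \<le> norm k * norm (grad \<rho> w - grad \<rho> z)"
            by (rule Cauchy_Schwarz_ineq2)
          also have "\<dots> \<le> norm k * e'"
            using d(3)[of w z] that by (intro mult_left_mono) (auto simp: dist_norm dist_commute norm_minus_commute)
          finally show "norm (((\<lambda>k. k \<bullet> grad \<rho> w) - (\<lambda>k. k \<bullet> grad \<rho> z)) k) \<le> e' * norm k"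
            by (simp add: inner_diff_right mult.commute)
        qed
      qed (use d in auto)
      then show ?thesis by simp
    qed
    have "norm (moll \<rho> u x' - moll \<rho> u x - (x' - x) \<bullet> ?D) \<le> e * norm (x' - x)" if "norm (x' - x) < d" for x'
    proof -
      define h where "h = x' - x"
      have h: "x' = x + h" "norm h < d" using that by (auto simp: h_def)
      let ?f = "\<lambda>y. (\<rho> (x - y + h) - \<rho> (x - y) - h \<bullet> grad \<rho> (x - y)) * u y"
      have e1: "\<rho> (x' - y) * u y - \<rho> (x - y) * u y - h \<bullet> (u y *\<^sub>R grad \<rho> (x - y)) = ?f y" for y
        by (simp add: h algebra_simps)
      have "moll \<rho> u x' - moll \<rho> u x - h \<bullet> ?D =
          (\<integral>y. \<rho> (x' - y) * u y - \<rho> (x - y) * u y - h \<bullet> (u y *\<^sub>R grad \<rho> (x - y)) \<partial>lborel)"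
      proof -
        have "(\<integral>y. h \<bullet> (u y *\<^sub>R grad \<rho> (x - y)) \<partial>lborel) = h \<bullet> ?D"
          using i2 by (intro integral_inner_right)
        moreover have "integrable lborel (\<lambda>y. h \<bullet> (u y *\<^sub>R grad \<rho> (x - y)))"
          using i2 by (intro integrable_inner_right)
        ultimately show ?thesis
          using i1[of x] i1[of x'] by (simp add: moll_def del: inner_scaleR_right)
      qed
      also have "\<dots> = (\<integral>y. ?f y \<partial>lborel)" by (simp only: e1)
      also have "norm \<dots> \<le> (\<integral>y. (norm h * e') * (indicator (cball x (r + 1)) y * \<bar>u y\<bar>) \<partial>lborel)"
      proof (rule order_trans[OF integral_norm_bound Bochner_Integration.integral_mono])
        have "integrable lborel (\<lambda>y. \<rho> (x' - y) * u y - \<rho> (x - y) * u y - h \<bullet> (u y *\<^sub>R grad \<rho> (x - y)))"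
          using i1[of x] i1[of x'] i2 by (intro Bochner_Integration.integrable_diff integrable_inner_right)
        then show "integrable lborel (\<lambda>y. norm (?f y))" by (simp only: e1 integrable_norm)
        show "integrable lborel (\<lambda>y. (norm h * e') * (indicator (cball x (r + 1)) y * \<bar>u y\<bar>))"
          by (intro integrable_mult_right iC)
        fix y
        show "norm (?f y) \<le> (norm h * e') * (indicator (cball x (r + 1)) y * \<bar>u y\<bar>)"
        proof (cases "dist x y \<le> r + 1")
          case True
          then show ?thesis using lin[OF h(2), of "x - y"] by (auto simp: abs_mult intro!: mult_right_mono)
        next
          case False
          then have "norm (x - y) > r" by (simp add: dist_norm)
          moreover have "norm (x - y + h) > r"
            using False h(2) d(2) norm_triangle_sub[of "x - y" "x - y + h"] by (simp add: dist_norm)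
          ultimately show ?thesis using \<rho>(2) G0 e'(1) by simp
        qed
      qed
      also have "\<dots> = norm h * (e' * C)" by (simp add: C_def)
      also have "\<dots> \<le> norm h * e" using e'(2) by (intro mult_left_mono) auto
      finally show ?thesis by (simp add: h_def mult.commute)
    qed
    then show "\<exists>d>0. \<forall>x'. norm (x' - x) < d \<longrightarrow> norm (moll \<rho> u x' - moll \<rho> u x - (x' - x) \<bullet> ?D) \<le> e * norm (x' - x)"
      using d(1) by blast
  qed
qed

text \<open>A partial derivative of a mollification is the mollification of the same function with
  the differentiated kernel; hence the induction varies the kernel and keeps u.\<close>

lemma C_k_moll:
  fixes u :: "'a::euclidean_space \<Rightarrow> real"
  assumes u: "locally_integrable_on u UNIV" and "\<And>k. C_k k \<rho>" "\<And>x. norm x > r \<Longrightarrow> \<rho> x = 0"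
  shows "C_k k (moll \<rho> u)"
  using assms(2,3)
proof (induction k arbitrary: \<rho>)
  case 0
  have "GDERIV (moll \<rho> u) x :> (\<integral>y. u y *\<^sub>R grad \<rho> (x - y) \<partial>lborel)" for x
    using GDERIV_moll[OF u] 0 by blast
  then show ?case
    by (auto simp: gderiv_def intro!: continuous_at_imp_continuous_on has_derivative_continuous)
next
  case (Suc k)
  have G: "GDERIV \<rho> x :> grad \<rho> x" for x using Suc.prems(1) C_k_Suc_iff[of 0 \<rho>] by auto
  have G0: "grad \<rho> x = 0" if "norm x > r" for x
    by (rule GDERIV_eq_0_transform[OF G, of "- cball 0 r"]) (use that Suc.prems(2) in auto)
  have Gc: "continuous_on UNIV (grad \<rho>)" using Suc.prems(1) by (rule C_k_continuous_grad)
  show ?case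
  proof (rule C_k_SucI[OF GDERIV_moll[OF u Suc.prems(1,2)]])
    fix b :: 'a assume b: "b \<in> Basis"
    have c: "continuous_on UNIV (\<lambda>x. grad \<rho> x \<bullet> b)" using Gc by (intro continuous_intros)
    have ic: "integrable lborel (\<lambda>y. u y *\<^sub>R grad \<rho> (x - y))" for x
      by (rule integrable_kernel[OF u Gc G0])
    have "(\<lambda>x. (\<integral>y. u y *\<^sub>R grad \<rho> (x - y) \<partial>lborel) \<bullet> b) = moll (\<lambda>x. grad \<rho> x \<bullet> b) u"
      unfolding moll_def using ic
      by (auto simp: fun_eq_iff integral_inner_left[symmetric] mult.commute intro!: Bochner_Integration.integral_cong)
    moreover have "C_k k (moll (\<lambda>x. grad \<rho> x \<bullet> b) u)"
      using G0 by (intro Suc.IH C_k_grad Suc.prems b) auto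
    ultimately show "C_k k (\<lambda>x. (\<integral>y. u y *\<^sub>R grad \<rho> (x - y) \<partial>lborel) \<bullet> b)" by simp
  qed
qed

text \<open>Convexity of t^p in tangent form. In the induction, multiplication by t leaves the
  surplus p s^(p-1) (t - s)^2, which is non-negative. It serves as Jensen's inequality for
  mollification, as weighted convexity, and in both bounds on the Bregman term.\<close>

lemma power_tangent_le:
  fixes s t :: real
  assumes "s \<ge> 0" "t \<ge> 0"
  shows "s ^ p + real p * s ^ (p - 1) * (t - s) \<le> t ^ p"
proof (induction p)
  case (Suc p)
  show ?case
  proof (cases p)
    case (Suc q)
    have "s ^ Suc p + real (Suc p) * s ^ (Suc p - 1) * (t - s) + real p * s ^ q * (t - s)\<^sup>2
        = t * (s ^ p + real p * s ^ (p - 1) * (t - s))"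
      by (simp add: Suc algebra_simps power2_eq_square)
    also have "\<dots> \<le> t * t ^ p" using Suc.IH assms by (intro mult_left_mono)
    finally have "s ^ Suc p + real (Suc p) * s ^ (Suc p - 1) * (t - s) + real p * s ^ q * (t - s)\<^sup>2 \<le> t ^ Suc p"
      by simp
    moreover have "real p * s ^ q * (t - s)\<^sup>2 \<ge> 0" using assms by simp
    ultimately show ?thesis by linarith
  qed simp
qed simp

section \<open>Mollifying kernels of mass one\<close>

locale mollifier_kernel =
  fixes \<rho> :: "'a::euclidean_space \<Rightarrow> real" and r :: real
  assumes smooth: "\<And>k. C_k k \<rho>"
    and nonneg: "\<And>x. \<rho> x \<ge> 0"
    and support: "\<And>x. norm x > r \<Longrightarrow> \<rho> x = 0"
    and mass: "(\<integral>x. \<rho> x \<partial>lborel) = 1"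
begin

lemma cont: "continuous_on UNIV \<rho>"
  using smooth by (rule C_k_imp_continuous)

lemma meas [measurable]: "\<rho> \<in> borel_measurable borel"
  using cont by (rule borel_measurable_continuous_onI)

lemma integrable_shift: "integrable lborel (\<lambda>y. \<rho> (x - y))" and mass_shift: "(\<integral>y. \<rho> (x - y) \<partial>lborel) = 1"
proof -
  \<comment> \<open>A non-integrable function has integral 0, so mass 1 already forces
    integrability.\<close>
  have "integrable lborel \<rho>" using mass not_integrable_integral_eq by force
  from integrable_lborel_affine[OF this, of "-1" x] show "integrable lborel (\<lambda>y. \<rho> (x - y))" by simp
  show "(\<integral>y. \<rho> (x - y) \<partial>lborel) = 1"
    using integral_lborel_reflect[of \<rho> x] mass by simp
qed

lemma nn_mass_shift: "(\<integral>\<^sup>+y. \<rho> (x - y) \<partial>lborel) = 1" "(\<integral>\<^sup>+x. \<rho> (x - y) \<partial>lborel) = 1"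
proof -
  show "(\<integral>\<^sup>+y. \<rho> (x - y) \<partial>lborel) = 1" for x
    using integrable_shift mass_shift by (subst nn_integral_eq_integral) (auto simp: nonneg)
  from this[of 0] have "(\<integral>\<^sup>+y. \<rho> (- y) \<partial>lborel) = 1" by simp
  then have "(\<integral>\<^sup>+y. \<rho> y \<partial>lborel) = 1"
    using nn_integral_lborel_affine[of "\<lambda>x. ennreal (\<rho> x)" "-1" 0] by simp
  then show "(\<integral>\<^sup>+x. \<rho> (x - y) \<partial>lborel) = 1"
    using nn_integral_lborel_translate[of "\<lambda>x. ennreal (\<rho> x)" y] by simp
qed

text \<open>Jensen's inequality for the probability density \<open>\<rho> (x - y)\<close> in y: the
  tangent of t^p at the mean s of |f| is integrated, and its linear part has mean zero. An infinite
  right-hand side is split off because f is only locally integrable.\<close>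

lemma norm_moll_power_le:
  fixes f :: "'a \<Rightarrow> 'b::euclidean_space"
  assumes f: "locally_integrable_on f UNIV"
  shows "ennreal (norm (moll \<rho> f x) ^ p) \<le> (\<integral>\<^sup>+y. \<rho> (x - y) * norm (f y) ^ p \<partial>lborel)"
proof (cases "(\<integral>\<^sup>+y. \<rho> (x - y) * norm (f y) ^ p \<partial>lborel) = \<infinity>")
  case False
  have [measurable]: "f \<in> borel_measurable borel" using f by (rule locally_integrable_borel)
  have ip: "integrable lborel (\<lambda>y. \<rho> (x - y) * norm (f y) ^ p)"
    using False by (intro integrableI_nonneg) (auto simp: nonneg less_top)
  have "integrable lborel (\<lambda>y. norm (\<rho> (x - y) *\<^sub>R f y))"
    by (intro integrable_norm integrable_moll[OF f cont support])
  then have i1: "integrable lborel (\<lambda>y. \<rho> (x - y) * norm (f y))"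
    by (simp add: nonneg)
  define s where "s = (\<integral>y. \<rho> (x - y) * norm (f y) \<partial>lborel)"
  have s0: "s \<ge> 0" unfolding s_def by (intro Bochner_Integration.integral_nonneg) (auto simp: nonneg)
  let ?g = "\<lambda>y. \<rho> (x - y) * s ^ p + (real p * s ^ (p - 1)) * (\<rho> (x - y) * norm (f y) - \<rho> (x - y) * s)"
  have "norm (moll \<rho> f x) \<le> s"
    unfolding moll_def s_def by (rule order_trans[OF integral_norm_bound]) (simp add: nonneg)
  then have "norm (moll \<rho> f x) ^ p \<le> s ^ p" by (intro power_mono) auto
  also have "s ^ p = (\<integral>y. ?g y \<partial>lborel)"
    using i1 integrable_shift[of x] mass_shift[of x] by (simp add: s_def)
  also have "\<dots> \<le> (\<integral>y. \<rho> (x - y) * norm (f y) ^ p \<partial>lborel)"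
  proof (rule Bochner_Integration.integral_mono)
    show "integrable lborel ?g" using i1 integrable_shift[of x] by simp
    show "?g y \<le> \<rho> (x - y) * norm (f y) ^ p" for y
      using mult_left_mono[OF power_tangent_le[OF s0 norm_ge_zero[of "f y"], of p] nonneg[of "x - y"]]
      by (simp add: algebra_simps)
  qed (rule ip)
  finally have "norm (moll \<rho> f x) ^ p \<le> (\<integral>y. \<rho> (x - y) * norm (f y) ^ p \<partial>lborel)" .
  then show ?thesis
    by (subst nn_integral_eq_integral[OF ip]) (auto simp: nonneg ennreal_leI)
qed simp

text \<open>Tonelli's theorem and the unit mass of the kernel in its other variable: mollification
  does not increase the L^p norm.\<close>

lemma nn_integral_norm_moll_power_le:
  fixes f :: "'a \<Rightarrow> 'b::euclidean_space"
  assumes f: "locally_integrable_on f UNIV"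
  shows "(\<integral>\<^sup>+x. norm (moll \<rho> f x) ^ p \<partial>lborel) \<le> (\<integral>\<^sup>+x. norm (f x) ^ p \<partial>lborel)"
proof -
  have [measurable]: "f \<in> borel_measurable borel" using f by (rule locally_integrable_borel)
  have "(\<integral>\<^sup>+x. norm (moll \<rho> f x) ^ p \<partial>lborel)
      \<le> (\<integral>\<^sup>+x. (\<integral>\<^sup>+y. \<rho> (x - y) * norm (f y) ^ p \<partial>lborel) \<partial>lborel)"
    by (intro nn_integral_mono norm_moll_power_le f)
  also have "\<dots> = (\<integral>\<^sup>+y. (\<integral>\<^sup>+x. \<rho> (x - y) * norm (f y) ^ p \<partial>lborel) \<partial>lborel)"
    by (rule lborel_pair.Fubini') measurable
  also have "\<dots> = (\<integral>\<^sup>+y. norm (f y) ^ p \<partial>lborel)"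
    using nn_mass_shift(2) by (simp add: ennreal_mult' nonneg nn_integral_multc)
  finally show ?thesis .
qed

lemma norm_moll_le:
  fixes f :: "'a \<Rightarrow> 'b::euclidean_space"
  assumes f: "locally_integrable_on f UNIV" and B: "\<And>x. norm (f x) \<le> B"
  shows "norm (moll \<rho> f x) \<le> B"
proof -
  have "norm (moll \<rho> f x) \<le> (\<integral>y. norm (\<rho> (x - y) *\<^sub>R f y) \<partial>lborel)"
    unfolding moll_def by (rule integral_norm_bound)
  also have "\<dots> \<le> (\<integral>y. \<rho> (x - y) * B \<partial>lborel)"
    using integrable_norm[OF integrable_moll[OF f cont support, where x = x]] integrable_shift
    by (intro Bochner_Integration.integral_mono) (auto simp: nonneg B mult_left_mono)
  also have "\<dots> = B" using integrable_shift mass_shift by simp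
  finally show ?thesis .
qed

lemma norm_moll_diff_le:
  fixes g :: "'a \<Rightarrow> 'b::euclidean_space"
  assumes g: "locally_integrable_on g UNIV" and e: "\<And>y. norm (x - y) \<le> r \<Longrightarrow> norm (g y - g x) \<le> e"
  shows "norm (moll \<rho> g x - g x) \<le> e"
proof -
  have i1: "integrable lborel (\<lambda>y. \<rho> (x - y) *\<^sub>R g y)" by (rule integrable_moll[OF g cont support])
  have i2: "integrable lborel (\<lambda>y. \<rho> (x - y) *\<^sub>R g x)" using integrable_shift by (rule integrable_scaleR_left)
  have "moll \<rho> g x - g x = (\<integral>y. \<rho> (x - y) *\<^sub>R g y - \<rho> (x - y) *\<^sub>R g x \<partial>lborel)"
    using i1 i2 integrable_shift[of x] mass_shift[of x] by (simp add: moll_def)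
  also have "\<dots> = (\<integral>y. \<rho> (x - y) *\<^sub>R (g y - g x) \<partial>lborel)" by (simp add: scaleR_diff_right)
  also have "norm \<dots> \<le> (\<integral>y. norm (\<rho> (x - y) *\<^sub>R (g y - g x)) \<partial>lborel)" by (rule integral_norm_bound)
  also have "\<dots> \<le> (\<integral>y. \<rho> (x - y) * e \<partial>lborel)"
  proof (rule Bochner_Integration.integral_mono)
    have "integrable lborel (\<lambda>y. \<rho> (x - y) *\<^sub>R (g y - g x))"
      unfolding scaleR_diff_right using i1 i2 by (rule Bochner_Integration.integrable_diff)
    then show "integrable lborel (\<lambda>y. norm (\<rho> (x - y) *\<^sub>R (g y - g x)))" by (rule integrable_norm)
    show "norm (\<rho> (x - y) *\<^sub>R (g y - g x)) \<le> \<rho> (x - y) * e" for y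
      using e[of y] nonneg[of "x - y"] support[of "x - y"]
      by (cases "norm (x - y) \<le> r") (auto intro: mult_left_mono)
  qed (use integrable_shift in simp)
  also have "\<dots> = e" using integrable_shift mass_shift by simp
  finally show ?thesis .
qed

end

lemma integrable_imp_locally_integrable:
  fixes f :: "'a::euclidean_space \<Rightarrow> 'b::euclidean_space"
  assumes "integrable lborel f" shows "locally_integrable_on f UNIV"
  using assms unfolding locally_integrable_on_def set_integrable_def
  by (auto intro!: integrable_mult_indicator compact_imp_closed borel_closed)

section \<open>The standard mollifiers\<close>

definition std_bump :: "'a::euclidean_space \<Rightarrow> real" where
  "std_bump x = flat_exp 1 (1 - x \<bullet> x)"

definition std_moll :: "nat \<Rightarrow> 'a::euclidean_space \<Rightarrow> real" where
  "std_moll j x = real (Suc j) ^ DIM('a) / (\<integral>y. std_bump (y::'a) \<partial>lborel) * std_bump (real (Suc j) *\<^sub>R x)"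

lemma std_moll: "mollifier_kernel (std_moll j :: 'a::euclidean_space \<Rightarrow> real) (1 / real (Suc j))"
proof
  have sm: "C_k k (std_bump :: 'a \<Rightarrow> real)" for k
    unfolding std_bump_def[abs_def] by (rule C_k_flat_exp)
  have c: "continuous_on UNIV (std_bump :: 'a \<Rightarrow> real)" using sm by (rule C_k_imp_continuous)
  have [measurable]: "(std_bump :: 'a \<Rightarrow> real) \<in> borel_measurable borel"
    using c by (rule borel_measurable_continuous_onI)
  have nn: "std_bump x \<ge> 0" for x :: 'a by (simp add: std_bump_def flat_exp_def)
  have z: "std_bump x = 0" if "norm x > 1" for x :: 'a
  proof -
    have "norm x * norm x > 1 * 1" using that by (intro mult_strict_mono) auto
    then show ?thesis by (simp add: std_bump_def flat_exp_def dot_square_norm power2_eq_square)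
  qed
  obtain B where B: "\<And>x::'a. norm (std_bump x) \<le> B" using continuous_bounded_support[OF c z] by blast
  have i: "integrable lborel (std_bump :: 'a \<Rightarrow> real)"
    by (rule integrable_bounded_cball[of _ B 1]) (use B z in auto)
  let ?m = "\<integral>y. std_bump (y::'a) \<partial>lborel"
  \<comment> \<open>The normalising constant does not vanish: the bump is positive on the open unit
    ball, a set of positive measure.\<close>
  have "?m \<noteq> 0"
  proof
    assume "?m = 0"
    then have "AE x in lborel. std_bump (x::'a) = 0"
      using integral_nonneg_eq_0_iff_AE[OF i] nn by auto
    moreover have "AE x in lborel. x \<in> ball (0::'a) 1 \<longrightarrow> std_bump x \<noteq> 0"
    proof (intro AE_I2 impI)
      fix x :: 'a assume "x \<in> ball 0 1"
      then have "x \<bullet> x < 1" by (simp add: dot_square_norm abs_square_less_1)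
      then show "std_bump x \<noteq> 0" by (simp add: std_bump_def flat_exp_def)
    qed
    ultimately have "AE x in lborel. x \<notin> ball (0::'a) 1" by eventually_elim auto
    then have "emeasure lborel {x::'a. norm x < 1} = 0"
      by (subst (asm) AE_iff_measurable[OF _ refl]) auto
    then have "emeasure lborel (ball (0::'a) 1) = 0"
      by (simp add: ball_def)
    then show False using emeasure_ball[of 1 "0::'a"] unit_ball_vol_pos[of "real DIM('a)"] by simp
  qed
  moreover have "?m \<ge> 0" using nn by (intro Bochner_Integration.integral_nonneg) auto
  ultimately have m: "?m > 0" by simp
  show "C_k k (std_moll j :: 'a \<Rightarrow> real)" for k
    using C_k_mult[OF C_k_const[of k "real (Suc j) ^ DIM('a) / ?m"] C_k_affine[OF sm, of k 0 "real (Suc j)"]]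
    unfolding std_moll_def[abs_def] by (simp only: add_0_left)
  show "std_moll j x \<ge> 0" for x :: 'a using m nn by (simp add: std_moll_def)
  show "std_moll j x = 0" if "norm x > 1 / real (Suc j)" for x :: 'a
    using that z[of "real (Suc j) *\<^sub>R x"] by (simp add: std_moll_def divide_simps mult.commute)
  have "(\<integral>x. std_moll j (x::'a) \<partial>lborel) = real (Suc j) ^ DIM('a) / ?m * (\<integral>x. std_bump (real (Suc j) *\<^sub>R (x::'a)) \<partial>lborel)"
    unfolding std_moll_def by simp
  also have "\<dots> = (real (Suc j) ^ DIM('a) * (\<integral>x. std_bump (real (Suc j) *\<^sub>R (x::'a)) \<partial>lborel)) / ?m"
    by (simp only: times_divide_eq_left)
  also have "real (Suc j) ^ DIM('a) * (\<integral>x. std_bump (real (Suc j) *\<^sub>R (x::'a)) \<partial>lborel) = ?m"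
    using integral_lborel_affine[of "std_bump :: 'a \<Rightarrow> real" "real (Suc j)" 0] by (simp del: of_nat_Suc)
  also have "?m / ?m = 1" using m by simp
  finally show "(\<integral>x. std_moll j (x::'a) \<partial>lborel) = 1" .
qed

text \<open>Truncating f in its values and in space costs little in L^1. Measurability provides
  continuous functions that converge to f almost everywhere; after the same truncation they are
  dominated by a multiple of one indicator and converge in L^1 as well.\<close>

lemma continuous_dense_L1:
  fixes f :: "'a::euclidean_space \<Rightarrow> 'b::euclidean_space"
  assumes f: "integrable lborel f" and "e > 0"
  obtains g R where "continuous_on UNIV g" "\<And>x. norm x > R \<Longrightarrow> g x = 0"
    "(\<integral>x. norm (f x - g x) \<partial>lborel) < e"
proof -
  have [measurable]: "f \<in> borel_measurable borel" using f by auto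
  \<comment> \<open>The radial retraction onto the ball of radius M, a continuous way to bound the
    values.\<close>
  define T :: "real \<Rightarrow> 'b \<Rightarrow> 'b" where "T M z = (M / max M (norm z)) *\<^sub>R z" for M z
  define cut :: "real \<Rightarrow> 'a \<Rightarrow> real" where "cut M x = max 0 (min 1 (M + 1 - norm x))" for M x
  have Tle: "norm (T M z) \<le> M" "norm (T M z) \<le> norm z" if "M > 0" for M z
    using that by (auto simp: T_def field_simps max_def)
  have T_id: "T M z = z" if "M \<ge> norm z" "M > 0" for M z using that by (simp add: T_def max_def)
  have Tc: "continuous_on UNIV (T M)" if "M > 0" for M
    unfolding T_def[abs_def] using that by (intro continuous_intros) (auto simp: max_def)
  have cutc: "continuous_on UNIV (cut M)" for M unfolding cut_def[abs_def] by (intro continuous_intros)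
  have cut01: "0 \<le> cut M x" "cut M x \<le> 1" "norm x > M + 1 \<Longrightarrow> cut M x = 0" "norm x \<le> M \<Longrightarrow> cut M x = 1" for M x
    by (auto simp: cut_def)
  have [measurable]: "T M \<in> borel_measurable borel" if "M > 0" for M
    using Tc[OF that] by (rule borel_measurable_continuous_onI)
  have [measurable]: "cut M \<in> borel_measurable borel" for M
    using cutc by (rule borel_measurable_continuous_onI)
  have "(\<lambda>M. \<integral>x. norm (f x - cut (real (Suc M)) x *\<^sub>R T (real (Suc M)) (f x)) \<partial>lborel) \<longlonglongrightarrow> (\<integral>x. 0 \<partial>(lborel :: 'a measure))"
  proof (rule integral_dominated_convergence[where w = "\<lambda>x. 2 * norm (f x)"])
    show "AE x in lborel. (\<lambda>M. norm (f x - cut (real (Suc M)) x *\<^sub>R T (real (Suc M)) (f x))) \<longlonglongrightarrow> 0"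
    proof (intro AE_I2 tendsto_eventually)
      fix x
      show "eventually (\<lambda>M. norm (f x - cut (real (Suc M)) x *\<^sub>R T (real (Suc M)) (f x)) = 0) sequentially"
        using eventually_norm_le[of x] eventually_norm_le[of "f x"]
        by eventually_elim (auto simp: cut01 T_id)
    qed
    show "AE x in lborel. norm (norm (f x - cut (real (Suc M)) x *\<^sub>R T (real (Suc M)) (f x))) \<le> 2 * norm (f x)" for M
    proof (intro AE_I2)
      fix x
      have "norm (cut (real (Suc M)) x *\<^sub>R T (real (Suc M)) (f x)) \<le> 1 * norm (f x)"
        unfolding norm_scaleR using cut01 Tle by (intro mult_mono) auto
      then show "norm (norm (f x - cut (real (Suc M)) x *\<^sub>R T (real (Suc M)) (f x))) \<le> 2 * norm (f x)"
        using norm_triangle_ineq4[of "f x" "cut (real (Suc M)) x *\<^sub>R T (real (Suc M)) (f x)"]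
        unfolding real_norm_def abs_norm_cancel by linarith
    qed
  qed (use f in auto)
  then have "eventually (\<lambda>M. (\<integral>x. norm (f x - cut (real (Suc M)) x *\<^sub>R T (real (Suc M)) (f x)) \<partial>lborel) < e / 2) sequentially"
    using \<open>e > 0\<close> by (intro order_tendstoD) auto
  then obtain M where M: "M > 0" "(\<integral>x. norm (f x - cut M x *\<^sub>R T M (f x)) \<partial>lborel) < e / 2"
    unfolding eventually_sequentially using that[of "real (Suc _)"] by (auto simp del: of_nat_Suc)
  have "f measurable_on UNIV"
    by (rule lebesgue_measurable_imp_measurable_on) (auto intro: measurable_completion)
  then obtain N g where N: "negligible N" and g: "\<And>n. continuous_on UNIV (g n)"
    and lim: "\<And>x. x \<notin> N \<Longrightarrow> (\<lambda>n. g n x) \<longlonglongrightarrow> f x"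
    unfolding measurable_on_def by auto
  have [measurable]: "g n \<in> borel_measurable borel" for n
    using g by (rule borel_measurable_continuous_onI)
  have ae: "AE x in lborel. x \<notin> N"
    using N AE_not_in[of N lebesgue] AE_completion_iff[of "\<lambda>x. x \<notin> N" lborel]
    by (auto simp: negligible_iff_null_sets)
  define h where "h n x = cut M x *\<^sub>R T M (g n x)" for n x
  have hM: "norm (cut M x *\<^sub>R T M z) \<le> M" for x z
    using mult_mono[OF cut01(2)[of M x] Tle(1)[OF M(1), of z]] cut01(1)[of M x] M(1) by simp
  have bnd: "norm (cut M x *\<^sub>R T M z - cut M x *\<^sub>R T M y) \<le> 2 * M" for x y z
    using norm_triangle_ineq4[of "cut M x *\<^sub>R T M z" "cut M x *\<^sub>R T M y"] hM[of x z] hM[of x y] by linarith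
  have [measurable]: "T M \<in> borel_measurable borel"
    using Tc[OF M(1)] by (rule borel_measurable_continuous_onI)
  have "(\<lambda>n. \<integral>x. norm (cut M x *\<^sub>R T M (f x) - h n x) \<partial>lborel) \<longlonglongrightarrow> (\<integral>x. 0 \<partial>(lborel :: 'a measure))"
  proof (rule integral_dominated_convergence[where w = "\<lambda>x. indicator (cball 0 (M + 1)) x * (2 * M)"])
    show "integrable lborel (\<lambda>x::'a. indicator (cball 0 (M + 1)) x * (2 * M))"
      by (rule integrable_bounded_cball[of _ "2 * M" "M + 1"]) (use M in \<open>auto simp: indicator_def\<close>)
    show "AE x in lborel. (\<lambda>n. norm (cut M x *\<^sub>R T M (f x) - h n x)) \<longlonglongrightarrow> 0"
      using ae
    proof eventually_elim
      fix x assume "x \<notin> N"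
      have "(\<lambda>n. T M (g n x)) \<longlonglongrightarrow> T M (f x)"
        using continuous_on_tendsto_compose[OF Tc[OF M(1)] lim[OF \<open>x \<notin> N\<close>]] by simp
      then have "(\<lambda>n. norm (cut M x *\<^sub>R T M (f x) - h n x)) \<longlonglongrightarrow> norm (cut M x *\<^sub>R T M (f x) - cut M x *\<^sub>R T M (f x))"
        unfolding h_def by (intro tendsto_intros)
      then show "(\<lambda>n. norm (cut M x *\<^sub>R T M (f x) - h n x)) \<longlonglongrightarrow> 0" by simp
    qed
    show "AE x in lborel. norm (norm (cut M x *\<^sub>R T M (f x) - h n x)) \<le> indicator (cball 0 (M + 1)) x * (2 * M)" for n
      unfolding h_def using bnd cut01(3)[of M] by (intro AE_I2) (auto simp: indicator_def)
  qed (auto simp: h_def)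
  then have "eventually (\<lambda>n. (\<integral>x. norm (cut M x *\<^sub>R T M (f x) - h n x) \<partial>lborel) < e / 2) sequentially"
    using \<open>e > 0\<close> by (intro order_tendstoD) auto
  then obtain n where n: "(\<integral>x. norm (cut M x *\<^sub>R T M (f x) - h n x) \<partial>lborel) < e / 2"
    by (auto simp: eventually_sequentially)
  have i: "integrable lborel (\<lambda>x. cut M x *\<^sub>R T M (k x))" if [measurable]: "k \<in> borel_measurable borel" for k
    by (rule integrable_bounded_cball[of _ M "M + 1"]) (use hM cut01(3) in auto)
  have ih: "integrable lborel (h n)" and ifT: "integrable lborel (\<lambda>x. cut M x *\<^sub>R T M (f x))"
    unfolding h_def[abs_def] by (intro i; measurable)+
  have "(\<integral>x. norm (f x - h n x) \<partial>lborel) \<le>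
      (\<integral>x. norm (f x - cut M x *\<^sub>R T M (f x)) + norm (cut M x *\<^sub>R T M (f x) - h n x) \<partial>lborel)"
  proof (rule Bochner_Integration.integral_mono)
    show "norm (f x - h n x) \<le> norm (f x - cut M x *\<^sub>R T M (f x)) + norm (cut M x *\<^sub>R T M (f x) - h n x)" for x
      using norm_triangle_ineq[of "f x - cut M x *\<^sub>R T M (f x)" "cut M x *\<^sub>R T M (f x) - h n x"] by simp
  qed (use f ih ifT in auto)
  also have "\<dots> < e" using f ih ifT M n by simp
  finally have "(\<integral>x. norm (f x - h n x) \<partial>lborel) < e" .
  moreover have "continuous_on UNIV (h n)"
    unfolding h_def[abs_def] using continuous_on_compose2[OF Tc[OF M(1)] g[of n]] cutc
    by (intro continuous_on_scaleR) auto
  moreover have "h n x = 0" if "norm x > M + 1" for x using that cut01(3) by (simp add: h_def)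
  ultimately show ?thesis using that by blast
qed

lemma continuous_imp_locally_integrable:
  fixes f :: "'a::euclidean_space \<Rightarrow> 'b::euclidean_space"
  assumes "continuous_on UNIV f"
  shows "locally_integrable_on f UNIV"
  unfolding locally_integrable_on_def set_integrable_def
  by (intro allI impI borel_integrable_compact continuous_on_subset[OF assms]) auto

lemma moll_diff:
  assumes "integrable lborel (\<lambda>y. \<rho> (x - y) *\<^sub>R f y)" "integrable lborel (\<lambda>y. \<rho> (x - y) *\<^sub>R g y)"
  shows "moll \<rho> (\<lambda>y. f y - g y) x = moll \<rho> f x - moll \<rho> g x"
  unfolding moll_def using assms by (simp add: scaleR_diff_right)

lemma integrable_moll_function:
  fixes f :: "'a::euclidean_space \<Rightarrow> 'b::euclidean_space"
  assumes "mollifier_kernel \<rho> r" and f: "integrable lborel f"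
  shows "integrable lborel (moll \<rho> f)" "(\<integral>x. norm (moll \<rho> f x) \<partial>lborel) \<le> (\<integral>x. norm (f x) \<partial>lborel)"
proof -
  interpret mollifier_kernel \<rho> r by fact
  have [measurable]: "f \<in> borel_measurable borel" using f by auto
  have le: "(\<integral>\<^sup>+x. norm (moll \<rho> f x) \<partial>lborel) \<le> (\<integral>\<^sup>+x. norm (f x) \<partial>lborel)"
    using nn_integral_norm_moll_power_le[OF integrable_imp_locally_integrable[OF f], of 1] by simp
  have fin: "(\<integral>\<^sup>+x. norm (f x) \<partial>lborel) < \<infinity>" using f by (simp add: integrable_iff_bounded)
  show i: "integrable lborel (moll \<rho> f)"
    using le fin by (simp add: integrable_iff_bounded) 
  show "(\<integral>x. norm (moll \<rho> f x) \<partial>lborel) \<le> (\<integral>x. norm (f x) \<partial>lborel)"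
    using le fin integrable_norm[OF i] integrable_norm[OF f]
    by (simp add: nn_integral_eq_integral ennreal_le_iff)
qed

text \<open>Mollification contracts L^1 distances, so f may be replaced by a continuous g of bounded
  support, for which uniform continuity makes the error small on a fixed ball.\<close>

theorem std_moll_tendsto_L1:
  fixes f :: "'a::euclidean_space \<Rightarrow> 'b::euclidean_space"
  assumes f: "integrable lborel f"
  shows "(\<lambda>j. \<integral>x. norm (moll (std_moll j) f x - f x) \<partial>lborel) \<longlonglongrightarrow> 0"
proof (rule LIMSEQ_I)
  fix e :: real assume "e > 0"
  have kernel: "mollifier_kernel (std_moll j :: 'a \<Rightarrow> real) (1 / real (Suc j))" for j by (rule std_moll)
  obtain g R where g: "continuous_on UNIV g" "\<And>x. norm x > R \<Longrightarrow> g x = 0"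
    and fg: "(\<integral>x. norm (f x - g x) \<partial>lborel) < e / 3"
    using continuous_dense_L1[OF f, of "e / 3"] \<open>e > 0\<close> by (metis zero_less_divide_iff zero_less_numeral)
  obtain B where B: "\<And>x. norm (g x) \<le> B" using continuous_bounded_support[OF g] by blast
  have [measurable]: "g \<in> borel_measurable borel" using g(1) by (rule borel_measurable_continuous_onI)
  have ig: "integrable lborel g"
    by (rule integrable_bounded_cball[of _ B R]) (use B g(2) in auto)
  define V where "V = measure lborel (cball (0::'a) (R + 1))"
  \<comment> \<open>The uniform error of g times the volume of a ball containing the supports of g
    and of its mollification stays below e/3.\<close>
  define \<delta> where "\<delta> = e / (3 * (V + 1))"
  have \<delta>: "\<delta> > 0" "\<delta> * V < e / 3" using \<open>e > 0\<close> measure_nonneg[of lborel "cball (0::'a) (R + 1)"]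
    by (auto simp: \<delta>_def V_def field_simps add_pos_nonneg)
  obtain d where d: "d > 0" "d \<le> 1" "\<And>x y. dist x y < d \<Longrightarrow> dist (g x) (g y) < \<delta>"
    using continuous_uniform_support[OF g \<delta>(1)] by blast
  obtain j0 where j0: "1 / real (Suc j0) < d" using nat_approx_posE[OF d(1)] by auto
  have "(\<integral>x. norm (moll (std_moll j) f x - f x) \<partial>lborel) < e" if "j \<ge> j0" for j
  proof -
    interpret mollifier_kernel "std_moll j :: 'a \<Rightarrow> real" "1 / real (Suc j)" by (rule kernel)
    let ?\<rho> = "std_moll j :: 'a \<Rightarrow> real"
    have "1 / real (Suc j) \<le> 1 / real (Suc j0)" using that by (simp add: frac_le)
    then have jd: "1 / real (Suc j) < d" using j0 by linarith
    have lf: "locally_integrable_on f UNIV" and lg: "locally_integrable_on g UNIV"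
      using f ig by (auto intro: integrable_imp_locally_integrable)
    have mfg: "moll ?\<rho> (\<lambda>y. f y - g y) x = moll ?\<rho> f x - moll ?\<rho> g x" for x
      by (intro moll_diff integrable_moll[OF lf cont support] integrable_moll[OF lg cont support])
    have ifg: "integrable lborel (\<lambda>y. f y - g y)" using f ig by auto
    note i = integrable_moll_function[OF kernel[of j] f] integrable_moll_function[OF kernel[of j] ig]
       integrable_moll_function[OF kernel[of j] ifg]
    have gg: "norm (moll ?\<rho> g x - g x) \<le> \<delta> * indicator (cball 0 (R + 1)) x" for x
    proof (cases "norm x \<le> R + 1")
      case True
      have "norm (moll ?\<rho> g x - g x) \<le> \<delta>"
        by (rule norm_moll_diff_le[OF lg]) (use d(3)[of _ x] jd in \<open>auto simp: dist_norm norm_minus_commute less_imp_le\<close>)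
      then show ?thesis using True by simp
    next
      case False
      then have "moll ?\<rho> g x = 0" using jd d by (intro moll_eq_0[OF support g(2)]) auto
      then show ?thesis using False g(2)[of x] \<delta>(1) by simp
    qed
    have iI: "integrable lborel (\<lambda>x. \<delta> * indicator (cball (0::'a) (R + 1)) x)"
      by (rule integrable_bounded_cball[of _ \<delta> "R + 1"]) (use \<delta>(1) in \<open>auto simp: indicator_def\<close>)
    have "(\<integral>x. norm (moll ?\<rho> f x - f x) \<partial>lborel) \<le>
       (\<integral>x. norm (moll ?\<rho> (\<lambda>y. f y - g y) x) + \<delta> * indicator (cball 0 (R + 1)) x + norm (f x - g x) \<partial>lborel)"
    proof (rule Bochner_Integration.integral_mono)
      fix x
      have "moll ?\<rho> f x - f x = moll ?\<rho> (\<lambda>y. f y - g y) x + (moll ?\<rho> g x - g x) - (f x - g x)" by (simp add: mfg)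
      then have "norm (moll ?\<rho> f x - f x) \<le> norm (moll ?\<rho> (\<lambda>y. f y - g y) x) + norm (moll ?\<rho> g x - g x) + norm (f x - g x)"
        using norm_triangle_ineq4[of "moll ?\<rho> (\<lambda>y. f y - g y) x + (moll ?\<rho> g x - g x)" "f x - g x"]
          norm_triangle_ineq[of "moll ?\<rho> (\<lambda>y. f y - g y) x" "moll ?\<rho> g x - g x"] by simp
      then show "norm (moll ?\<rho> f x - f x) \<le> norm (moll ?\<rho> (\<lambda>y. f y - g y) x) + \<delta> * indicator (cball 0 (R + 1)) x + norm (f x - g x)"
        using gg[of x] by linarith
    qed (use i ifg f iI in auto)
    also have "\<dots> = (\<integral>x. norm (moll ?\<rho> (\<lambda>y. f y - g y) x) \<partial>lborel) + \<delta> * V + (\<integral>x. norm (f x - g x) \<partial>lborel)"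
      using i ifg iI by (simp add: V_def)
    also have "\<dots> < e" using i(6) fg \<delta>(2) by linarith
    finally show ?thesis .
  qed
  then show "\<exists>no. \<forall>n\<ge>no. norm ((\<integral>x. norm (moll (std_moll n) f x - f x) \<partial>lborel) - 0) < e"
    by (auto simp: Bochner_Integration.integral_nonneg)
qed

text \<open>All standard mollifiers have support radius at most 1, so on the ball of radius K the
  mollification only sees f cut off at radius K + 1.\<close>

lemma std_moll_tendsto_L1_loc:
  fixes f :: "'a::euclidean_space \<Rightarrow> 'b::euclidean_space"
  assumes f: "locally_integrable_on f UNIV"
  shows "(\<lambda>j. \<integral>x. indicator (cball 0 K) x * norm (moll (std_moll j) f x - f x) \<partial>lborel) \<longlonglongrightarrow> 0"
    "integrable lborel (\<lambda>x. indicator (cball 0 K) x *\<^sub>R (moll (std_moll j) f x - f x))"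
    "integrable lborel (\<lambda>x. indicator (cball 0 K) x * norm (moll (std_moll j) f x - f x))"
proof -
  have [measurable]: "f \<in> borel_measurable borel" using f by (rule locally_integrable_borel)
  let ?f = "\<lambda>y. indicator (cball 0 (K + 1)) y *\<^sub>R f y"
  have i: "integrable lborel ?f" by (rule locally_integrable_onD[OF f])
  have eq: "moll (std_moll j) f x = moll (std_moll j) ?f x" if "norm x \<le> K" for x j
  proof (rule moll_cong_cball[OF _ that])
    interpret mollifier_kernel "std_moll j :: 'a \<Rightarrow> real" "1 / real (Suc j)" by (rule std_moll)
    show "std_moll j y = 0" if "norm y > 1" for y :: 'a
    proof (rule support)
      have "1 / real (Suc j) \<le> 1" by simp
      then show "norm y > 1 / real (Suc j)" using that by linarith
    qed
  qed
  have eq': "indicator (cball 0 K) x *\<^sub>R (moll (std_moll j) f x - f x)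
      = indicator (cball 0 K) x *\<^sub>R (moll (std_moll j) ?f x - ?f x)" for x j
    using eq[of x j] by (auto simp: indicator_def)
  have ij: "integrable lborel (\<lambda>x. moll (std_moll j) ?f x - ?f x)" for j
    using integrable_moll_function(1)[OF std_moll i] i by auto
  show ii: "integrable lborel (\<lambda>x. indicator (cball 0 K) x *\<^sub>R (moll (std_moll j) f x - f x))" for j
    unfolding eq' using ij by (intro integrable_mult_indicator) auto
  have eq'': "indicator (cball 0 K) x * norm (moll (std_moll j) f x - f x)
     = norm (indicator (cball 0 K) x *\<^sub>R (moll (std_moll j) f x - f x))" for x j by simp
  show "integrable lborel (\<lambda>x. indicator (cball 0 K) x * norm (moll (std_moll j) f x - f x))"
    unfolding eq'' using ii by (rule integrable_norm)
  show "(\<lambda>j. \<integral>x. indicator (cball 0 K) x * norm (moll (std_moll j) f x - f x) \<partial>lborel) \<longlonglongrightarrow> 0"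
  proof (rule tendsto_sandwich[OF _ _ tendsto_const std_moll_tendsto_L1[OF i]])
    show "eventually (\<lambda>j. 0 \<le> (\<integral>x. indicator (cball 0 K) x * norm (moll (std_moll j) f x - f x) \<partial>lborel)) sequentially"
      by (intro always_eventually allI Bochner_Integration.integral_nonneg) auto
    show "eventually (\<lambda>j. (\<integral>x. indicator (cball 0 K) x * norm (moll (std_moll j) f x - f x) \<partial>lborel)
       \<le> (\<integral>x. norm (moll (std_moll j) ?f x - ?f x) \<partial>lborel)) sequentially"
      unfolding eq'' eq' using ii[unfolded eq'] ij
      by (intro always_eventually allI Bochner_Integration.integral_mono integrable_norm) (auto simp: indicator_def)
  qed
qed

section \<open>Functions that are Lipschitz on balls\<close>

lemma test_functionsE:
  assumes "\<phi> \<in> test_functions \<Omega>"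
  obtains K where "compact K" "K \<subseteq> \<Omega>" "\<And>x. x \<notin> K \<Longrightarrow> \<phi> x = 0" "\<And>x. x \<notin> K \<Longrightarrow> grad \<phi> x = 0"
    "\<And>k. C_k k \<phi>" "continuous_on UNIV \<phi>" "continuous_on UNIV (grad \<phi>)"
proof
  let ?K = "closure {x. \<phi> x \<noteq> 0}"
  have a: "\<And>k. C_k k \<phi>" "compact ?K" "?K \<subseteq> \<Omega>" using assms unfolding test_functions_def by auto
  then show "\<And>k. C_k k \<phi>" "compact ?K" "?K \<subseteq> \<Omega>" by auto
  show z: "\<phi> x = 0" if "x \<notin> ?K" for x using that closure_subset[of "{x. \<phi> x \<noteq> 0}"] by auto
  show "grad \<phi> x = 0" if "x \<notin> ?K" for x
  proof (rule GDERIV_eq_0_transform[OF test_functions_GDERIV[OF assms]])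
    show "open (- ?K)" by (rule open_Compl[OF closed_closure])
    show "x \<in> - ?K" using that by simp
    show "\<phi> y = 0" if "y \<in> - ?K" for y by (rule z) (use that in simp)
  qed
  show "continuous_on UNIV \<phi>" using a(1) by (rule C_k_imp_continuous)
  show "continuous_on UNIV (grad \<phi>)" using a(1) by (rule C_k_continuous_grad)
qed

text \<open>A class that contains the C^1 functions as well as truncations with a corner, such as
  the positive part of v minus a constant, and is closed under products. Differentiability almost
  everywhere is assumed separately, together with an explicit gradient.\<close>

definition lipschitz_on_balls :: "('a::euclidean_space \<Rightarrow> real) \<Rightarrow> bool" where
  "lipschitz_on_balls f \<longleftrightarrow> (\<forall>r. \<exists>L. L-lipschitz_on (cball 0 r) f)"

lemma lipschitz_on_balls_continuous:
  assumes "lipschitz_on_balls f" shows "continuous_on UNIV f"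
proof (rule continuous_at_imp_continuous_on, rule ballI)
  fix x :: 'a
  obtain L where "L-lipschitz_on (cball 0 (norm x + 1)) f" using assms unfolding lipschitz_on_balls_def by blast
  then have "continuous_on (ball 0 (norm x + 1)) f"
    by (rule continuous_on_subset[OF lipschitz_on_continuous_on]) auto
  then show "isCont f x" by (simp add: continuous_on_eq_continuous_at)
qed

lemma lipschitz_on_balls_bounded:
  assumes "lipschitz_on_balls f" obtains B where "B > 0" "\<And>x. norm x \<le> r \<Longrightarrow> \<bar>f x\<bar> \<le> B"
proof -
  have "compact (f ` cball 0 r)"
    by (intro compact_continuous_image continuous_on_subset[OF lipschitz_on_balls_continuous[OF assms]]) auto
  then obtain B where "B > 0" "\<And>y. y \<in> f ` cball 0 r \<Longrightarrow> norm y \<le> B"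
    using compact_imp_bounded bounded_pos by metis
  then show ?thesis by (intro that[of B]) auto
qed

lemma lipschitz_on_balls_mult:
  assumes f: "lipschitz_on_balls f" and g: "lipschitz_on_balls g"
  shows "lipschitz_on_balls (\<lambda>x. f x * g x)"
  unfolding lipschitz_on_balls_def
proof
  fix r
  obtain L M where L: "L-lipschitz_on (cball 0 r) f" "M-lipschitz_on (cball 0 r) g"
    using f g unfolding lipschitz_on_balls_def by blast
  obtain A where A: "A > 0" "\<And>x. norm x \<le> r \<Longrightarrow> \<bar>f x\<bar> \<le> A" using lipschitz_on_balls_bounded[OF f] by blast
  obtain B where B: "B > 0" "\<And>x. norm x \<le> r \<Longrightarrow> \<bar>g x\<bar> \<le> B" using lipschitz_on_balls_bounded[OF g] by blast
  have "(A * M + B * L)-lipschitz_on (cball 0 r) (\<lambda>x. f x * g x)"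
  proof (rule lipschitz_onI)
    fix x y :: 'a assume xy: "x \<in> cball 0 r" "y \<in> cball 0 r"
    have "\<bar>f x * g x - f y * g y\<bar> = \<bar>f x * (g x - g y) + g y * (f x - f y)\<bar>" by (simp add: algebra_simps)
    also have "\<dots> \<le> \<bar>f x\<bar> * \<bar>g x - g y\<bar> + \<bar>g y\<bar> * \<bar>f x - f y\<bar>"
      by (metis abs_mult abs_triangle_ineq)
    also have "\<dots> \<le> A * (M * dist x y) + B * (L * dist x y)"
      using xy A B lipschitz_onD[OF L(1) xy] lipschitz_onD[OF L(2) xy]
      by (intro add_mono mult_mono) (auto simp: dist_real_def)
    finally show "dist (f x * g x) (f y * g y) \<le> (A * M + B * L) * dist x y"
      by (simp add: dist_real_def algebra_simps)
  qed (use A B lipschitz_on_nonneg[OF L(1)] lipschitz_on_nonneg[OF L(2)] in auto)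
  then show "\<exists>L. L-lipschitz_on (cball 0 r) (\<lambda>x. f x * g x)" by blast
qed

lemma lipschitz_on_balls_diff:
  assumes "lipschitz_on_balls f" "lipschitz_on_balls g"
  shows "lipschitz_on_balls (\<lambda>x. f x - g x)"
  using assms unfolding lipschitz_on_balls_def by (blast intro: lipschitz_on_diff)

lemma lipschitz_on_balls_const: "lipschitz_on_balls (\<lambda>x. c)"
  unfolding lipschitz_on_balls_def using lipschitz_on_constant by blast

lemma lipschitz_on_balls_max:
  assumes "lipschitz_on_balls f"
  shows "lipschitz_on_balls (\<lambda>x. max (f x) c)"
  unfolding lipschitz_on_balls_def
proof
  fix r
  obtain L where L: "L-lipschitz_on (cball 0 r) f" using assms unfolding lipschitz_on_balls_def by blast
  have "L-lipschitz_on (cball 0 r) (\<lambda>x. max (f x) c)"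
  proof (rule lipschitz_onI)
    fix x y :: 'a assume xy: "x \<in> cball 0 r" "y \<in> cball 0 r"
    show "dist (max (f x) c) (max (f y) c) \<le> L * dist x y"
      using lipschitz_onD[OF L xy] by (auto simp: dist_real_def max_def)
  qed (rule lipschitz_on_nonneg[OF L])
  then show "\<exists>L. L-lipschitz_on (cball 0 r) (\<lambda>x. max (f x) c)" by blast
qed

lemma onorm_inner_le: "onorm (\<lambda>h::'a::euclidean_space. h \<bullet> D) \<le> norm D"
  by (rule onorm_le) (metis Cauchy_Schwarz_ineq2 mult.commute real_norm_def)

lemma C1_lipschitz_on_balls:
  assumes "\<And>x. GDERIV f x :> D x" "continuous_on UNIV D"
  shows "lipschitz_on_balls f"
  unfolding lipschitz_on_balls_def
proof
  fix r :: real
  have "compact (D ` cball 0 r)"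
    by (intro compact_continuous_image continuous_on_subset[OF assms(2)]) auto
  then obtain B where B: "B > 0" "\<And>y. y \<in> D ` cball 0 r \<Longrightarrow> norm y \<le> B"
    using compact_imp_bounded bounded_pos by metis
  have "B-lipschitz_on (cball 0 r) f"
  proof (rule bounded_derivative_imp_lipschitz[where f' = "\<lambda>x h. h \<bullet> D x"])
    show "(f has_derivative (\<lambda>h. h \<bullet> D x)) (at x within cball 0 r)" for x
      using assms(1)[of x] unfolding gderiv_def by (rule has_derivative_at_withinI)
    show "onorm (\<lambda>h. h \<bullet> D x) \<le> B" if "x \<in> cball 0 r" for x
      using order_trans[OF onorm_inner_le B(2)] that by auto
  qed (use B in auto)
  then show "\<exists>L. L-lipschitz_on (cball 0 r) f" by blast
qed

lemma GDERIV_difference_quotient: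
  assumes "GDERIV f x :> D"
  shows "(\<lambda>n. real (Suc n) * (f (x + (1 / real (Suc n)) *\<^sub>R b) - f x)) \<longlonglongrightarrow> b \<bullet> D"
proof -
  have "((\<lambda>t. x + t *\<^sub>R b) has_derivative (\<lambda>t. t *\<^sub>R b)) (at 0)" by (auto intro!: derivative_eq_intros)
  moreover have "(f has_derivative (\<lambda>h. h \<bullet> D)) (at (x + 0 *\<^sub>R b))" using assms by (simp add: gderiv_def)
  ultimately have "((\<lambda>t. f (x + t *\<^sub>R b)) has_derivative (\<lambda>t. (t *\<^sub>R b) \<bullet> D)) (at 0)"
    by (rule has_derivative_compose)
  then have "((\<lambda>t. f (x + t *\<^sub>R b)) has_real_derivative (b \<bullet> D)) (at 0)"
    by (rule has_derivative_imp_has_field_derivative) simp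
  then have "((\<lambda>h. (f (x + h *\<^sub>R b) - f x) / h) \<longlongrightarrow> b \<bullet> D) (at 0)"
    by (simp add: DERIV_def)
  moreover have "filterlim (\<lambda>n. 1 / real (Suc n)) (at 0) sequentially"
    unfolding filterlim_at using LIMSEQ_inverse_real_of_nat by (auto simp: inverse_eq_divide)
  ultimately have "(\<lambda>n. (f (x + (1 / real (Suc n)) *\<^sub>R b) - f x) / (1 / real (Suc n))) \<longlonglongrightarrow> b \<bullet> D"
    by (rule filterlim_compose)
  then show ?thesis by (simp add: mult.commute)
qed

lemma lipschitz_difference_quotient_le:
  assumes "L-lipschitz_on (cball 0 (r + 1)) f" "norm x \<le> r" "norm b \<le> 1"
  shows "\<bar>real (Suc n) * (f (x + (1 / real (Suc n)) *\<^sub>R b) - f x)\<bar> \<le> L * norm b"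
proof -
  have le1: "norm ((1 / real (Suc n)) *\<^sub>R b) \<le> 1"
    using assms(3) by (simp add: divide_simps)
  have "dist (f (x + (1 / real (Suc n)) *\<^sub>R b)) (f x) \<le> L * dist (x + (1 / real (Suc n)) *\<^sub>R b) x"
    using le1 assms(2) norm_triangle_ineq[of x "(1 / real (Suc n)) *\<^sub>R b"]
    by (intro lipschitz_onD[OF assms(1)]) (simp_all del: norm_scaleR)
  also have "dist (x + (1 / real (Suc n)) *\<^sub>R b) x = norm b / real (Suc n)" by (simp add: dist_norm)
  finally have "real (Suc n) * \<bar>f (x + (1 / real (Suc n)) *\<^sub>R b) - f x\<bar> \<le> L * norm b"
    by (simp add: dist_real_def field_simps del: of_nat_Suc)
  then show ?thesis unfolding abs_mult by (simp del: of_nat_Suc)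
qed

text \<open>The difference quotients in the direction of D itself tend to |D| and are at most
  L.\<close>

lemma norm_gradient_le_lipschitz:
  assumes "L-lipschitz_on (cball 0 (r + 1)) f" "norm x \<le> r" "GDERIV f x :> D"
  shows "norm D \<le> L"
proof (cases "D = 0")
  case False
  define b where "b = D /\<^sub>R norm D"
  have b: "norm b = 1" "b \<bullet> D = norm D" using False by (auto simp: b_def dot_square_norm power2_eq_square)
  have "b \<bullet> D \<le> L * norm b"
  proof (rule LIMSEQ_le_const2[OF GDERIV_difference_quotient[OF assms(3)]], intro exI allI impI)
    fix n
    show "real (Suc n) * (f (x + (1 / real (Suc n)) *\<^sub>R b) - f x) \<le> L * norm b"
      using lipschitz_difference_quotient_le[OF assms(1,2), of b n] b(1) by linarith
  qed
  then show ?thesis using b by simp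
qed (use lipschitz_on_nonneg[OF assms(1)] in simp)

text \<open>Translation invariance takes the place of the divergence theorem: every difference
  quotient has integral 0, and the Lipschitz bound lets the quotients pass to the derivative by
  dominated convergence.\<close>

lemma integral_gradient_eq_0:
  fixes f :: "'a::euclidean_space \<Rightarrow> real"
  assumes f: "lipschitz_on_balls f" and supp: "\<And>x. norm x > r \<Longrightarrow> f x = 0"
    and g: "AE x in lborel. GDERIV f x :> g x" and [measurable]: "g \<in> borel_measurable borel"
  shows "integrable lborel g" "(\<integral>x. g x \<partial>lborel) = 0"
proof -
  have cf: "continuous_on UNIV f" by (rule lipschitz_on_balls_continuous[OF f])
  have [measurable]: "f \<in> borel_measurable borel" by (rule borel_measurable_continuous_onI[OF cf])
  obtain B where B: "\<And>x. norm (f x) \<le> B" using continuous_bounded_support[OF cf supp] by blast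
  have intf: "integrable lborel f" by (rule integrable_bounded_cball[of _ B r]) (use B supp in auto)
  \<comment> \<open>Quotients with steps of length at most 1 vanish outside radius r + 1, and
    bounding them inside that ball reads f up to radius r + 2.\<close>
  obtain L where L: "L-lipschitz_on (cball 0 (r + 1 + 1)) f" using f unfolding lipschitz_on_balls_def by blast
  have comp: "integrable lborel (\<lambda>x. b \<bullet> g x) \<and> (\<integral>x. b \<bullet> g x \<partial>lborel) = 0" if b: "b \<in> Basis" for b
  proof -
    let ?q = "\<lambda>n x. real (Suc n) * (f (x + (1 / real (Suc n)) *\<^sub>R b) - f x)"
    have lim: "AE x in lborel. (\<lambda>n. ?q n x) \<longlonglongrightarrow> b \<bullet> g x"
      using g by eventually_elim (rule GDERIV_difference_quotient)
    have bnd: "AE x in lborel. norm (?q n x) \<le> indicator (cball 0 (r + 1)) x * L" for n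
    proof (intro AE_I2)
      fix x
      show "norm (?q n x) \<le> indicator (cball 0 (r + 1)) x * L"
      proof (cases "norm x \<le> r + 1")
        case True
        then show ?thesis using lipschitz_difference_quotient_le[OF L True, of b n] b by simp
      next
        case False
        have "norm ((1 / real (Suc n)) *\<^sub>R b) \<le> 1" using b by (simp add: divide_simps)
        then have "norm (x + (1 / real (Suc n)) *\<^sub>R b) > r"
          using norm_triangle_ineq4[of "x + (1 / real (Suc n)) *\<^sub>R b" "(1 / real (Suc n)) *\<^sub>R b"] False
          by (simp del: norm_scaleR)
        then show ?thesis using False supp[of x] supp[of "x + (1 / real (Suc n)) *\<^sub>R b"] by simp
      qed
    qed
    have dom: "integrable lborel (\<lambda>x::'a. indicator (cball 0 (r + 1)) x * L)"
      by (rule integrable_bounded_cball[of _ L "r + 1"]) (use lipschitz_on_nonneg[OF L] in \<open>auto simp: indicator_def\<close>)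
    have int0: "(\<integral>x. ?q n x \<partial>lborel) = 0" for n
    proof -
      have "(\<integral>x. f (x + (1 / real (Suc n)) *\<^sub>R b) \<partial>lborel) = (\<integral>x. f x \<partial>lborel)"
        by (rule integral_lborel_translate) measurable
      moreover have "integrable lborel (\<lambda>x. f (x + (1 / real (Suc n)) *\<^sub>R b))"
        using integrable_lborel_affine[OF intf, of 1 "(1 / real (Suc n)) *\<^sub>R b"] by (simp add: add.commute)
      ultimately show ?thesis using intf by simp
    qed
    have "integrable lborel (\<lambda>x. b \<bullet> g x)"
      by (rule integrable_dominated_convergence[OF _ _ dom lim bnd]) measurable
    moreover have "(\<lambda>n. \<integral>x. ?q n x \<partial>lborel) \<longlonglongrightarrow> (\<integral>x. b \<bullet> g x \<partial>lborel)"
      by (rule integral_dominated_convergence[OF _ _ dom lim bnd]) measurable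
    ultimately show ?thesis unfolding int0 using LIMSEQ_unique tendsto_const by blast
  qed
  have "integrable lborel (\<lambda>x. \<Sum>b\<in>Basis. (b \<bullet> g x) *\<^sub>R b)"
    using comp by (intro Bochner_Integration.integrable_sum integrable_scaleR_left) blast
  moreover have "(\<lambda>x. \<Sum>b\<in>Basis. (b \<bullet> g x) *\<^sub>R b) = g"
    by (simp add: euclidean_representation inner_commute[of _ "g _"])
  ultimately show ig: "integrable lborel g" by simp
  show "(\<integral>x. g x \<partial>lborel) = 0"
  proof (rule euclidean_eqI)
    fix b :: 'a assume b: "b \<in> Basis"
    have "(\<integral>x. g x \<partial>lborel) \<bullet> b = b \<bullet> (\<integral>x. g x \<partial>lborel)" by (rule inner_commute)
    also have "\<dots> = (\<integral>x. b \<bullet> g x \<partial>lborel)" using ig by (intro integral_inner_right[symmetric])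
    finally show "(\<integral>x. g x \<partial>lborel) \<bullet> b = 0 \<bullet> b" using comp[OF b] by simp
  qed
qed

section \<open>Weak gradients\<close>

lemma set_lebesgue_integral_vanish:
  assumes "\<And>x. x \<notin> \<Omega> \<Longrightarrow> f x = 0"
  shows "(LINT x:\<Omega>|M. f x) = (\<integral>x. f x \<partial>M)"
  unfolding set_lebesgue_integral_def
  by (intro Bochner_Integration.integral_cong refl) (use assms in \<open>auto simp: indicator_def\<close>)

text \<open>A test function and its gradient vanish outside the domain, so the set integrals of
  \<open>has_weak_grad\<close> become integrals over the whole space.\<close>

lemma has_weak_gradI:
  assumes "locally_integrable_on u \<Omega>" "locally_integrable_on G \<Omega>"
    "\<And>\<phi>. \<phi> \<in> test_functions \<Omega> \<Longrightarrow> (\<integral>x. u x *\<^sub>R grad \<phi> x \<partial>lborel) = - (\<integral>x. \<phi> x *\<^sub>R G x \<partial>lborel)"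
  shows "has_weak_grad \<Omega> u G"
  unfolding has_weak_grad_def
proof (intro conjI ballI assms(1,2))
  fix \<phi> assume \<phi>: "\<phi> \<in> test_functions \<Omega>"
  obtain K where "K \<subseteq> \<Omega>" "\<And>x. x \<notin> K \<Longrightarrow> \<phi> x = 0" "\<And>x. x \<notin> K \<Longrightarrow> grad \<phi> x = 0"
    using test_functionsE[OF \<phi>] by metis
  then have "\<And>x. x \<notin> \<Omega> \<Longrightarrow> \<phi> x = 0" "\<And>x. x \<notin> \<Omega> \<Longrightarrow> grad \<phi> x = 0" by blast+
  then show "(LINT x:\<Omega>|lborel. u x *\<^sub>R grad \<phi> x) = - (LINT x:\<Omega>|lborel. \<phi> x *\<^sub>R G x)"
    using assms(3)[OF \<phi>] by (subst (1 2) set_lebesgue_integral_vanish) auto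
qed

lemma has_weak_gradD:
  assumes "has_weak_grad \<Omega> u G"
  shows "locally_integrable_on u \<Omega>" "locally_integrable_on G \<Omega>"
    "\<And>\<phi>. \<phi> \<in> test_functions \<Omega> \<Longrightarrow> (\<integral>x. u x *\<^sub>R grad \<phi> x \<partial>lborel) = - (\<integral>x. \<phi> x *\<^sub>R G x \<partial>lborel)"
proof -
  show "locally_integrable_on u \<Omega>" "locally_integrable_on G \<Omega>"
    using assms unfolding has_weak_grad_def by auto
  fix \<phi> assume \<phi>: "\<phi> \<in> test_functions \<Omega>"
  obtain K where "K \<subseteq> \<Omega>" "\<And>x. x \<notin> K \<Longrightarrow> \<phi> x = 0" "\<And>x. x \<notin> K \<Longrightarrow> grad \<phi> x = 0"
    using test_functionsE[OF \<phi>] by metis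
  then have z: "\<And>x. x \<notin> \<Omega> \<Longrightarrow> \<phi> x = 0" "\<And>x. x \<notin> \<Omega> \<Longrightarrow> grad \<phi> x = 0" by blast+
  have "(LINT x:\<Omega>|lborel. u x *\<^sub>R grad \<phi> x) = - (LINT x:\<Omega>|lborel. \<phi> x *\<^sub>R G x)"
    using assms \<phi> unfolding has_weak_grad_def by blast
  then show "(\<integral>x. u x *\<^sub>R grad \<phi> x \<partial>lborel) = - (\<integral>x. \<phi> x *\<^sub>R G x \<partial>lborel)"
    by (subst (asm) (1 2) set_lebesgue_integral_vanish) (use z in auto)
qed

lemma test_functions_mono: "\<phi> \<in> test_functions \<Omega> \<Longrightarrow> \<Omega> \<subseteq> \<Omega>' \<Longrightarrow> \<phi> \<in> test_functions \<Omega>'"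
  unfolding test_functions_def by auto

lemma has_weak_grad_subset:
  assumes "has_weak_grad \<Omega>' u G" "\<Omega> \<subseteq> \<Omega>'"
  shows "has_weak_grad \<Omega> u G"
proof (rule has_weak_gradI)
  show "locally_integrable_on u \<Omega>" "locally_integrable_on G \<Omega>"
    using has_weak_gradD(1,2)[OF assms(1)] assms(2) unfolding locally_integrable_on_def by blast+
qed (intro has_weak_gradD(3)[OF assms(1)] test_functions_mono[OF _ assms(2)])

lemma has_weak_grad_diff:
  assumes "has_weak_grad \<Omega> u G" "has_weak_grad \<Omega> w Gw"
  shows "has_weak_grad \<Omega> (\<lambda>x. u x - w x) (\<lambda>x. G x - Gw x)"
proof (rule has_weak_gradI)
  note u = has_weak_gradD[OF assms(1)] and w = has_weak_gradD[OF assms(2)]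
  show "locally_integrable_on (\<lambda>x. u x - w x) \<Omega>" "locally_integrable_on (\<lambda>x. G x - Gw x) \<Omega>"
    using u(1,2) w(1,2) unfolding locally_integrable_on_def by (auto intro: set_integral_diff)
  fix \<phi> assume \<phi>: "\<phi> \<in> test_functions \<Omega>"
  obtain K where K: "compact K" "K \<subseteq> \<Omega>" and z: "\<And>x. x \<notin> K \<Longrightarrow> \<phi> x = 0" "\<And>x. x \<notin> K \<Longrightarrow> grad \<phi> x = 0"
    and c: "continuous_on UNIV \<phi>" "continuous_on UNIV (grad \<phi>)"
    using test_functionsE[OF \<phi>] by metis
  show "(\<integral>x. (u x - w x) *\<^sub>R grad \<phi> x \<partial>lborel) = - (\<integral>x. \<phi> x *\<^sub>R (G x - Gw x) \<partial>lborel)"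
    using u(3)[OF \<phi>] w(3)[OF \<phi>] integrable_test_scaleR[OF u(1) K c(2) z(2)] integrable_test_scaleR[OF w(1) K c(2) z(2)]
      integrable_test_scaleR'[OF u(2) K c(1) z(1)] integrable_test_scaleR'[OF w(2) K c(1) z(1)]
    by (simp add: scaleR_diff_left scaleR_diff_right)
qed

lemma locally_integrable_bounded:
  fixes g :: "'a::euclidean_space \<Rightarrow> 'b::euclidean_space"
  assumes [measurable]: "g \<in> borel_measurable borel" and b: "\<And>r. \<exists>B. AE x in lborel. norm x \<le> r \<longrightarrow> norm (g x) \<le> B"
  shows "locally_integrable_on g UNIV"
  unfolding locally_integrable_on_def set_integrable_def
proof (intro allI impI, elim conjE)
  fix K :: "'a set" assume K: "compact K"
  then obtain r where r: "K \<subseteq> cball 0 r" using compact_support_cball by blast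
  obtain B where B: "AE x in lborel. norm x \<le> r \<longrightarrow> norm (g x) \<le> B" using b by blast
  have [measurable]: "K \<in> sets borel" using K by (simp add: borel_compact)
  show "integrable lborel (\<lambda>x. indicator K x *\<^sub>R g x)"
  proof (rule integrable_bounded_cball[of _ "max B 0" r])
    show "AE x in lborel. norm (indicator K x *\<^sub>R g x) \<le> max B 0"
      using B by eventually_elim (use r in \<open>auto simp: indicator_def\<close>)
    show "indicator K x *\<^sub>R g x = 0" if "norm x > r" for x using r that by (auto simp: indicator_def)
  qed measurable
qed

lemma lipschitz_on_balls_gradient_bounded:
  assumes "lipschitz_on_balls f" "AE x in lborel. GDERIV f x :> g x"
  shows "\<exists>B. AE x in lborel. norm x \<le> r \<longrightarrow> norm (g x) \<le> B"
proof -
  obtain L where L: "L-lipschitz_on (cball 0 (r + 1)) f" using assms(1) unfolding lipschitz_on_balls_def by blast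
  have "AE x in lborel. norm x \<le> r \<longrightarrow> norm (g x) \<le> L"
    using assms(2) by eventually_elim (use norm_gradient_le_lipschitz[OF L] in blast)
  then show ?thesis by blast
qed

text \<open>The product of u with a test function is Lipschitz with bounded support, and the
  integral of its gradient vanishes.\<close>

lemma lipschitz_has_weak_grad:
  assumes u: "lipschitz_on_balls u" and g: "AE x in lborel. GDERIV u x :> G x" and [measurable]: "G \<in> borel_measurable borel"
  shows "has_weak_grad UNIV u G"
proof (rule has_weak_gradI)
  have cu: "continuous_on UNIV u" using u by (rule lipschitz_on_balls_continuous)
  then have [measurable]: "u \<in> borel_measurable borel" by (rule borel_measurable_continuous_onI)
  show lu: "locally_integrable_on u UNIV" using cu by (rule continuous_imp_locally_integrable)
  show lG: "locally_integrable_on G UNIV"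
    by (rule locally_integrable_bounded[OF _ lipschitz_on_balls_gradient_bounded[OF u g]]) measurable
  fix \<phi> :: "'a \<Rightarrow> real" assume \<phi>: "\<phi> \<in> test_functions UNIV"
  obtain K where K: "compact K" "K \<subseteq> UNIV" and z: "\<And>x. x \<notin> K \<Longrightarrow> \<phi> x = 0" "\<And>x. x \<notin> K \<Longrightarrow> grad \<phi> x = 0"
    and c: "continuous_on UNIV \<phi>" "continuous_on UNIV (grad \<phi>)"
    using test_functionsE[OF \<phi>] by metis
  have [measurable]: "\<phi> \<in> borel_measurable borel" "grad \<phi> \<in> borel_measurable borel"
    using c by (auto intro: borel_measurable_continuous_onI)
  obtain r where r: "K \<subseteq> cball 0 r" using compact_support_cball[OF K(1)] by blast
  have "lipschitz_on_balls \<phi>" by (rule C1_lipschitz_on_balls[OF test_functions_GDERIV[OF \<phi>] c(2)])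
  then have "lipschitz_on_balls (\<lambda>x. u x * \<phi> x)" by (rule lipschitz_on_balls_mult[OF u])
  moreover have "u x * \<phi> x = 0" if "norm x > r" for x
  proof -
    have "x \<notin> K" using that r by auto
    then show ?thesis by (simp add: z(1))
  qed
  moreover have "AE x in lborel. GDERIV (\<lambda>x. u x * \<phi> x) x :> u x *\<^sub>R grad \<phi> x + \<phi> x *\<^sub>R G x"
    using g by eventually_elim (intro GDERIV_mult test_functions_GDERIV[OF \<phi>])
  ultimately have "(\<integral>x. u x *\<^sub>R grad \<phi> x + \<phi> x *\<^sub>R G x \<partial>lborel) = 0"
    by (rule integral_gradient_eq_0(2)) measurable
  then show "(\<integral>x. u x *\<^sub>R grad \<phi> x \<partial>lborel) = - (\<integral>x. \<phi> x *\<^sub>R G x \<partial>lborel)"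
    using integrable_test_scaleR[OF lu K c(2) z(2)] integrable_test_scaleR'[OF lG K c(1) z(1)]
    by (simp add: eq_neg_iff_add_eq_0)
qed

lemma test_functions_has_weak_grad:
  assumes "\<phi> \<in> test_functions \<Omega>" shows "has_weak_grad \<Omega>' \<phi> (grad \<phi>)"
proof (rule has_weak_grad_subset[OF lipschitz_has_weak_grad])
  have c: "continuous_on UNIV (grad \<phi>)" using test_functionsE[OF assms] by metis
  then show "lipschitz_on_balls \<phi>" by (rule C1_lipschitz_on_balls[OF test_functions_GDERIV[OF assms]])
  show "grad \<phi> \<in> borel_measurable borel" using c by (rule borel_measurable_continuous_onI)
  show "AE x in lborel. GDERIV \<phi> x :> grad \<phi> x" using test_functions_GDERIV[OF assms] by simp
qed simp

text \<open>As a function of y the reflected kernel is a test function. Testing against it turns the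
  weak gradient identity into a statement about mollifications.\<close>

lemma test_functions_shifted_kernel:
  fixes \<rho> :: "'a::euclidean_space \<Rightarrow> real"
  assumes "mollifier_kernel \<rho> r" "cball x r \<subseteq> \<Omega>"
  shows "(\<lambda>y. \<rho> (x - y)) \<in> test_functions \<Omega>" "GDERIV (\<lambda>y. \<rho> (x - y)) y :> - grad \<rho> (x - y)"
proof -
  interpret mollifier_kernel \<rho> r by fact
  show "(\<lambda>y. \<rho> (x - y)) \<in> test_functions \<Omega>"
  proof (rule test_functionsI_cball[OF _ _ assms(2)])
    show "C_k k (\<lambda>y. \<rho> (x - y))" for k using C_k_affine[OF smooth, of k x "-1"] by simp
    show "\<rho> (x - y) = 0" if "y \<notin> cball x r" for y using that by (intro support) (simp add: dist_norm)
  qed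
  have "GDERIV \<rho> (x + (-1) *\<^sub>R y) :> grad \<rho> (x + (-1) *\<^sub>R y)" using smooth[of 1] C_k_Suc_iff[of 0 \<rho>] by auto
  from GDERIV_affine[OF this] show "GDERIV (\<lambda>y. \<rho> (x - y)) y :> - grad \<rho> (x - y)" by simp
qed

text \<open>The fundamental lemma of the calculus of variations. On a small ball the mollifications
  of D are integrals against test functions, hence 0, and they converge to D in L^1. Countably many
  such balls cover the domain.\<close>

lemma weakly_null_imp_AE_0:
  fixes D :: "'a::euclidean_space \<Rightarrow> 'b::euclidean_space"
  assumes D: "locally_integrable_on D \<Omega>" and "open \<Omega>"
    and null: "\<And>\<phi>. \<phi> \<in> test_functions \<Omega> \<Longrightarrow> (\<integral>x. \<phi> x *\<^sub>R D x \<partial>lborel) = 0"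
  shows "AE x in lborel. x \<in> \<Omega> \<longrightarrow> D x = 0"
proof -
  \<comment> \<open>The doubled radius leaves room for kernels of radius below s around every point
    of the smaller ball.\<close>
  have local: "AE x in lborel. x \<in> ball c s \<longrightarrow> D x = 0" if cs: "cball c (2 * s) \<subseteq> \<Omega>" "s > 0" for c s
  proof -
    let ?D = "\<lambda>x. indicator (cball c (2 * s)) x *\<^sub>R D x"
    have i: "integrable lborel ?D" by (rule locally_integrable_indicator[OF D _ cs(1)]) simp
    have [measurable]: "?D \<in> borel_measurable borel" using i by auto
    obtain j0 where j0: "1 / real (Suc j0) < s" using nat_approx_posE[OF cs(2)] by auto
    have zero: "moll (std_moll j) ?D x = 0" if j: "j \<ge> j0" and x: "x \<in> ball c s" for j x
    proof -
      have "1 / real (Suc j) \<le> 1 / real (Suc j0)" using j by (simp add: frac_le)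
      then have js: "1 / real (Suc j) < s" using j0 by linarith
      interpret mollifier_kernel "std_moll j :: 'a \<Rightarrow> real" "1 / real (Suc j)" by (rule std_moll)
      have sub: "cball x (1 / real (Suc j)) \<subseteq> cball c (2 * s)"
      proof
        fix y assume "y \<in> cball x (1 / real (Suc j))"
        then show "y \<in> cball c (2 * s)" using js x dist_triangle[of c y x] by simp
      qed
      have "moll (std_moll j) ?D x = (\<integral>y. std_moll j (x - y) *\<^sub>R D y \<partial>lborel)"
        unfolding moll_def
      proof (intro Bochner_Integration.integral_cong refl)
        fix y
        show "std_moll j (x - y) *\<^sub>R ?D y = std_moll j (x - y) *\<^sub>R D y"
          using support[of "x - y"] sub by (cases "y \<in> cball x (1 / real (Suc j))") (auto simp: dist_norm indicator_def)
      qed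
      also have "\<dots> = 0"
        using sub cs by (intro null test_functions_shifted_kernel(1)[OF std_moll]) auto
      finally show ?thesis .
    qed
    have iB: "integrable lborel (\<lambda>x. indicator (ball c s) x *\<^sub>R norm (?D x))"
      by (rule integrable_mult_indicator[OF _ integrable_norm[OF i]]) simp
    have "(\<integral>x. indicator (ball c s) x *\<^sub>R norm (?D x) \<partial>lborel) \<le> 0"
    proof (rule LIMSEQ_le_const[OF std_moll_tendsto_L1[OF i]], intro exI allI impI)
      fix j assume j: "j \<ge> j0"
      show "(\<integral>x. indicator (ball c s) x *\<^sub>R norm (?D x) \<partial>lborel) \<le> (\<integral>x. norm (moll (std_moll j) ?D x - ?D x) \<partial>lborel)"
      proof (rule Bochner_Integration.integral_mono[OF iB])
        show "integrable lborel (\<lambda>x. norm (moll (std_moll j) ?D x - ?D x))"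
          by (intro integrable_norm Bochner_Integration.integrable_diff integrable_moll_function(1)[OF std_moll i] i)
        show "indicator (ball c s) x *\<^sub>R norm (?D x) \<le> norm (moll (std_moll j) ?D x - ?D x)" for x
          using zero[OF j, of x] by (cases "x \<in> ball c s") (auto simp del: mem_ball)
      qed
    qed
    moreover have "(\<integral>x. indicator (ball c s) x *\<^sub>R norm (?D x) \<partial>lborel) \<ge> 0"
      by (intro Bochner_Integration.integral_nonneg) auto
    ultimately have "(\<integral>x. indicator (ball c s) x *\<^sub>R norm (?D x) \<partial>lborel) = 0" by linarith
    then have "AE x in lborel. indicator (ball c s) x *\<^sub>R norm (?D x) = 0"
      by (subst (asm) integral_nonneg_eq_0_iff_AE[OF iB]) auto
    then show ?thesis
      by eventually_elim (use cs(2) in \<open>auto simp: indicator_def split: if_splits\<close>)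
  qed
  define F where "F = {ball c s |c s. cball c (2 * s) \<subseteq> \<Omega> \<and> s > 0}"
  obtain F' where F': "F' \<subseteq> F" "countable F'" "\<Union>F' = \<Union>F"
    using Lindelof[of F] unfolding F_def by blast
  have "\<Omega> \<subseteq> \<Union>F"
  proof
    fix x assume "x \<in> \<Omega>"
    then obtain e where "e > 0" "cball x e \<subseteq> \<Omega>" using \<open>open \<Omega>\<close> open_contains_cball by metis
    then have "ball x (e / 2) \<in> F" "x \<in> ball x (e / 2)" unfolding F_def by force+
    then show "x \<in> \<Union>F" by blast
  qed
  moreover have "AE x in lborel. \<forall>B\<in>F'. x \<in> B \<longrightarrow> D x = 0"
    using F'(1) local unfolding F_def by (subst AE_ball_countable[OF F'(2)]) blast
  ultimately show ?thesis using F'(3) by (auto elim!: eventually_mono)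
qed

lemma has_weak_grad_unique:
  assumes "has_weak_grad \<Omega> u G" "has_weak_grad \<Omega> u Gw" "open \<Omega>"
  shows "AE x in lborel. x \<in> \<Omega> \<longrightarrow> G x = Gw x"
proof -
  have d: "has_weak_grad \<Omega> (\<lambda>x. u x - u x) (\<lambda>x. G x - Gw x)" by (rule has_weak_grad_diff[OF assms(1,2)])
  have "AE x in lborel. x \<in> \<Omega> \<longrightarrow> G x - Gw x = 0"
    by (rule weakly_null_imp_AE_0[OF has_weak_gradD(2)[OF d] assms(3)]) (use has_weak_gradD(3)[OF d] in simp)
  then show ?thesis by simp
qed

text \<open>The choice made in \<open>weak_grad\<close> is harmless on open sets: any known weak
  gradient can be substituted almost everywhere.\<close>

lemma weak_grad_eq_AE:
  assumes "has_weak_grad \<Omega> u G" "open \<Omega>"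
  shows "AE x in lborel. x \<in> \<Omega> \<longrightarrow> weak_grad \<Omega> u x = G x"
  unfolding weak_grad_def
  by (rule has_weak_grad_unique[OF someI[of "has_weak_grad \<Omega> u"] assms]) (rule assms)

lemma has_weak_grad_weak_grad: "weakly_differentiable \<Omega> u \<Longrightarrow> has_weak_grad \<Omega> u (weak_grad \<Omega> u)"
  unfolding weakly_differentiable_def weak_grad_def by (metis someI_ex)

section \<open>Weak chain rule\<close>

lemma borel_balls [measurable]:
  "cball (c::'a::metric_space) r \<in> sets borel" "ball c r \<in> sets borel"
  by auto

text \<open>Mollification commutes with the weak gradient, because the reflected kernel is an
  admissible test function.\<close>

lemma GDERIV_moll_weak_grad:
  assumes u: "has_weak_grad UNIV u G" and "mollifier_kernel \<rho> r"
  shows "GDERIV (moll \<rho> u) x :> moll \<rho> G x" "continuous_on UNIV (moll \<rho> G)"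
proof -
  interpret mollifier_kernel \<rho> r by fact
  note w = has_weak_gradD[OF u]
  have G: "GDERIV (moll \<rho> u) x :> moll \<rho> G x" for x
  proof -
    have "grad (\<lambda>y. \<rho> (x - y)) y = - grad \<rho> (x - y)" for y
      by (rule grad_eqI[OF test_functions_shifted_kernel(2)[OF assms(2) subset_UNIV]])
    then have "(\<integral>y. u y *\<^sub>R grad \<rho> (x - y) \<partial>lborel) = moll \<rho> G x"
      using w(3)[OF test_functions_shifted_kernel(1)[OF assms(2) subset_UNIV, of x]] by (simp add: moll_def)
    then show ?thesis using GDERIV_moll[OF w(1) smooth support, where x = x] by simp
  qed
  then show "GDERIV (moll \<rho> u) x :> moll \<rho> G x" .
  have "grad (moll \<rho> u) = moll \<rho> G" using G grad_eqI by blast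
  moreover have "continuous_on UNIV (grad (moll \<rho> u))"
    by (rule C_k_continuous_grad, rule C_k_moll[OF w(1) smooth support])
  ultimately show "continuous_on UNIV (moll \<rho> G)" by simp
qed

lemma integral_eq_0_limit:
  fixes T :: "'a \<Rightarrow> 'b::euclidean_space"
  assumes "integrable M T" "\<And>j. integrable M (S j)" "\<And>j. (\<integral>x. S j x \<partial>M) = 0"
    "\<And>j. integrable M (e j)" "\<And>j. AE x in M. norm (S j x - T x) \<le> e j x" "(\<lambda>j. \<integral>x. e j x \<partial>M) \<longlonglongrightarrow> 0"
  shows "(\<integral>x. T x \<partial>M) = 0"
proof -
  have "norm (\<integral>x. T x \<partial>M) \<le> (\<integral>x. e j x \<partial>M)" for j
  proof -
    have "(\<integral>x. T x \<partial>M) = - (\<integral>x. S j x - T x \<partial>M)" using assms(1,2,3) by simp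
    then have "norm (\<integral>x. T x \<partial>M) \<le> (\<integral>x. norm (S j x - T x) \<partial>M)"
      using integral_norm_bound[of M "\<lambda>x. S j x - T x"] by simp
    also have "\<dots> \<le> (\<integral>x. e j x \<partial>M)" using assms by (intro integral_mono_AE) auto
    finally show ?thesis .
  qed
  then have "norm (\<integral>x. T x \<partial>M) \<le> 0" by (intro LIMSEQ_le_const[OF assms(6)]) blast
  then show ?thesis by simp
qed

lemma subseq_AE_moll:
  fixes f :: "'a::euclidean_space \<Rightarrow> 'b::euclidean_space"
  assumes "locally_integrable_on f UNIV"
  obtains r :: "nat \<Rightarrow> nat" where "strict_mono r"
    "AE x in lborel. norm x \<le> K \<longrightarrow> (\<lambda>j. moll (std_moll (r j)) f x) \<longlonglongrightarrow> f x"
proof -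
  note L = std_moll_tendsto_L1_loc[OF assms, of K]
  have "(\<lambda>j. \<integral>x. norm (indicator (cball 0 K) x *\<^sub>R (moll (std_moll j) f x - f x)) \<partial>lborel) \<longlonglongrightarrow> 0"
    using L(1) by simp
  from tendsto_L1_AE_subseq[OF L(2) this] obtain r :: "nat \<Rightarrow> nat" where r: "strict_mono r"
    "AE x in lborel. (\<lambda>n. indicator (cball 0 K) x *\<^sub>R (moll (std_moll (r n)) f x - f x)) \<longlonglongrightarrow> 0" by blast
  have "AE x in lborel. norm x \<le> K \<longrightarrow> (\<lambda>j. moll (std_moll (r j)) f x) \<longlonglongrightarrow> f x"
    using r(2)
  proof eventually_elim
    fix x assume a: "(\<lambda>n. indicator (cball 0 K) x *\<^sub>R (moll (std_moll (r n)) f x - f x)) \<longlonglongrightarrow> 0"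
    show "norm x \<le> K \<longrightarrow> (\<lambda>j. moll (std_moll (r j)) f x) \<longlonglongrightarrow> f x"
    proof
      assume "norm x \<le> K"
      then have "(\<lambda>n. moll (std_moll (r n)) f x - f x) \<longlonglongrightarrow> 0" using a by simp
      then show "(\<lambda>j. moll (std_moll (r j)) f x) \<longlonglongrightarrow> f x" by (simp add: LIM_zero_iff)
    qed
  qed
  with r(1) show ?thesis by (rule that)
qed

text \<open>The weak form of grad F(u) = F'(u) G, tested against l. For mollified u it is the
  classical chain and product rule. The error has three parts, controlled by the Lipschitz bound on
  F, by L^1 convergence of the mollified gradients, and by dominated convergence for
  \<open>F'\<close>.\<close>

lemma weak_chain_rule_integral:
  fixes u :: "'a::euclidean_space \<Rightarrow> real"
  assumes u: "has_weak_grad UNIV u G"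
    and F: "\<And>t. (F has_real_derivative F' t) (at t)" "continuous_on UNIV F'" "\<And>t. \<bar>F' t\<bar> \<le> c"
    and l: "lipschitz_on_balls l" "\<And>x. norm x > K \<Longrightarrow> l x = 0" "AE x in lborel. GDERIV l x :> L x" "L \<in> borel_measurable borel"
  shows "integrable lborel (\<lambda>x. F (u x) *\<^sub>R L x + (l x * F' (u x)) *\<^sub>R G x)"
    "(\<integral>x. F (u x) *\<^sub>R L x + (l x * F' (u x)) *\<^sub>R G x \<partial>lborel) = 0"
proof -
  note w = has_weak_gradD[OF u]
  have cF: "continuous_on UNIV F" using F(1) DERIV_continuous_on has_field_derivative_at_within by blast
  have cl: "continuous_on UNIV l" using l(1) by (rule lipschitz_on_balls_continuous)
  have [measurable]: "u \<in> borel_measurable borel" "G \<in> borel_measurable borel" "L \<in> borel_measurable borel"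
    "F \<in> borel_measurable borel" "F' \<in> borel_measurable borel" "l \<in> borel_measurable borel"
    using w locally_integrable_borel l(4) cF F(2) cl by (auto intro: borel_measurable_continuous_onI)
  have Flip: "\<bar>F s - F t\<bar> \<le> c * \<bar>s - t\<bar>" for s t
    using field_differentiable_bound[of UNIV F F' c s t] F(1,3) by (auto intro: has_field_derivative_at_within)
  have c0: "c \<ge> 0" using F(3)[of 0] by linarith
  obtain M where M: "M > 0" "\<And>x. \<bar>l x\<bar> \<le> M" using continuous_bounded_support[OF cl l(2)] by (metis real_norm_def)
  obtain B where B: "AE x in lborel. norm x \<le> K \<longrightarrow> norm (L x) \<le> B"
    using lipschitz_on_balls_gradient_bounded[OF l(1,3)] by blast
  have L0: "AE x in lborel. norm x > K \<longrightarrow> L x = 0"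
    using l(3)
  proof eventually_elim
    fix x assume g: "GDERIV l x :> L x"
    show "norm x > K \<longrightarrow> L x = 0"
    proof
      assume "norm x > K"
      then show "L x = 0"
        using l(2) by (intro GDERIV_eq_0_transform[OF g, of "- cball 0 K"]) (auto intro: open_Compl)
    qed
  qed
  let ?\<chi> = "indicator (cball (0::'a) K) :: 'a \<Rightarrow> real"
  let ?B = "max B 0"
  have LB: "AE x in lborel. norm (L x) \<le> ?\<chi> x * ?B"
    using B L0 by eventually_elim (auto simp: indicator_def)
  have lB: "\<bar>l x\<bar> \<le> ?\<chi> x * M" for x using M l(2)[of x] by (auto simp: indicator_def)
  have i\<chi>u: "integrable lborel (\<lambda>x. ?\<chi> x * \<bar>u x\<bar>)" and i\<chi>G: "integrable lborel (\<lambda>x. ?\<chi> x * norm (G x))"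
    using integrable_norm[OF locally_integrable_onD[OF w(1), of 0 K]] integrable_norm[OF locally_integrable_onD[OF w(2), of 0 K]]
    by (simp_all add: abs_mult)
  have i\<chi>: "integrable lborel ?\<chi>"
    by (rule integrable_bounded_cball[of _ 1 K]) (auto split: split_indicator intro!: borel_measurable_indicator)
  let ?T = "\<lambda>x. F (u x) *\<^sub>R L x + (l x * F' (u x)) *\<^sub>R G x"
  show iT: "integrable lborel ?T"
  proof (rule Bochner_Integration.integrable_bound)
    show "integrable lborel (\<lambda>x. \<bar>F 0\<bar> * ?B * ?\<chi> x + c * ?B * (?\<chi> x * \<bar>u x\<bar>) + M * c * (?\<chi> x * norm (G x)))"
      by (intro Bochner_Integration.integrable_add integrable_mult_right i\<chi> i\<chi>u i\<chi>G)
    show "AE x in lborel. norm (?T x) \<le> norm (\<bar>F 0\<bar> * ?B * ?\<chi> x + c * ?B * (?\<chi> x * \<bar>u x\<bar>) + M * c * (?\<chi> x * norm (G x)))"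
      using LB
    proof eventually_elim
      fix x assume LBx: "norm (L x) \<le> ?\<chi> x * ?B"
      have "norm (?T x) \<le> \<bar>F (u x)\<bar> * norm (L x) + \<bar>l x\<bar> * \<bar>F' (u x)\<bar> * norm (G x)"
        using norm_triangle_ineq[of "F (u x) *\<^sub>R L x" "(l x * F' (u x)) *\<^sub>R G x"] by (simp add: abs_mult)
      also have "\<dots> \<le> (\<bar>F 0\<bar> + c * \<bar>u x\<bar>) * (?\<chi> x * ?B) + (?\<chi> x * M) * c * norm (G x)"
        using Flip[of "u x" 0] LBx lB[of x] F(3)[of "u x"] c0 by (intro add_mono mult_mono) auto
      also have "\<dots> = \<bar>F 0\<bar> * ?B * ?\<chi> x + c * ?B * (?\<chi> x * \<bar>u x\<bar>) + M * c * (?\<chi> x * norm (G x))"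
        by (simp add: algebra_simps)
      finally show "norm (?T x) \<le> norm (\<bar>F 0\<bar> * ?B * ?\<chi> x + c * ?B * (?\<chi> x * \<bar>u x\<bar>) + M * c * (?\<chi> x * norm (G x)))"
        by simp
    qed
  qed measurable
  \<comment> \<open>Since \<open>F'\<close> is merely continuous and bounded, its convergence along
    the mollified functions is taken pointwise; this requires almost everywhere convergence, hence a
    subsequence.\<close>
  obtain r :: "nat \<Rightarrow> nat" where r: "strict_mono r"
    and rlim: "AE x in lborel. norm x \<le> K \<longrightarrow> (\<lambda>j. moll (std_moll (r j)) u x) \<longlonglongrightarrow> u x"
    using subseq_AE_moll[OF w(1)] by blast
  define U where "U j = moll (std_moll (r j)) u" for j
  define Gj where "Gj j = moll (std_moll (r j)) G" for j
  have GU: "GDERIV (U j) x :> Gj j x" and cGj: "continuous_on UNIV (Gj j)" for j x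
    unfolding U_def Gj_def using GDERIV_moll_weak_grad[OF u std_moll] by blast+
  have cU: "continuous_on UNIV (U j)" for j
    using C1_lipschitz_on_balls[OF GU cGj] by (rule lipschitz_on_balls_continuous)
  have [measurable]: "U j \<in> borel_measurable borel" "Gj j \<in> borel_measurable borel" for j
    using cU cGj by (auto intro: borel_measurable_continuous_onI)
  let ?S = "\<lambda>j x. l x *\<^sub>R (F' (U j x) *\<^sub>R Gj j x) + F (U j x) *\<^sub>R L x"
  have S: "integrable lborel (?S j)" "(\<integral>x. ?S j x \<partial>lborel) = 0" for j
  proof -
    have GF: "GDERIV (\<lambda>x. F (U j x)) x :> F' (U j x) *\<^sub>R Gj j x" for x
      by (rule GDERIV_DERIV_compose[OF GU F(1)])
    have "lipschitz_on_balls (\<lambda>x. F (U j x))"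
      by (rule C1_lipschitz_on_balls[OF GF])
         (intro continuous_intros cGj continuous_on_compose2[OF F(2) cU], simp)
    then have 1: "lipschitz_on_balls (\<lambda>x. l x * F (U j x))" by (rule lipschitz_on_balls_mult[OF l(1)])
    have 2: "l x * F (U j x) = 0" if "norm x > K" for x using l(2)[OF that] by simp
    have 3: "AE x in lborel. GDERIV (\<lambda>x. l x * F (U j x)) x :> ?S j x"
      using l(3) by eventually_elim (intro GDERIV_mult GF)
    have 4: "?S j \<in> borel_measurable borel" by measurable
    show "integrable lborel (?S j)" "(\<integral>x. ?S j x \<partial>lborel) = 0"
      using integral_gradient_eq_0[OF 1 2 3 4] by blast+
  qed
  let ?e1 = "\<lambda>j x. ?\<chi> x * norm (U j x - u x)" and ?e2 = "\<lambda>j x. ?\<chi> x * norm (Gj j x - G x)"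
    and ?e3 = "\<lambda>j x. \<bar>F' (U j x) - F' (u x)\<bar> * (?\<chi> x * norm (G x))"
  have e1: "integrable lborel (?e1 j)" "(\<lambda>j. \<integral>x. ?e1 j x \<partial>lborel) \<longlonglongrightarrow> 0" for j
    using std_moll_tendsto_L1_loc(3)[OF w(1)] LIMSEQ_subseq_LIMSEQ[OF std_moll_tendsto_L1_loc(1)[OF w(1), of K] r]
    by (auto simp: U_def comp_def)
  have e2: "integrable lborel (?e2 j)" "(\<lambda>j. \<integral>x. ?e2 j x \<partial>lborel) \<longlonglongrightarrow> 0" for j
    using std_moll_tendsto_L1_loc(3)[OF w(2)] LIMSEQ_subseq_LIMSEQ[OF std_moll_tendsto_L1_loc(1)[OF w(2), of K] r]
    by (auto simp: Gj_def comp_def)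
  have F'd: "\<bar>F' s - F' t\<bar> \<le> 2 * c" for s t using F(3)[of s] F(3)[of t] by linarith
  have dom: "integrable lborel (\<lambda>x. 2 * c * (?\<chi> x * norm (G x)))" by (intro integrable_mult_right i\<chi>G)
  have bnd3: "AE x in lborel. norm (?e3 j x) \<le> 2 * c * (?\<chi> x * norm (G x))" for j
    using F'd by (intro AE_I2) (auto simp: abs_mult intro!: mult_right_mono)
  have lim3: "AE x in lborel. (\<lambda>j. ?e3 j x) \<longlonglongrightarrow> 0"
    using rlim
  proof eventually_elim
    fix x assume a: "norm x \<le> K \<longrightarrow> (\<lambda>j. moll (std_moll (r j)) u x) \<longlonglongrightarrow> u x"
    show "(\<lambda>j. ?e3 j x) \<longlonglongrightarrow> 0"
    proof (cases "norm x \<le> K")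
      case True
      then have "(\<lambda>j. F' (U j x)) \<longlonglongrightarrow> F' (u x)"
        using a continuous_on_tendsto_compose[OF F(2)] by (auto simp: U_def)
      then have "(\<lambda>j. ?e3 j x) \<longlonglongrightarrow> \<bar>F' (u x) - F' (u x)\<bar> * (?\<chi> x * norm (G x))" by (intro tendsto_intros)
      then show ?thesis by simp
    qed (simp add: indicator_def)
  qed
  have e3: "integrable lborel (?e3 j)" for j
  proof (rule Bochner_Integration.integrable_bound[OF dom])
    show "AE x in lborel. norm (?e3 j x) \<le> norm (2 * c * (?\<chi> x * norm (G x)))"
      using bnd3[of j] by eventually_elim (auto intro: order_trans)
  qed measurable
  have "(\<lambda>j. \<integral>x. ?e3 j x \<partial>lborel) \<longlonglongrightarrow> (\<integral>x. 0 \<partial>(lborel :: 'a measure))"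
    by (rule integral_dominated_convergence[OF _ _ dom lim3 bnd3]) measurable
  then have e3lim: "(\<lambda>j. \<integral>x. ?e3 j x \<partial>lborel) \<longlonglongrightarrow> 0" by simp
  show "(\<integral>x. ?T x \<partial>lborel) = 0"
  proof (rule integral_eq_0_limit[OF iT S])
    show "integrable lborel (\<lambda>x. c * ?B * ?e1 j x + M * c * ?e2 j x + M * ?e3 j x)" for j
      by (intro Bochner_Integration.integrable_add integrable_mult_right e1 e2 e3)
    have "(\<lambda>j. c * ?B * (\<integral>x. ?e1 j x \<partial>lborel) + M * c * (\<integral>x. ?e2 j x \<partial>lborel) + M * (\<integral>x. ?e3 j x \<partial>lborel))
        \<longlonglongrightarrow> c * ?B * 0 + M * c * 0 + M * 0"
      by (intro tendsto_intros e1(2) e2(2) e3lim)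
    then show "(\<lambda>j. \<integral>x. c * ?B * ?e1 j x + M * c * ?e2 j x + M * ?e3 j x \<partial>lborel) \<longlonglongrightarrow> 0"
      using e1(1) e2(1) e3 by simp
    show "AE x in lborel. norm (?S j x - ?T x) \<le> c * ?B * ?e1 j x + M * c * ?e2 j x + M * ?e3 j x" for j
      using LB
    proof eventually_elim
      fix x assume LBx: "norm (L x) \<le> ?\<chi> x * ?B"
      have "?S j x - ?T x = (F (U j x) - F (u x)) *\<^sub>R L x + (l x * F' (U j x)) *\<^sub>R (Gj j x - G x)
          + (l x * (F' (U j x) - F' (u x))) *\<^sub>R G x"
        by (simp add: algebra_simps)
      also have "norm \<dots> \<le> \<bar>F (U j x) - F (u x)\<bar> * norm (L x) + \<bar>l x\<bar> * \<bar>F' (U j x)\<bar> * norm (Gj j x - G x)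
          + \<bar>l x\<bar> * \<bar>F' (U j x) - F' (u x)\<bar> * norm (G x)"
        by (intro norm_triangle_le add_mono) (simp_all add: abs_mult)
      also have "\<dots> \<le> (c * \<bar>U j x - u x\<bar>) * (?\<chi> x * ?B) + (?\<chi> x * M) * c * norm (Gj j x - G x)
          + (?\<chi> x * M) * \<bar>F' (U j x) - F' (u x)\<bar> * norm (G x)"
        using Flip[of "U j x" "u x"] LBx lB[of x] F(3)[of "U j x"] c0
        by (intro add_mono mult_mono) auto
      also have "\<dots> = c * ?B * ?e1 j x + M * c * ?e2 j x + M * ?e3 j x"
        by (simp add: algebra_simps)
      finally show "norm (?S j x - ?T x) \<le> c * ?B * ?e1 j x + M * c * ?e2 j x + M * ?e3 j x" .
    qed
  qed
qed

section \<open>The functional \<open>J\<close> on weakly differentiable functions\<close>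

lemma ball_volume_eq: "ball_volume TYPE('a::euclidean_space) = unit_ball_vol (real DIM('a))"
  unfolding ball_volume_def by (simp add: measure_def emeasure_ball)

lemma ball_volume_pos: "ball_volume TYPE('a::euclidean_space) > 0"
  by (simp add: ball_volume_eq)

lemma measure_cball_eq:
  assumes "r \<ge> 0"
  shows "measure lborel (cball (c::'a::euclidean_space) r) = ball_volume TYPE('a) * r ^ DIM('a)"
  using assms by (simp add: ball_volume_eq measure_def emeasure_cball)

lemma omega_tilde_nonneg:
  assumes "DIM('a::euclidean_space) \<ge> 2" shows "omega_tilde TYPE('a) \<ge> 0"
  using assms unfolding omega_tilde_def sphere_area_def by (intro mult_nonneg_nonneg) auto

lemma AE_not_on_sphere: "AE x in lborel. norm (x::'a::euclidean_space) \<noteq> r"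
proof -
  have "sphere (0::'a) r \<in> null_sets lborel"
    using negligible_sphere[of "0::'a" r]
    by (auto simp: null_sets_completion_iff negligible_iff_null_sets negligible_convex_frontier)
  then have "AE x in lborel. x \<notin> sphere (0::'a) r" by (rule AE_not_in)
  then show ?thesis by simp
qed

text \<open>The open unit ball is exhausted by the closed balls of radius 1 - 1/(n + 1), on which
  local integrability gives measurability.\<close>

lemma locally_integrable_ball_borel:
  fixes f :: "'a::euclidean_space \<Rightarrow> 'b::euclidean_space"
  assumes "locally_integrable_on f (ball 0 1)"
  shows "(\<lambda>x. indicator (ball 0 1) x *\<^sub>R f x) \<in> borel_measurable borel"
proof (rule borel_measurable_indicator_limit[where A = "\<lambda>n. cball 0 (1 - 1 / real (Suc n))"])
  fix n
  have "integrable lborel (\<lambda>x. indicator (cball 0 (1 - 1 / real (Suc n))) x *\<^sub>R f x)"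
  proof (rule locally_integrable_indicator[OF assms])
    have "1 / real (Suc n) > 0" by simp
    then have "norm x < 1" if "norm x \<le> 1 - 1 / real (Suc n)" for x :: 'a using that by linarith
    then show "cball 0 (1 - 1 / real (Suc n)) \<subseteq> ball (0::'a) 1" by (simp add: subset_eq)
  qed simp
  then show "(\<lambda>x. indicator (cball 0 (1 - 1 / real (Suc n))) x *\<^sub>R f x) \<in> borel_measurable borel" by auto
next
  fix x :: 'a
  show "eventually (\<lambda>n. x \<in> cball 0 (1 - 1 / real (Suc n)) \<longleftrightarrow> x \<in> ball 0 1) sequentially"
  proof (cases "norm x < 1")
    case True
    then obtain n0 where n0: "1 / real (Suc n0) < 1 - norm x" using nat_approx_posE[of "1 - norm x"] by auto
    have "1 / real (Suc n) \<le> 1 / real (Suc n0)" if "n \<ge> n0" for n using that by (simp add: frac_le)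
    then show ?thesis using n0 True by (intro eventually_sequentiallyI[of n0]) force
  next
    case False
    have "1 / real (Suc n) > 0" for n by simp
    then have "\<not> norm x \<le> 1 - 1 / real (Suc n)" for n using False by (smt (verit))
    then show ?thesis using False by simp
  qed
qed

text \<open>The indicator multiplies the gradient before the norm is taken, because G is arbitrary
  outside the unit ball; inside, all weak gradients agree almost everywhere.\<close>

lemma J_fun_eq:
  fixes u :: "'a::euclidean_space \<Rightarrow> real"
  assumes "has_weak_grad (ball 0 1) u G"
  shows "J_fun u = 1 / omega_tilde TYPE('a) * (\<integral>x. norm (indicator (ball 0 1) x *\<^sub>R G x) ^ DIM('a) \<partial>lborel)
     - ln (1 / ball_volume TYPE('a) * (\<integral>x. indicator (ball 0 1) x * exp (u x) \<partial>lborel))"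
proof -
  have w: "has_weak_grad (ball 0 1) u (weak_grad (ball 0 1) u)"
    using assms by (intro has_weak_grad_weak_grad) (auto simp: weakly_differentiable_def)
  note [measurable] = locally_integrable_ball_borel[OF has_weak_gradD(2)[OF w]] locally_integrable_ball_borel[OF has_weak_gradD(2)[OF assms]]
  have "(LINT x:ball 0 1|lborel. norm (weak_grad (ball 0 1) u x) ^ DIM('a))
     = (\<integral>x. norm (indicator (ball 0 1) x *\<^sub>R weak_grad (ball 0 1) u x) ^ DIM('a) \<partial>lborel)"
    unfolding set_lebesgue_integral_def
    by (intro Bochner_Integration.integral_cong refl) (auto simp: indicator_def)
  also have "\<dots> = (\<integral>x. norm (indicator (ball 0 1) x *\<^sub>R G x) ^ DIM('a) \<partial>lborel)"
  proof (rule integral_cong_AE)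
    show "AE x in lborel. norm (indicator (ball 0 1) x *\<^sub>R weak_grad (ball 0 1) u x) ^ DIM('a)
        = norm (indicator (ball 0 1) x *\<^sub>R G x) ^ DIM('a)"
      using weak_grad_eq_AE[OF assms open_ball] by eventually_elim (auto simp: indicator_def)
  qed measurable
  finally show ?thesis by (simp add: J_fun_def set_lebesgue_integral_def)
qed

text \<open>Mollification does not increase the energy, and dilation into the unit ball preserves it
  because the exponent equals the dimension; only the volume factor R^N appears, inside the
  logarithm. Since z is bounded, the exponential integrals converge by dominated
  convergence.\<close>

lemma J_bound_extends:
  fixes z :: "'a::euclidean_space \<Rightarrow> real"
  assumes dim: "DIM('a) \<ge> 2"
    and m: "\<And>\<phi>. \<phi> \<in> test_functions (ball 0 1) \<Longrightarrow> m \<le> J_fun (\<phi> :: 'a \<Rightarrow> real)"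
    and z: "has_weak_grad UNIV z Z" "\<And>x. norm (z x) \<le> M" "\<And>x. norm x > R \<Longrightarrow> z x = 0" "R > 0"
    and Z: "integrable lborel (\<lambda>x. norm (Z x) ^ DIM('a))"
  shows "m \<le> 1 / omega_tilde TYPE('a) * (\<integral>x. norm (Z x) ^ DIM('a) \<partial>lborel)
    - ln (1 / (ball_volume TYPE('a) * R ^ DIM('a)) * (\<integral>x. indicator (cball 0 R) x * exp (z x) \<partial>lborel))"
proof -
  let ?N = "DIM('a)" and ?V = "ball_volume TYPE('a)" and ?om = "omega_tilde TYPE('a)"
  note w = has_weak_gradD[OF z(1)]
  have [measurable]: "z \<in> borel_measurable borel" "Z \<in> borel_measurable borel"
    using w locally_integrable_borel by auto
  have V: "?V > 0" by (rule ball_volume_pos)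
  have om: "?om \<ge> 0" using dim by (rule omega_tilde_nonneg)
  have iz: "integrable lborel z" by (rule integrable_bounded_cball[of _ M R]) (use z in auto)
  have "integrable lborel (\<lambda>x. moll (std_moll j) z x - z x)" for j
    by (intro Bochner_Integration.integrable_diff integrable_moll_function(1)[OF std_moll iz] iz)
  from tendsto_L1_AE_subseq[OF this std_moll_tendsto_L1[OF iz]]
  obtain r :: "nat \<Rightarrow> nat" where r: "strict_mono r"
    and rlim: "AE x in lborel. (\<lambda>j. moll (std_moll (r j)) z x - z x) \<longlonglongrightarrow> 0"
    by blast
  define \<epsilon> where "\<epsilon> j = 1 / real (Suc (r j))" for j
  \<comment> \<open>The mollified function lives in radius R + \<epsilon>; dividing by R + 2
    \<epsilon> places its support compactly inside the open unit ball.\<close>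
  define Rj where "Rj j = R + 2 * \<epsilon> j" for j
  define zj where "zj j = moll (std_moll (r j)) z" for j
  define Zj where "Zj j = moll (std_moll (r j)) Z" for j
  have \<epsilon>: "\<epsilon> j > 0" "\<epsilon> j \<le> 1" for j by (auto simp: \<epsilon>_def)
  have \<epsilon>lim: "\<epsilon> \<longlonglongrightarrow> 0"
    using LIMSEQ_subseq_LIMSEQ[OF LIMSEQ_inverse_real_of_nat r] by (simp add: \<epsilon>_def[abs_def] comp_def inverse_eq_divide)
  have Rj: "Rj j > R" "Rj j > 0" "Rj j \<le> R + 2" for j using \<epsilon>[of j] z(4) by (auto simp: Rj_def)
  have Rlim: "Rj \<longlonglongrightarrow> R"
    unfolding Rj_def[abs_def] using tendsto_add[OF tendsto_const tendsto_mult[OF tendsto_const \<epsilon>lim]] by force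
  have kern: "mollifier_kernel (std_moll (r j) :: 'a \<Rightarrow> real) (\<epsilon> j)" for j
    unfolding \<epsilon>_def by (rule std_moll)
  have supp: "std_moll (r j) x = 0" if "norm x > \<epsilon> j" for j and x :: 'a
    by (rule mollifier_kernel.support[OF kern that])
  have zsupp: "zj j x = 0" if "norm x > R + \<epsilon> j" for j x
    unfolding zj_def by (rule moll_eq_0[OF supp z(3)]) (use that in auto)
  have zle: "\<bar>zj j x\<bar> \<le> M" for j x
    using mollifier_kernel.norm_moll_le[OF kern w(1) z(2)] by (simp add: zj_def)
  have Gz: "GDERIV (zj j) x :> Zj j x" and cZ: "continuous_on UNIV (Zj j)" for j x
    unfolding zj_def Zj_def using GDERIV_moll_weak_grad[OF z(1) kern] by blast+
  have cz: "continuous_on UNIV (zj j)" for j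
    using C1_lipschitz_on_balls[OF Gz cZ] by (rule lipschitz_on_balls_continuous)
  have [measurable]: "zj j \<in> borel_measurable borel" "Zj j \<in> borel_measurable borel" for j
    using cz cZ by (auto intro: borel_measurable_continuous_onI)
  define \<phi> where "\<phi> j x = zj j (Rj j *\<^sub>R x)" for j x
  have \<phi>test: "\<phi> j \<in> test_functions (ball 0 1)" for j
  proof (rule test_functionsI[where r = "(R + \<epsilon> j) / Rj j"])
    show "C_k k (\<phi> j)" for k
    proof -
      have "C_k k (moll (std_moll (r j)) z)"
        by (rule C_k_moll[OF w(1) mollifier_kernel.smooth[OF kern] supp])
      from C_k_affine[OF this, of 0 "Rj j"] show ?thesis by (simp add: \<phi>_def[abs_def] zj_def)
    qed
    show "\<phi> j x = 0" if "norm x > (R + \<epsilon> j) / Rj j" for x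
      unfolding \<phi>_def by (rule zsupp) (use that Rj(2)[of j] in \<open>simp add: divide_simps mult.commute\<close>)
    show "cball 0 ((R + \<epsilon> j) / Rj j) \<subseteq> ball (0::'a) 1"
    proof -
      have "(R + \<epsilon> j) / Rj j < 1" using Rj(2)[of j] \<epsilon>(1)[of j] by (simp add: Rj_def)
      then have "norm x < 1" if "norm x \<le> (R + \<epsilon> j) / Rj j" for x :: 'a using that by linarith
      then show ?thesis by (simp add: subset_eq)
    qed
  qed
  have G\<phi>: "grad (\<phi> j) x = Rj j *\<^sub>R Zj j (Rj j *\<^sub>R x)" for j x
    using GDERIV_affine[of "zj j" 0 "Rj j" x "Zj j (Rj j *\<^sub>R x)"] Gz[of j "Rj j *\<^sub>R x"]
    by (intro grad_eqI) (simp add: \<phi>_def[abs_def])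
  have energy: "(\<integral>x. norm (indicator (ball 0 1) x *\<^sub>R grad (\<phi> j) x) ^ ?N \<partial>lborel) \<le> (\<integral>x. norm (Z x) ^ ?N \<partial>lborel)" for j
  proof -
    have "(\<integral>\<^sup>+x. norm (indicator (ball 0 1) x *\<^sub>R grad (\<phi> j) x) ^ ?N \<partial>lborel)
       \<le> (\<integral>\<^sup>+x. ennreal (Rj j ^ ?N) * ennreal (norm (Zj j (Rj j *\<^sub>R x)) ^ ?N) \<partial>lborel)"
      using Rj(2)[of j]
      by (intro nn_integral_mono)
         (auto simp: G\<phi> indicator_def power_mult_distrib ennreal_mult'[symmetric] power_0_left)
    also have "\<dots> = ennreal (Rj j ^ ?N) * (\<integral>\<^sup>+x. norm (Zj j (Rj j *\<^sub>R x)) ^ ?N \<partial>lborel)"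
      by (rule nn_integral_cmult) measurable
    \<comment> \<open>The factor that the chain rule contributes to the N-th power is exactly the
      Jacobian of the dilation.\<close>
    also have "\<dots> = (\<integral>\<^sup>+x. norm (Zj j x) ^ ?N \<partial>lborel)"
      using nn_integral_lborel_affine[of "\<lambda>x. ennreal (norm (Zj j x) ^ ?N)" "Rj j" 0] Rj(2)[of j] by simp
    also have "\<dots> \<le> (\<integral>\<^sup>+x. norm (Z x) ^ ?N \<partial>lborel)"
      unfolding Zj_def by (rule mollifier_kernel.nn_integral_norm_moll_power_le[OF kern w(2)])
    finally have le: "(\<integral>\<^sup>+x. norm (indicator (ball 0 1) x *\<^sub>R grad (\<phi> j) x) ^ ?N \<partial>lborel) \<le> (\<integral>\<^sup>+x. norm (Z x) ^ ?N \<partial>lborel)" .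
    also have "\<dots> = ennreal (\<integral>x. norm (Z x) ^ ?N \<partial>lborel)"
      by (rule nn_integral_eq_integral[OF Z]) simp
    finally have le: "(\<integral>\<^sup>+x. norm (indicator (ball 0 1) x *\<^sub>R grad (\<phi> j) x) ^ ?N \<partial>lborel) \<le> ennreal (\<integral>x. norm (Z x) ^ ?N \<partial>lborel)" .
    have [measurable]: "grad (\<phi> j) \<in> borel_measurable borel"
    proof -
      have "grad (\<phi> j) = (\<lambda>x. Rj j *\<^sub>R Zj j (Rj j *\<^sub>R x))" using G\<phi> by blast
      then show ?thesis by simp
    qed
    have "(\<integral>x. norm (indicator (ball 0 1) x *\<^sub>R grad (\<phi> j) x) ^ ?N \<partial>lborel)
      = enn2real (\<integral>\<^sup>+x. norm (indicator (ball 0 1) x *\<^sub>R grad (\<phi> j) x) ^ ?N \<partial>lborel)"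
      by (rule integral_eq_nn_integral) auto
    also have "\<dots> \<le> enn2real (ennreal (\<integral>x. norm (Z x) ^ ?N \<partial>lborel))"
      by (rule enn2real_mono[OF le]) simp
    also have "\<dots> = (\<integral>x. norm (Z x) ^ ?N \<partial>lborel)" by simp
    finally show ?thesis .
  qed
  let ?B = "\<lambda>j. \<integral>y. indicator (ball 0 (Rj j)) y * exp (zj j y) \<partial>lborel"
  have Bj: "(\<integral>x. indicator (ball 0 1) x * exp (\<phi> j x) \<partial>lborel) = ?B j / Rj j ^ ?N" for j
  proof -
    have "?B j = Rj j ^ ?N *\<^sub>R (\<integral>x. indicator (ball 0 (Rj j)) (0 + Rj j *\<^sub>R x) * exp (zj j (0 + Rj j *\<^sub>R x)) \<partial>lborel)"
      using Rj(2)[of j] integral_lborel_affine[of "\<lambda>y. indicator (ball 0 (Rj j)) y * exp (zj j y)" "Rj j" 0] by simp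
    also have "(\<integral>x. indicator (ball 0 (Rj j)) (0 + Rj j *\<^sub>R x) * exp (zj j (0 + Rj j *\<^sub>R x)) \<partial>lborel)
      = (\<integral>x. indicator (ball 0 1) x * exp (\<phi> j x) \<partial>lborel)"
      using Rj(2)[of j] by (intro Bochner_Integration.integral_cong refl) (auto simp: \<phi>_def indicator_def)
    finally show ?thesis using Rj(2)[of j] by simp
  qed
  let ?L = "\<integral>x. indicator (cball 0 R) x * exp (z x) \<partial>lborel"
  have dom: "integrable lborel (\<lambda>x::'a. indicator (cball 0 (R + 2)) x * exp M)"
    by (rule integrable_bounded_cball[of _ "exp M" "R + 2"]) (auto split: split_indicator)
  have Blim: "?B \<longlonglongrightarrow> ?L"
  proof (rule integral_dominated_convergence[OF _ _ dom])
    show "AE x in lborel. (\<lambda>j. indicator (ball 0 (Rj j)) x * exp (zj j x)) \<longlonglongrightarrow> indicator (cball 0 R) x * exp (z x)"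
      using rlim
    proof eventually_elim
      fix x :: 'a assume "(\<lambda>j. moll (std_moll (r j)) z x - z x) \<longlonglongrightarrow> 0"
      then have "(\<lambda>j. zj j x) \<longlonglongrightarrow> z x" by (simp add: LIM_zero_iff zj_def)
      moreover have "(\<lambda>j. indicator (ball 0 (Rj j)) x :: real) \<longlonglongrightarrow> indicator (cball 0 R) x"
      proof (rule tendsto_eventually, cases "norm x \<le> R")
        case True
        then show "eventually (\<lambda>j. indicator (ball 0 (Rj j)) x = (indicator (cball 0 R) x :: real)) sequentially"
          using Rj(1) by (intro always_eventually) (auto simp: indicator_def intro: le_less_trans)
      next
        case False
        then have "eventually (\<lambda>j. Rj j < norm x) sequentially" using Rlim by (intro order_tendstoD) auto
        then show "eventually (\<lambda>j. indicator (ball 0 (Rj j)) x = (indicator (cball 0 R) x :: real)) sequentially"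
          by eventually_elim (use False in \<open>auto simp: indicator_def\<close>)
      qed
      ultimately show "(\<lambda>j. indicator (ball 0 (Rj j)) x * exp (zj j x)) \<longlonglongrightarrow> indicator (cball 0 R) x * exp (z x)"
        by (intro tendsto_intros)
    qed
    show "AE x in lborel. norm (indicator (ball 0 (Rj j)) x * exp (zj j x)) \<le> indicator (cball 0 (R + 2)) x * exp M" for j
    proof (intro AE_I2)
      fix x :: 'a
      have "indicator (ball 0 (Rj j)) x \<le> (indicator (cball 0 (R + 2)) x :: real)"
        using Rj(3)[of j] by (auto simp: indicator_def)
      then show "norm (indicator (ball 0 (Rj j)) x * exp (zj j x)) \<le> indicator (cball 0 (R + 2)) x * exp M"
        using zle[of j x] by (auto simp: abs_mult intro!: mult_mono)
    qed
  qed measurable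
  \<comment> \<open>Positivity of the limit is what allows passing to the limit under the
    logarithm.\<close>
  have Lpos: "?L > 0"
  proof -
    have "0 < exp (- M) * measure lborel (cball (0::'a) R)"
      using V z(4) by (simp add: measure_cball_eq)
    also have "\<dots> = (\<integral>x. indicator (cball (0::'a) R) x * exp (- M) \<partial>lborel)" by simp
    also have "\<dots> \<le> ?L"
    proof (rule Bochner_Integration.integral_mono)
      show "integrable lborel (\<lambda>x::'a. indicator (cball 0 R) x * exp (- M))"
        by (rule integrable_bounded_cball[of _ "exp (-M)" R]) (auto split: split_indicator)
      show "integrable lborel (\<lambda>x. indicator (cball 0 R) x * exp (z x))"
        by (rule integrable_bounded_cball[of _ "exp M" R]) (use abs_le_D1[OF z(2)[unfolded real_norm_def]] in \<open>auto split: split_indicator\<close>)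
      show "indicator (cball 0 R) x * exp (- M) \<le> indicator (cball 0 R) x * exp (z x)" for x
        using z(2)[of x] by (intro mult_left_mono) auto
    qed
    finally show ?thesis .
  qed
  have mle: "m \<le> 1 / ?om * (\<integral>x. norm (Z x) ^ ?N \<partial>lborel) - ln (1 / ?V * (?B j / Rj j ^ ?N))" for j
  proof -
    have "m \<le> J_fun (\<phi> j)" by (rule m[OF \<phi>test])
    also have "\<dots> = 1 / ?om * (\<integral>x. norm (indicator (ball 0 1) x *\<^sub>R grad (\<phi> j) x) ^ ?N \<partial>lborel) - ln (1 / ?V * (?B j / Rj j ^ ?N))"
      unfolding J_fun_eq[OF test_functions_has_weak_grad[OF \<phi>test]] Bj ..
    also have "\<dots> \<le> 1 / ?om * (\<integral>x. norm (Z x) ^ ?N \<partial>lborel) - ln (1 / ?V * (?B j / Rj j ^ ?N))"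
      using om energy[of j] by (intro diff_right_mono mult_left_mono) auto
    finally show ?thesis .
  qed
  have "(\<lambda>j. 1 / ?om * (\<integral>x. norm (Z x) ^ ?N \<partial>lborel) - ln (1 / ?V * (?B j / Rj j ^ ?N)))
     \<longlonglongrightarrow> 1 / ?om * (\<integral>x. norm (Z x) ^ ?N \<partial>lborel) - ln (1 / ?V * (?L / R ^ ?N))"
    using V z(4) Lpos by (intro tendsto_intros Blim Rlim) auto
  from LIMSEQ_le_const[OF this] mle
  have "m \<le> 1 / ?om * (\<integral>x. norm (Z x) ^ ?N \<partial>lborel) - ln (1 / ?V * (?L / R ^ ?N))" by blast
  then show ?thesis by simp
qed

section \<open>Integration of radial functions\<close>

text \<open>Polar coordinates for radial functions: the image of Lebesgue measure under the norm is
  determined by its values on half-lines, that is, by the volumes V a^N of balls.\<close>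

lemma distr_norm_lborel:
  "distr lborel borel (norm :: 'a::euclidean_space \<Rightarrow> real) =
   density lborel (\<lambda>r. ennreal (real DIM('a) * ball_volume TYPE('a) * r ^ (DIM('a) - 1)) * indicator {0..} r)"
  (is "?D = ?E")
proof (rule measure_eqI_generator_eq[where \<Omega> = UNIV and E = "range (\<lambda>a::real. {..a})" and A = "\<lambda>n::nat. {..real n}"])
  let ?N = "DIM('a)" and ?V = "ball_volume TYPE('a)"
  have V: "?V > 0" by (rule ball_volume_pos)
  have N: "?N > 0" by simp
  have D: "emeasure ?D {..a} = ennreal (if a \<ge> 0 then ?V * a ^ ?N else 0)" for a
  proof -
    have "emeasure ?D {..a} = emeasure lborel (cball (0::'a) a)"
      by (subst emeasure_distr) (auto intro!: arg_cong[where f = "emeasure lborel"])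
    then show ?thesis by (auto simp: emeasure_cball ball_volume_eq)
  qed
  have E: "emeasure ?E {..a} = ennreal (if a \<ge> 0 then ?V * a ^ ?N else 0)" for a
  proof -
    have "emeasure ?E {..a} = (\<integral>\<^sup>+r. ennreal (real ?N * ?V * r ^ (?N - 1)) * indicator {0..a} r \<partial>lborel)"
      by (subst emeasure_density) (auto intro!: nn_integral_cong simp: indicator_def)
    also have "\<dots> = ennreal (if a \<ge> 0 then ?V * a ^ ?N else 0)"
    proof (cases "a \<ge> 0")
      case True
      have "(\<integral>\<^sup>+r. ennreal (real ?N * ?V * r ^ (?N - 1)) * indicator {0..a} r \<partial>lborel) = ?V * a ^ ?N - ?V * 0 ^ ?N"
        using True V by (intro nn_integral_FTC_Icc) (auto intro!: derivative_eq_intros)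
      then show ?thesis using True by (simp add: power_0_left)
    next
      case False
      then show ?thesis by (simp add: indicator_def)
    qed
    finally show ?thesis .
  qed
  show "emeasure ?D X = emeasure ?E X" if "X \<in> range (\<lambda>a::real. {..a})" for X
    using that D E by auto
  show "emeasure ?D {..real n} \<noteq> \<infinity>" for n unfolding D by simp
  show "Int_stable (range (\<lambda>a::real. {..a}))" by (auto simp: Int_stable_def)
  show "sets ?D = sigma_sets UNIV (range (\<lambda>a::real. {..a}))"
    "sets ?E = sigma_sets UNIV (range (\<lambda>a::real. {..a}))"
    by (simp_all add: borel_eq_atMost)
  show "(\<Union>n. {..real n}) = UNIV" using real_arch_simple by auto
qed auto

lemma nn_integral_radial:
  assumes [measurable]: "f \<in> borel_measurable borel"
  shows "(\<integral>\<^sup>+x. f (norm (x::'a::euclidean_space)) \<partial>lborel)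
    = (\<integral>\<^sup>+r. ennreal (real DIM('a) * ball_volume TYPE('a) * r ^ (DIM('a) - 1)) * f r * indicator {0..} r \<partial>lborel)"
proof -
  have "(\<integral>\<^sup>+x. f (norm (x::'a)) \<partial>lborel) = (\<integral>\<^sup>+r. f r \<partial>distr lborel borel (norm :: 'a \<Rightarrow> real))"
    by (simp add: nn_integral_distr)
  also have "\<dots> = (\<integral>\<^sup>+r. ennreal (real DIM('a) * ball_volume TYPE('a) * r ^ (DIM('a) - 1)) * f r * indicator {0..} r \<partial>lborel)"
    unfolding distr_norm_lborel by (simp add: nn_integral_density mult_ac)
  finally show ?thesis .
qed

text \<open>The derivative of F at r = 0 is two-sided, which is why the antiderivatives supplied
  later are written with |r|.\<close>

lemma nn_integral_radial_cball:
  assumes [measurable]: "f \<in> borel_measurable borel" and "R \<ge> 0"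
    and F: "\<And>r. 0 \<le> r \<Longrightarrow> DERIV F r :> real DIM('a) * ball_volume TYPE('a) * r ^ (DIM('a) - 1) * f r"
    and nn: "\<And>r. 0 \<le> r \<Longrightarrow> 0 \<le> f r"
  shows "(\<integral>\<^sup>+x. ennreal (indicator (cball 0 R) x * f (norm (x::'a::euclidean_space))) \<partial>lborel) = ennreal (F R - F 0)"
proof -
  have "(\<integral>\<^sup>+x. ennreal (indicator (cball 0 R) x * f (norm (x::'a))) \<partial>lborel)
     = (\<integral>\<^sup>+x. ennreal (f (norm (x::'a))) * indicator {..R} (norm x) \<partial>lborel)"
    by (intro nn_integral_cong) (auto simp: indicator_def)
  also have "\<dots> = (\<integral>\<^sup>+r. ennreal (real DIM('a) * ball_volume TYPE('a) * r ^ (DIM('a) - 1)) * (ennreal (f r) * indicator {..R} r) * indicator {0..} r \<partial>lborel)"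
    by (rule nn_integral_radial) measurable
  also have "\<dots> = (\<integral>\<^sup>+r. ennreal (real DIM('a) * ball_volume TYPE('a) * r ^ (DIM('a) - 1) * f r) * indicator {0..R} r \<partial>lborel)"
    using nn ball_volume_pos[where 'a='a]
    by (intro nn_integral_cong) (auto simp: indicator_def ennreal_mult[symmetric])
  also have "\<dots> = ennreal (F R - F 0)"
    using assms(2) F nn ball_volume_pos[where 'a='a] by (intro nn_integral_FTC_Icc) auto
  finally show ?thesis .
qed

text \<open>A comparison form: it is enough that some majorant of the weighted integrand has an
  antiderivative with a finite limit at infinity.\<close>

lemma integrable_radial:
  fixes f :: "real \<Rightarrow> real"
  assumes [measurable]: "f \<in> borel_measurable borel" and nn: "\<And>r. 0 \<le> r \<Longrightarrow> 0 \<le> f r"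
    and F: "\<And>r. 0 \<le> r \<Longrightarrow> DERIV F r :> g r" and [measurable]: "g \<in> borel_measurable borel"
    and le: "\<And>r. 0 \<le> r \<Longrightarrow> real DIM('a) * ball_volume TYPE('a) * r ^ (DIM('a) - 1) * f r \<le> g r"
    and T: "(F \<longlongrightarrow> T) at_top"
  shows "integrable lborel (\<lambda>x::'a::euclidean_space. f (norm x))"
proof -
  let ?w = "\<lambda>r. real DIM('a) * ball_volume TYPE('a) * r ^ (DIM('a) - 1)"
  have w: "?w r \<ge> 0" if "r \<ge> 0" for r using that ball_volume_pos[where 'a='a] by simp
  have "(\<integral>\<^sup>+x. ennreal (f (norm (x::'a))) \<partial>lborel) = (\<integral>\<^sup>+r. ennreal (?w r) * ennreal (f r) * indicator {0..} r \<partial>lborel)"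
    by (rule nn_integral_radial) measurable
  also have "\<dots> \<le> (\<integral>\<^sup>+r. ennreal (g r) * indicator {0..} r \<partial>lborel)"
    using w nn le by (intro nn_integral_mono) (auto simp: indicator_def ennreal_mult[symmetric] ennreal_leI)
  also have "\<dots> = ennreal (T - F 0)"
  proof (rule nn_integral_FTC_atLeast[OF _ _ _ T])
    show "0 \<le> g x" if "0 \<le> x" for x using le[OF that] w[OF that] nn[OF that] by (meson mult_nonneg_nonneg order_trans)
  qed (use F in auto)
  finally show ?thesis using nn by (intro integrableI_nonneg) (auto intro: le_less_trans)
qed

text \<open>The preimage of the whole sphere under the radial projection is the punctured ball, so
  only the factor N of \<open>sphere_measure\<close> is added to the volume.\<close>

lemma sphere_area_eq: "sphere_area TYPE('a::euclidean_space) = real DIM('a) * ball_volume TYPE('a)"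
proof -
  let ?A = "cball (0::'a) 1 - {0}" and ?h = "\<lambda>x::'a. x /\<^sub>R norm x"
  have h: "?h \<in> measurable (restrict_space lborel ?A) (restrict_space borel (sphere 0 1))"
    by (intro measurable_restrict_space2 measurable_restrict_space1) (auto simp: space_restrict_space)
  have "emeasure (distr (restrict_space lborel ?A) (restrict_space borel (sphere 0 1)) ?h) (sphere 0 1)
      = emeasure (restrict_space lborel ?A) (?h -` sphere 0 1 \<inter> space (restrict_space lborel ?A))"
    by (rule emeasure_distr[OF h]) (auto simp: sets_restrict_space)
  also have "?h -` sphere 0 1 \<inter> space (restrict_space lborel ?A) = ?A" by (auto simp: space_restrict_space)
  also have "emeasure (restrict_space lborel ?A) ?A = emeasure lborel ?A"
    by (rule emeasure_restrict_space) auto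
  also have "\<dots> = emeasure lborel (cball (0::'a) 1)"
    by (subst emeasure_Diff) auto
  also have "\<dots> = ennreal (ball_volume TYPE('a))" by (simp add: emeasure_cball ball_volume_eq)
  finally show ?thesis
    using ball_volume_pos[where 'a='a]
    by (simp add: sphere_area_def sphere_measure_def measure_def ennreal_of_nat_eq_real_of_nat ennreal_mult[symmetric])
qed

section \<open>Powers of the norm and the conjugate exponent\<close>

lemma GDERIV_norm_powr:
  fixes x :: "'a::euclidean_space"
  assumes p: "p > 1"
  shows "GDERIV (\<lambda>x. norm x powr p) x :> (p * norm x powr (p - 2)) *\<^sub>R x"
proof (cases "x = 0")
  case False
  have "((\<lambda>t. t powr p) has_real_derivative p * norm x powr (p - 1)) (at (norm x))"
    using False by (auto intro!: derivative_eq_intros)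
  from GDERIV_DERIV_compose[OF GDERIV_norm[OF False] this]
  have "GDERIV (\<lambda>x. norm x powr p) x :> (p * norm x powr (p - 1)) *\<^sub>R sgn x" .
  moreover have "norm x powr (p - 1) = norm x powr (p - 2) * norm x"
    using False powr_add[of "norm x" "p - 2" 1] by simp
  then have "(p * norm x powr (p - 1)) *\<^sub>R sgn x = (p * norm x powr (p - 2)) *\<^sub>R x"
    using False by (simp add: sgn_div_norm)
  ultimately show ?thesis by simp
next
  case True
  have "((\<lambda>h::'a. norm h powr (p - 1)) \<longlongrightarrow> 0) (at 0)"
    using p by (intro tendsto_zero_powrI[where b = "p - 1"] tendsto_norm_zero tendsto_ident_at tendsto_const) auto
  then have "((\<lambda>h::'a. norm (norm (0 + h) powr p - norm (0::'a) powr p - h \<bullet> 0) / norm h) \<longlongrightarrow> 0) (at 0)"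
    by (rule Lim_transform_eventually)
       (auto simp: eventually_at_filter powr_diff)
  then show ?thesis using True
    by (simp add: gderiv_def has_derivative_at bounded_linear_inner_left)
qed

lemma continuous_norm_powr_scaleR:
  assumes p: "p > 1"
  shows "continuous_on UNIV (\<lambda>x::'a::euclidean_space. norm x powr (p - 2) *\<^sub>R x)"
proof (rule continuous_at_imp_continuous_on, rule ballI)
  fix x :: 'a
  show "isCont (\<lambda>x. norm x powr (p - 2) *\<^sub>R x) x"
  proof (cases "x = 0")
    case True
    have "((\<lambda>h::'a. norm h powr (p - 1)) \<longlongrightarrow> 0) (at 0)"
      using p by (intro tendsto_zero_powrI[where b = "p - 1"] tendsto_norm_zero tendsto_ident_at tendsto_const) auto
    then have "((\<lambda>h::'a. norm (norm h powr (p - 2) *\<^sub>R h)) \<longlongrightarrow> 0) (at 0)"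
    proof (rule Lim_transform_eventually)
      show "eventually (\<lambda>h::'a. norm h powr (p - 1) = norm (norm h powr (p - 2) *\<^sub>R h)) (at 0)"
        unfolding eventually_at_filter
      proof (intro always_eventually allI impI)
        fix h :: 'a assume "h \<noteq> 0"
        then show "norm h powr (p - 1) = norm (norm h powr (p - 2) *\<^sub>R h)"
          using powr_add[of "norm h" "p - 2" 1] by simp
      qed
    qed
    then show ?thesis using True by (simp only: isCont_def tendsto_norm_zero_iff scaleR_zero_right)
  qed (auto intro!: continuous_intros)
qed

text \<open>The Hoelder conjugate q of N. The relations (N - 1) q = N and N (q - 1) = q govern all
  exponents that follow.\<close>

definition conj_exp :: "'a::euclidean_space itself \<Rightarrow> real" where
  "conj_exp _ = real DIM('a) / (real DIM('a) - 1)"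

lemma conj_exp:
  assumes "DIM('a::euclidean_space) \<ge> 2"
  shows "conj_exp TYPE('a) > 1" "(real DIM('a) - 1) * conj_exp TYPE('a) = real DIM('a)"
    "real (DIM('a) - 1) * conj_exp TYPE('a) = real DIM('a)"
    "real (DIM('a) - 2) * conj_exp TYPE('a) = real DIM('a) - conj_exp TYPE('a)"
proof -
  have N: "real DIM('a) \<ge> 2" using assms by simp
  show "conj_exp TYPE('a) > 1" "(real DIM('a) - 1) * conj_exp TYPE('a) = real DIM('a)"
    using N by (simp_all add: conj_exp_def)
  then show "real (DIM('a) - 1) * conj_exp TYPE('a) = real DIM('a)"
    using assms by (simp add: of_nat_diff)
  have "conj_exp TYPE('a) * (real DIM('a) - 2) = (real DIM('a) - 1) * conj_exp TYPE('a) - conj_exp TYPE('a)"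
    by (simp add: algebra_simps)
  also have "(real DIM('a) - 1) * conj_exp TYPE('a) = real DIM('a)" by fact
  finally show "real (DIM('a) - 2) * conj_exp TYPE('a) = real DIM('a) - conj_exp TYPE('a)"
    using assms by (simp add: of_nat_diff mult.commute)
qed

section \<open>The density \<open>mu_dens\<close> and its logarithm\<close>

text \<open>The absolute value makes the function even and so differentiable from both sides at 0;
  this is the one-dimensional case of the gradient of |x|^p.\<close>

lemma abs_powr_deriv:
  fixes p r :: real
  assumes "p > 1" "0 \<le> r"
  shows "DERIV (\<lambda>r. \<bar>r\<bar> powr p) r :> p * r powr (p - 1)"
proof -
  have "DERIV (\<lambda>r. \<bar>r\<bar> powr p) r :> (p * \<bar>r\<bar> powr (p - 2)) * r"
    using GDERIV_norm_powr[OF assms(1), of r] by simp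
  moreover have "(p * \<bar>r\<bar> powr (p - 2)) * r = p * r powr (p - 1)"
    using assms(2) powr_add[of r "p - 2" 1] by (cases "r = 0") auto
  ultimately show ?thesis by simp
qed

lemma powr_power_nonneg: "0 \<le> x \<Longrightarrow> n > 0 \<Longrightarrow> (x powr a) ^ n = x powr (real n * a)" for x :: real
  by (cases "x = 0") (auto simp: powr_power mult.commute)

text \<open>Consequences of (N - 1) q = N that express the radial weight r^(N-1) through s = r^q and
  r^(q-1), so that radial integrands become derivatives of functions of s.\<close>

lemma radial_power_identities:
  fixes r :: real
  defines "q \<equiv> conj_exp TYPE('a::euclidean_space)"
  assumes dim: "DIM('a) \<ge> 2" and r: "0 \<le> r"
  shows "r ^ (DIM('a) - 1) * r powr q = (r powr q) ^ (DIM('a) - 1) * r powr (q - 1)"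
    "r ^ (DIM('a) - 1) = (r powr q) ^ (DIM('a) - 2) * r powr (q - 1)"
    "(r powr (q - 1)) ^ DIM('a) = r powr q"
    "(r powr q) ^ (DIM('a) - 1) = r ^ DIM('a)"
proof -
  note q = conj_exp[OF dim, folded q_def]
  have q4: "real (DIM('a) - 2) * q + (q - 1) = real (DIM('a) - 1)"
    using q(4) dim by (simp add: of_nat_diff)
  show "r ^ (DIM('a) - 1) = (r powr q) ^ (DIM('a) - 2) * r powr (q - 1)"
  proof (cases "r = 0")
    case False
    then have r: "r > 0" using r by simp
    have "(r powr q) ^ (DIM('a) - 2) = r powr (real (DIM('a) - 2) * q)"
      using r by (simp add: powr_power mult.commute)
    then have "(r powr q) ^ (DIM('a) - 2) * r powr (q - 1) = r powr (real (DIM('a) - 2) * q + (q - 1))"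
      by (simp only: powr_add)
    then show ?thesis unfolding q4 using r by (simp only: powr_realpow)
  qed (use dim in auto)
  show e: "(r powr q) ^ (DIM('a) - 1) = r ^ DIM('a)"
  proof (cases "r = 0")
    case False
    then have r: "r > 0" using r by simp
    have "(r powr q) ^ (DIM('a) - 1) = r powr (real (DIM('a) - 1) * q)"
      using r by (simp add: powr_power mult.commute)
    then show ?thesis unfolding q(3) using r by (simp only: powr_realpow)
  qed (use dim in \<open>auto simp: power_0_left\<close>)
  have "real DIM('a) * (q - 1) = q" using q(2) by (simp add: algebra_simps)
  then show "(r powr (q - 1)) ^ DIM('a) = r powr q"
    using r by (subst powr_power_nonneg) auto
  have "r ^ DIM('a) * r powr (q - 1) = r ^ (DIM('a) - 1) * (r * r powr (q - 1))"
    using dim by (simp add: power_eq_if)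
  also have "r * r powr (q - 1) = r powr q"
    using r powr_add[of r 1 "q - 1"] by (cases "r = 0") auto
  finally show "r ^ (DIM('a) - 1) * r powr q = (r powr q) ^ (DIM('a) - 1) * r powr (q - 1)" by (simp only: e)
qed

lemma omega_tilde_eq:
  "omega_tilde TYPE('a::euclidean_space) = real DIM('a) ^ DIM('a) * conj_exp TYPE('a) ^ (DIM('a) - 1) * (real DIM('a) * ball_volume TYPE('a))"
  by (simp add: omega_tilde_def sphere_area_eq conj_exp_def)

lemma omega_tilde_pos:
  assumes "DIM('a::euclidean_space) \<ge> 2" shows "omega_tilde TYPE('a) > 0"
  unfolding omega_tilde_eq using conj_exp(1)[OF assms] ball_volume_pos[where 'a='a]
  by (intro mult_pos_pos zero_less_power) auto

lemma power_split:
  fixes a :: real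
  assumes "n \<ge> 2"
  shows "a ^ (n - 1) = a ^ (n - 2) * a" "a ^ n = a ^ (n - 2) * a\<^sup>2" "a ^ n = a ^ (n - 1) * a"
proof -
  obtain k where "n = k + 2" using assms by (metis le_add_diff_inverse2)
  then show "a ^ (n - 1) = a ^ (n - 2) * a" "a ^ n = a ^ (n - 2) * a\<^sup>2" "a ^ n = a ^ (n - 1) * a"
    by (simp_all add: power2_eq_square)
qed

definition profile :: "'a::euclidean_space \<Rightarrow> real" where
  "profile x = norm x powr conj_exp TYPE('a)"

lemma profile_nonneg [simp]: "profile x \<ge> 0" by (simp add: profile_def)

lemma profile_add_pos [simp]: "1 + profile x > 0" "1 + profile x \<noteq> 0"
  using profile_nonneg[of x] by linarith+

lemma mu_dens_eq: "mu_dens (x::'a::euclidean_space) = 1 / (ball_volume TYPE('a) * (1 + profile x) ^ DIM('a))"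
  by (simp add: mu_dens_def profile_def conj_exp_def)

lemma v_eq: "v (x::'a::euclidean_space) = - ln (ball_volume TYPE('a)) - real DIM('a) * ln (1 + profile x)"
  using ball_volume_pos[where 'a='a] profile_add_pos[of x]
  by (simp add: v_def mu_dens_eq ln_div ln_mult ln_realpow)

lemma exp_v: "exp (v (x::'a::euclidean_space)) = mu_dens x"
  using ball_volume_pos[where 'a='a] profile_add_pos[of x] by (simp add: v_def mu_dens_eq)

lemma mu_dens_pos: "mu_dens (x::'a::euclidean_space) > 0"
  using exp_v[of x] exp_gt_zero by metis

definition grad_profile :: "'a::euclidean_space \<Rightarrow> 'a" where
  "grad_profile x = (conj_exp TYPE('a) * norm x powr (conj_exp TYPE('a) - 2)) *\<^sub>R x"

lemma GDERIV_profile: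
  assumes "DIM('a::euclidean_space) \<ge> 2" shows "GDERIV (profile :: 'a \<Rightarrow> real) x :> grad_profile x"
  unfolding profile_def[abs_def] grad_profile_def by (rule GDERIV_norm_powr[OF conj_exp(1)[OF assms]])

lemma continuous_grad_profile:
  assumes "DIM('a::euclidean_space) \<ge> 2" shows "continuous_on UNIV (grad_profile :: 'a \<Rightarrow> 'a)"
  unfolding grad_profile_def[abs_def] scaleR_scaleR[symmetric]
  by (intro continuous_on_scaleR continuous_on_const continuous_norm_powr_scaleR conj_exp(1)[OF assms])

lemma continuous_profile:
  assumes "DIM('a::euclidean_space) \<ge> 2" shows "continuous_on UNIV (profile :: 'a \<Rightarrow> real)"
  using C1_lipschitz_on_balls[OF GDERIV_profile[OF assms] continuous_grad_profile[OF assms]]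
  by (rule lipschitz_on_balls_continuous)

lemma norm_grad_profile:
  fixes x :: "'a::euclidean_space"
  assumes "DIM('a) \<ge> 2"
  shows "norm (grad_profile x) = conj_exp TYPE('a) * norm x powr (conj_exp TYPE('a) - 1)"
  using conj_exp(1)[OF assms] powr_add[of "norm x" "conj_exp TYPE('a) - 2" 1]
  by (cases "x = 0") (auto simp: grad_profile_def abs_mult)

text \<open>Euler's identity for a homogeneous function of degree q.\<close>

lemma inner_grad_profile:
  fixes x :: "'a::euclidean_space"
  assumes "DIM('a) \<ge> 2"
  shows "x \<bullet> grad_profile x = conj_exp TYPE('a) * profile x"
  using powr_add[of "norm x" "conj_exp TYPE('a) - 2" 2]
  by (cases "x = 0") (auto simp: grad_profile_def profile_def dot_square_norm powr_realpow[symmetric] simp flip: powr_numeral)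

lemma GDERIV_v:
  assumes "DIM('a::euclidean_space) \<ge> 2"
  shows "GDERIV v x :> (- real DIM('a) / (1 + profile x)) *\<^sub>R grad_profile (x::'a)"
proof -
  have "DERIV (\<lambda>s. - ln (ball_volume TYPE('a)) - real DIM('a) * ln (1 + s)) (profile x) :> - real DIM('a) / (1 + profile x)"
    using profile_add_pos[of x] by (auto intro!: derivative_eq_intros)
  from GDERIV_DERIV_compose[OF GDERIV_profile[OF assms] this] show ?thesis by (simp add: v_eq[abs_def])
qed

lemma grad_v:
  assumes "DIM('a::euclidean_space) \<ge> 2"
  shows "grad v x = (- real DIM('a) / (1 + profile x)) *\<^sub>R grad_profile (x::'a)"
  by (rule grad_eqI[OF GDERIV_v[OF assms]])

lemma continuous_grad_v:
  assumes "DIM('a::euclidean_space) \<ge> 2" shows "continuous_on UNIV (grad v :: 'a \<Rightarrow> 'a)"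
proof -
  have "grad v = (\<lambda>x::'a. (- real DIM('a) / (1 + profile x)) *\<^sub>R grad_profile x)" using grad_v[OF assms] by blast
  moreover have "continuous_on UNIV (\<lambda>x::'a. (- real DIM('a) / (1 + profile x)) *\<^sub>R grad_profile x)"
    by (intro continuous_intros continuous_grad_profile continuous_profile assms) auto
  ultimately show ?thesis by simp
qed

lemma norm_grad_v_power:
  fixes x :: "'a::euclidean_space"
  assumes "DIM('a) \<ge> 2"
  shows "norm (grad v x) ^ DIM('a) = (real DIM('a) * conj_exp TYPE('a)) ^ DIM('a) * profile x / (1 + profile x) ^ DIM('a)"
  using radial_power_identities(3)[OF assms norm_ge_zero[of x]] profile_add_pos[of x]
  by (simp add: grad_v[OF assms] norm_grad_profile[OF assms] power_mult_distrib power_divide profile_def[symmetric])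

text \<open>The powers of |x| from the two factors cancel, as (N - 2)(q - 1) + (q - 2) = 0. What
  remains is x times a radial factor without singularity at the origin, although second derivatives
  of v need not exist there.\<close>

lemma grad_v_field:
  fixes x :: "'a::euclidean_space"
  assumes dim: "DIM('a) \<ge> 2"
  shows "norm (grad v x) ^ (DIM('a) - 2) *\<^sub>R grad v x
    = (- ((real DIM('a) * conj_exp TYPE('a)) ^ (DIM('a) - 1)) / (1 + profile x) ^ (DIM('a) - 1)) *\<^sub>R x"
proof (cases "x = 0")
  case False
  let ?N = "DIM('a)" and ?q = "conj_exp TYPE('a)"
  have "(norm x powr (?q - 1)) ^ (?N - 2) * norm x powr (?q - 2) = norm x powr (real (?N - 2) * (?q - 1) + (?q - 2))"
    using False by (simp add: powr_power powr_add mult.commute)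
  also have "real (?N - 2) * (?q - 1) + (?q - 2) = 0"
    using conj_exp(4)[OF dim] dim by (simp add: algebra_simps of_nat_diff)
  finally have e: "(norm x powr (?q - 1)) ^ (?N - 2) * norm x powr (?q - 2) = 1" using False by simp
  note p = power_split(1)[OF dim]
  have n: "norm (grad v x) = real ?N * ?q * norm x powr (?q - 1) / (1 + profile x)"
    using profile_add_pos[of x] by (simp add: grad_v[OF dim] norm_grad_profile[OF dim])
  have "norm (grad v x) ^ (?N - 2) * (- real ?N / (1 + profile x) * (?q * norm x powr (?q - 2)))
      = - (((real ?N * ?q) ^ (?N - 2) * (real ?N * ?q)) / ((1 + profile x) ^ (?N - 2) * (1 + profile x)))
        * ((norm x powr (?q - 1)) ^ (?N - 2) * norm x powr (?q - 2))"
    unfolding n by (simp add: power_mult_distrib power_divide field_simps)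
  also have "\<dots> = - ((real ?N * ?q) ^ (?N - 1)) / (1 + profile x) ^ (?N - 1)"
    unfolding e p by simp
  finally show ?thesis by (simp add: grad_v[OF dim] grad_profile_def)
qed (simp add: grad_v[OF dim] grad_profile_def)

lemma ratio_deriv:
  fixes q r :: real
  assumes "q > 1" "0 \<le> r"
  shows "DERIV (\<lambda>r. \<bar>r\<bar> powr q / (1 + \<bar>r\<bar> powr q)) r :> q * r powr (q - 1) / (1 + r powr q)\<^sup>2"
proof -
  have s: "1 + \<bar>r\<bar> powr q \<noteq> 0" using powr_ge_zero[of "\<bar>r\<bar>" q] by linarith
  note d = abs_powr_deriv[OF assms]
  from DERIV_divide[OF d DERIV_add[OF DERIV_const d] s]
  have "DERIV (\<lambda>r. \<bar>r\<bar> powr q / (1 + \<bar>r\<bar> powr q)) r :>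
    (q * r powr (q - 1) * (1 + \<bar>r\<bar> powr q) - \<bar>r\<bar> powr q * (0 + q * r powr (q - 1))) / ((1 + \<bar>r\<bar> powr q) * (1 + \<bar>r\<bar> powr q))" .
  then show ?thesis using assms(2) by (simp add: algebra_simps power2_eq_square)
qed

text \<open>With t = s/(1 + s) the radial integrand is exactly the derivative of t^(N-1), which
  increases from 0 to 1; so mu is in fact a probability measure.\<close>

lemma integrable_mu_dens:
  assumes dim: "DIM('a::euclidean_space) \<ge> 2"
  shows "integrable lborel (mu_dens :: 'a \<Rightarrow> real)"
proof -
  let ?N = "DIM('a)" and ?q = "conj_exp TYPE('a)" and ?V = "ball_volume TYPE('a)"
  let ?s = "\<lambda>r::real. \<bar>r\<bar> powr ?q"
  have V: "?V > 0" by (rule ball_volume_pos)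
  have q: "?q > 1" by (rule conj_exp(1)[OF dim])
  have s: "1 + ?s r > 0" for r using powr_ge_zero[of "\<bar>r\<bar>" ?q] by linarith
  note p = power_split[OF dim]
  let ?f = "\<lambda>r. 1 / (?V * (1 + r powr ?q) ^ ?N)"
  let ?g = "\<lambda>r. real ?N * r ^ (?N - 1) / (1 + r powr ?q) ^ ?N"
  have "integrable lborel (\<lambda>x::'a. ?f (norm x))"
  proof (rule integrable_radial[where F = "\<lambda>r. (?s r / (1 + ?s r)) ^ (?N - 1)" and g = ?g and T = "1 ^ (?N - 1)"])
    show "DERIV (\<lambda>r. (?s r / (1 + ?s r)) ^ (?N - 1)) r :> ?g r" if r: "0 \<le> r" for r
    proof -
      have "DERIV (\<lambda>r. (?s r / (1 + ?s r)) ^ (?N - 1)) r :>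
         real (?N - 1) * (?q * r powr (?q - 1) / (1 + r powr ?q)\<^sup>2 * (?s r / (1 + ?s r)) ^ (?N - 1 - Suc 0))"
        by (rule DERIV_power[OF ratio_deriv[OF q r]])
      also have "?N - 1 - Suc 0 = ?N - 2" by simp
      also have "real (?N - 1) * (?q * r powr (?q - 1) / (1 + r powr ?q)\<^sup>2 * (?s r / (1 + ?s r)) ^ (?N - 2))
        = (real (?N - 1) * ?q) * ((?s r) ^ (?N - 2) * r powr (?q - 1)) / ((1 + ?s r) ^ (?N - 2) * (1 + ?s r)\<^sup>2)"
        using r by (simp add: power_divide mult_ac)
      also have "\<dots> = ?g r"
        by (simp only: radial_power_identities(2)[OF dim r, symmetric] conj_exp(3)[OF dim] p(2) abs_of_nonneg[OF r])
      finally show ?thesis .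
    qed
    show "((\<lambda>r. (?s r / (1 + ?s r)) ^ (?N - 1)) \<longlongrightarrow> 1 ^ (?N - 1)) at_top"
    proof (intro tendsto_power)
      have "((\<lambda>r::real. 1 / (1 + r powr (- ?q))) \<longlongrightarrow> 1 / (1 + 0)) at_top"
        using q by (intro tendsto_intros tendsto_neg_powr filterlim_ident) auto
      then have "((\<lambda>r::real. 1 / (1 + r powr (- ?q))) \<longlongrightarrow> 1) at_top" by simp
      then show "((\<lambda>r. ?s r / (1 + ?s r)) \<longlongrightarrow> 1) at_top"
      proof (rule Lim_transform_eventually)
        show "eventually (\<lambda>r. 1 / (1 + r powr (- ?q)) = ?s r / (1 + ?s r)) at_top"
          using eventually_gt_at_top[of 0]
        proof eventually_elim
          fix r :: real assume "r > 0"
          then show "1 / (1 + r powr (- ?q)) = ?s r / (1 + ?s r)" by (simp add: powr_minus divide_simps add.commute)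
        qed
      qed
    qed
    show "real ?N * ?V * r ^ (?N - 1) * ?f r \<le> ?g r" if "0 \<le> r" for r using V by simp
    show "0 \<le> ?f r" for r using V by simp
  qed measurable
  then show ?thesis by (simp add: mu_dens_eq[abs_def] profile_def)
qed

text \<open>Equivalently, the sum of t^k/k over all k >= N, where t = s/(1 + s) and s = R^q: the
  series of -ln (1 - t) = ln (1 + s) without its first N - 1 terms.\<close>

definition energy_value :: "'a::euclidean_space itself \<Rightarrow> real \<Rightarrow> real" where
  "energy_value T R = ln (1 + R powr conj_exp T)
     - (\<Sum>k = 1..DIM('a) - 1. (R powr conj_exp T / (1 + R powr conj_exp T)) ^ k / real k)"

text \<open>Differentiating the finite sum produces a geometric sum, and subtracting it from the
  derivative of the logarithm leaves s'/(1 + s) t^(N-1). Up to the constant omega~ this is the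
  radial energy density of v.\<close>

lemma energy_grad_v:
  assumes dim: "DIM('a::euclidean_space) \<ge> 2" and R: "R > 0"
  shows "integrable lborel (\<lambda>x::'a. indicator (cball 0 R) x * norm (grad v x) ^ DIM('a))"
    "1 / omega_tilde TYPE('a) * (\<integral>x. indicator (cball (0::'a) R) x * norm (grad v x) ^ DIM('a) \<partial>lborel) = energy_value TYPE('a) R"
proof -
  let ?N = "DIM('a)" and ?q = "conj_exp TYPE('a)" and ?V = "ball_volume TYPE('a)" and ?om = "omega_tilde TYPE('a)"
  let ?s = "\<lambda>r::real. \<bar>r\<bar> powr ?q"
  have V: "?V > 0" by (rule ball_volume_pos)
  have om: "?om > 0" by (rule omega_tilde_pos[OF dim])
  have q: "?q > 1" by (rule conj_exp(1)[OF dim])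
  have s: "1 + ?s r > 0" for r using powr_ge_zero[of "\<bar>r\<bar>" ?q] by linarith
  note p = power_split[OF dim]
  let ?f = "\<lambda>r. (real ?N * ?q) ^ ?N * r powr ?q / (1 + r powr ?q) ^ ?N"
  let ?F = "\<lambda>r. ?om * (ln (1 + ?s r) - (\<Sum>k = 1..?N - 1. (?s r / (1 + ?s r)) ^ k / real k))"
  have D: "DERIV ?F r :> real ?N * ?V * r ^ (?N - 1) * ?f r" if r: "0 \<le> r" for r
  proof -
    let ?t = "r powr ?q / (1 + r powr ?q)" and ?s' = "?q * r powr (?q - 1)"
    have sr: "1 + r powr ?q > 0" using s[of r] r by simp
    have "DERIV (\<lambda>r. (?s r / (1 + ?s r)) ^ k / real k) r :> ?s' / (1 + r powr ?q)\<^sup>2 * ?t ^ (k - 1)" if "k \<in> {1..?N - 1}" for k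
    proof -
      have "DERIV (\<lambda>r. (?s r / (1 + ?s r)) ^ k) r :> real k * (?s' / (1 + r powr ?q)\<^sup>2 * (?s r / (1 + ?s r)) ^ (k - Suc 0))"
        by (rule DERIV_power[OF ratio_deriv[OF q r]])
      from DERIV_cdivide[OF this, of "real k"] show ?thesis using that r by (simp add: mult.assoc)
    qed
    then have "DERIV (\<lambda>r. \<Sum>k = 1..?N - 1. (?s r / (1 + ?s r)) ^ k / real k) r :> (\<Sum>k = 1..?N - 1. ?s' / (1 + r powr ?q)\<^sup>2 * ?t ^ (k - 1))"
      by (rule DERIV_sum)
    moreover have "DERIV (\<lambda>r. ln (1 + ?s r)) r :> ?s' / (1 + r powr ?q)"
    proof -
      have "DERIV (\<lambda>r. 1 + ?s r) r :> 0 + ?s'" by (intro DERIV_add DERIV_const abs_powr_deriv[OF q r])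
      from DERIV_chain2[OF DERIV_ln_divide[OF s[of r]] this] show ?thesis using r by simp
    qed
    ultimately have "DERIV ?F r :> ?om * (?s' / (1 + r powr ?q) - (\<Sum>k = 1..?N - 1. ?s' / (1 + r powr ?q)\<^sup>2 * ?t ^ (k - 1)))"
      by (intro DERIV_cmult DERIV_diff)
    moreover have "?om * (?s' / (1 + r powr ?q) - (\<Sum>k = 1..?N - 1. ?s' / (1 + r powr ?q)\<^sup>2 * ?t ^ (k - 1)))
        = real ?N * ?V * r ^ (?N - 1) * ?f r"
    proof -
      have "(\<Sum>k = 1..?N - 1. ?s' / (1 + r powr ?q)\<^sup>2 * ?t ^ (k - 1)) = ?s' / (1 + r powr ?q)\<^sup>2 * (\<Sum>k<?N - 1. ?t ^ k)"
        unfolding sum_distrib_left[symmetric]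
        by (intro arg_cong2[where f = "(*)"] refl sum.reindex_bij_witness[of _ Suc "\<lambda>k. k - 1"]) auto
      \<comment> \<open>One factor 1/(1 + s) equals 1 - t and closes the geometric sum.\<close>
      also have "\<dots> = ?s' / (1 + r powr ?q) * ((1 - ?t) * (\<Sum>k<?N - 1. ?t ^ k))"
        using sr by (simp add: field_simps power2_eq_square)
      also have "(1 - ?t) * (\<Sum>k<?N - 1. ?t ^ k) = 1 - ?t ^ (?N - 1)" by (simp add: one_diff_power_eq)
      finally have "?s' / (1 + r powr ?q) - (\<Sum>k = 1..?N - 1. ?s' / (1 + r powr ?q)\<^sup>2 * ?t ^ (k - 1))
          = ?s' / (1 + r powr ?q) * ?t ^ (?N - 1)" by (simp add: algebra_simps)
      also have "\<dots> = ?q * ((r powr ?q) ^ (?N - 1) * r powr (?q - 1)) / (1 + r powr ?q) ^ ?N"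
        unfolding p(3)[of "1 + r powr ?q"] by (simp add: power_divide mult_ac)
      also have "\<dots> = ?q * (r ^ (?N - 1) * r powr ?q) / (1 + r powr ?q) ^ ?N"
        by (simp only: radial_power_identities(1)[OF dim r])
      finally show ?thesis
        unfolding omega_tilde_eq by (simp add: power_mult_distrib p(3)[of ?q] mult_ac)
    qed
    ultimately show ?thesis by simp
  qed
  have f0: "0 \<le> ?f r" if "0 \<le> r" for r using q by simp
  have nn: "(\<integral>\<^sup>+x. ennreal (indicator (cball 0 R) x * norm (grad v (x::'a)) ^ ?N) \<partial>lborel) = ennreal (?F R - ?F 0)"
    unfolding norm_grad_v_power[OF dim] profile_def
    using R f0 by (intro nn_integral_radial_cball[where F = ?F and f = ?f] D) measurable
  have F0: "?F 0 = 0"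
  proof -
    have "(\<Sum>k = 1..?N - 1. (0::real) ^ k / real k) = 0" by (intro sum.neutral) auto
    then show ?thesis by simp
  qed
  have [measurable]: "grad v \<in> borel_measurable (borel :: 'a measure)"
    using continuous_grad_v[OF dim] by (rule borel_measurable_continuous_onI)
  show i: "integrable lborel (\<lambda>x::'a. indicator (cball 0 R) x * norm (grad v x) ^ ?N)"
    using nn by (intro integrableI_nonneg) auto
  have FR: "?F R = ?om * energy_value TYPE('a) R" using R by (simp add: energy_value_def)
  have e: "(\<integral>\<^sup>+x. ennreal (indicator (cball (0::'a) R) x * norm (grad v x) ^ ?N) \<partial>lborel)
     = ennreal (\<integral>x. indicator (cball (0::'a) R) x * norm (grad v x) ^ ?N \<partial>lborel)"
    by (rule nn_integral_eq_integral[OF i]) simp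
  have "ennreal (\<integral>x. indicator (cball (0::'a) R) x * norm (grad v x) ^ ?N \<partial>lborel) = ennreal (?om * energy_value TYPE('a) R)"
    using nn unfolding e F0 FR by (simp only: diff_zero)
  \<comment> \<open>\<open>ennreal\<close> sends negative reals to 0, so non-negativity must be
    known before the equation can be read in the reals.\<close>
  moreover have "?om * energy_value TYPE('a) R \<ge> 0"
  proof -
    have "?F 0 \<le> ?F R"
    proof (rule DERIV_nonneg_imp_nondecreasing[where f = ?F])
      fix r :: real assume r: "0 \<le> r" "r \<le> R"
      have "real ?N * ?V * r ^ (?N - 1) * ?f r \<ge> 0" using r V f0[OF r(1)] by (intro mult_nonneg_nonneg) auto
      then show "\<exists>y. DERIV ?F r :> y \<and> y \<ge> 0" using D[OF r(1)] by blast
    qed (use R in simp)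
    then show ?thesis unfolding F0 FR .
  qed
  ultimately have "(\<integral>x. indicator (cball (0::'a) R) x * norm (grad v x) ^ ?N \<partial>lborel) = ?om * energy_value TYPE('a) R"
    by (subst (asm) ennreal_inj) (auto intro!: Bochner_Integration.integral_nonneg)
  then show "1 / ?om * (\<integral>x. indicator (cball (0::'a) R) x * norm (grad v x) ^ ?N \<partial>lborel) = energy_value TYPE('a) R"
    using om by simp
qed

text \<open>At infinity |grad v|^N decays like |x|^(-N) and just fails to be integrable. The squared
  logarithm repairs this, with antiderivative -1/(1 + ln (1 + s)) up to a constant. The gradients of
  the cutoffs are later compared with this function.\<close>

lemma integrable_grad_v_log:
  assumes dim: "DIM('a::euclidean_space) \<ge> 2"
  shows "integrable lborel (\<lambda>x::'a. norm (grad v x) ^ DIM('a) / (1 + ln (1 + profile x))\<^sup>2)"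
proof -
  let ?N = "DIM('a)" and ?q = "conj_exp TYPE('a)" and ?V = "ball_volume TYPE('a)"
  let ?s = "\<lambda>r::real. \<bar>r\<bar> powr ?q"
  have V: "?V > 0" by (rule ball_volume_pos)
  have q: "?q > 1" by (rule conj_exp(1)[OF dim])
  have s: "1 + ?s r \<ge> 1" for r using powr_ge_zero[of "\<bar>r\<bar>" ?q] by linarith
  have l: "ln (1 + ?s r) \<ge> 0" for r using s[of r] by simp
  note p = power_split[OF dim]
  let ?f = "\<lambda>r. (real ?N * ?q) ^ ?N * r powr ?q / (1 + r powr ?q) ^ ?N / (1 + ln (1 + r powr ?q))\<^sup>2"
  let ?C = "real ?N * ?V * (real ?N * ?q) ^ ?N"
  let ?g = "\<lambda>r. ?C * (r powr (?q - 1) / (1 + r powr ?q) / (1 + ln (1 + r powr ?q))\<^sup>2)"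
  let ?F = "\<lambda>r. - (?C / ?q) * (1 / (1 + ln (1 + ?s r)))"
  have "integrable lborel (\<lambda>x::'a. ?f (norm x))"
  proof (rule integrable_radial[where F = ?F and g = ?g and T = "- (?C / ?q) * 0"])
    show "DERIV ?F r :> ?g r" if r: "0 \<le> r" for r
    proof -
      have "DERIV (\<lambda>r. 1 + ?s r) r :> 0 + ?q * r powr (?q - 1)" by (intro DERIV_add DERIV_const abs_powr_deriv[OF q r])
      from DERIV_chain2[OF DERIV_ln_divide this] s[of r]
      have "DERIV (\<lambda>r. ln (1 + ?s r)) r :> 1 / (1 + ?s r) * (0 + ?q * r powr (?q - 1))" by auto
      then have "DERIV (\<lambda>r. 1 + ln (1 + ?s r)) r :> 0 + 1 / (1 + ?s r) * (0 + ?q * r powr (?q - 1))" by (intro DERIV_add DERIV_const)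
      moreover have "1 + ln (1 + ?s r) \<noteq> 0" using l[of r] by linarith
      ultimately have "DERIV (\<lambda>r. inverse (1 + ln (1 + ?s r))) r :>
        - ((0 + 1 / (1 + ?s r) * (0 + ?q * r powr (?q - 1))) * inverse ((1 + ln (1 + ?s r)) ^ Suc (Suc 0)))"
        by (rule DERIV_inverse_fun)
      then have "DERIV (\<lambda>r. 1 / (1 + ln (1 + ?s r))) r :> - ((1 / (1 + ?s r) * (?q * r powr (?q - 1))) / (1 + ln (1 + ?s r))\<^sup>2)"
        by (simp only: inverse_eq_divide add_0_left numeral_2_eq_2 times_divide_eq_right mult_1_right)
      from DERIV_cmult[OF this, of "- (?C / ?q)"] show ?thesis using r q by (simp add: field_simps)
    qed
    show "(?F \<longlongrightarrow> - (?C / ?q) * 0) at_top"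
    proof (intro tendsto_mult tendsto_const)
      have "filterlim (\<lambda>r. 1 + ln (1 + ?s r)) at_top at_top"
      proof (rule filterlim_at_top_mono[OF ln_at_top])
        show "eventually (\<lambda>r. ln r \<le> 1 + ln (1 + ?s r)) at_top"
          using eventually_ge_at_top[of 1]
        proof eventually_elim
          fix r :: real assume r: "r \<ge> 1"
          then have "r \<le> ?s r" using powr_mono[of 1 ?q r] q by simp
          then have "ln r \<le> ln (1 + ?s r)" using r by simp
          then show "ln r \<le> 1 + ln (1 + ?s r)" by simp
        qed
      qed
      from tendsto_inverse_0_at_top[OF this]
      show "((\<lambda>r. 1 / (1 + ln (1 + ?s r))) \<longlongrightarrow> 0) at_top" by (simp add: inverse_eq_divide)
    qed
    show "real ?N * ?V * r ^ (?N - 1) * ?f r \<le> ?g r" if r: "0 \<le> r" for r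
    proof -
      have sr: "1 + r powr ?q \<ge> 1" by simp
      have "(r powr ?q) ^ (?N - 1) \<le> (1 + r powr ?q) ^ (?N - 1)" by (intro power_mono) auto
      then have "(r powr ?q) ^ (?N - 1) / (1 + r powr ?q) ^ ?N \<le> 1 / (1 + r powr ?q)"
      proof -
        have B: "(1 + r powr ?q) ^ (?N - 1) > 0" by (intro zero_less_power add_pos_nonneg) auto
        have aux: "a \<le> b \<Longrightarrow> b > 0 \<Longrightarrow> a / b \<le> 1" for a b :: real by simp
        have "(r powr ?q) ^ (?N - 1) / (1 + r powr ?q) ^ (?N - 1) \<le> 1"
          by (rule aux[OF _ B]) fact
        then have "(r powr ?q) ^ (?N - 1) / (1 + r powr ?q) ^ (?N - 1) / (1 + r powr ?q) \<le> 1 / (1 + r powr ?q)"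
          by (rule divide_right_mono) (use sr in linarith)
        then show ?thesis by (simp only: p(3)[of "1 + r powr ?q"] divide_divide_eq_left)
      qed
      then have "(r powr ?q) ^ (?N - 1) / (1 + r powr ?q) ^ ?N * (?C * r powr (?q - 1) / (1 + ln (1 + r powr ?q))\<^sup>2)
        \<le> 1 / (1 + r powr ?q) * (?C * r powr (?q - 1) / (1 + ln (1 + r powr ?q))\<^sup>2)"
        using V q by (intro mult_right_mono) auto
      moreover have "real ?N * ?V * r ^ (?N - 1) * ?f r
        = ?C * (r ^ (?N - 1) * r powr ?q) / (1 + r powr ?q) ^ ?N / (1 + ln (1 + r powr ?q))\<^sup>2" by (simp add: mult_ac)
      moreover have "\<dots> = (r powr ?q) ^ (?N - 1) / (1 + r powr ?q) ^ ?N * (?C * r powr (?q - 1) / (1 + ln (1 + r powr ?q))\<^sup>2)"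
        unfolding radial_power_identities(1)[OF dim r] by (simp add: mult_ac)
      moreover have "1 / (1 + r powr ?q) * (?C * r powr (?q - 1) / (1 + ln (1 + r powr ?q))\<^sup>2) = ?g r" by simp
      ultimately show ?thesis by linarith
    qed
    show "0 \<le> ?f r" for r using q by simp
  qed measurable
  then show ?thesis by (simp add: norm_grad_v_power[OF dim] profile_def)
qed

section \<open>The Liouville equation satisfied by v\<close>

definition liouville_field :: "'a::euclidean_space \<Rightarrow> 'a" where
  "liouville_field x = norm (grad v x) ^ (DIM('a) - 2) *\<^sub>R grad v x"

text \<open>Integration by parts is available for scalar functions, so the field is treated by
  components: \<open>L b\<close> is the gradient of one component, and the divergence is the sum of
  the diagonal entries. By Euler's identity its numerator is (N - 1) q s - N (1 + s) = -N, up to the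
  constant \<open>c\<close>.\<close>

lemma liouville_field_component:
  fixes x :: "'a::euclidean_space"
  assumes dim: "DIM('a) \<ge> 2"
  defines "c \<equiv> (real DIM('a) * conj_exp TYPE('a)) ^ (DIM('a) - 1)"
  defines "L \<equiv> \<lambda>b x. (x \<bullet> b) *\<^sub>R (c * real (DIM('a) - 1) / (1 + profile x) ^ DIM('a)) *\<^sub>R grad_profile x + (- c / (1 + profile x) ^ (DIM('a) - 1)) *\<^sub>R b"
  shows "GDERIV (\<lambda>x. liouville_field x \<bullet> b) x :> L b x" "continuous_on UNIV (L b)"
    "(\<Sum>b\<in>Basis. L b x \<bullet> b) = - (omega_tilde TYPE('a) / real DIM('a)) * mu_dens x"
proof -
  let ?N = "DIM('a)" and ?q = "conj_exp TYPE('a)" and ?V = "ball_volume TYPE('a)"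
  have q: "?q > 1" by (rule conj_exp(1)[OF dim])
  note p = power_split[OF dim]
  have "DERIV (\<lambda>s. - c / (1 + s) ^ (?N - 1)) (profile x) :> c * real (?N - 1) / (1 + profile x) ^ ?N"
  proof -
    have 1: "DERIV (\<lambda>s. (1 + s) ^ (?N - 1)) (profile x) :> real (?N - 1) * (1 * (1 + profile x) ^ (?N - 1 - Suc 0))"
      by (rule DERIV_power) (auto intro!: derivative_eq_intros)
    have "DERIV (\<lambda>s. (- c) * inverse ((1 + s) ^ (?N - 1))) (profile x) :>
       (- c) * (- (inverse ((1 + profile x) ^ (?N - 1)) * (real (?N - 1) * (1 * (1 + profile x) ^ (?N - 1 - Suc 0))) * inverse ((1 + profile x) ^ (?N - 1))))"
      by (intro DERIV_cmult DERIV_inverse_fun[OF 1, unfolded power_Suc power_0 mult_1_right] DERIV_inverse'[OF 1]) simp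
    moreover have "(1 + profile x) ^ (?N - 1) = (1 + profile x) ^ (?N - 2) * (1 + profile x)"
      "(1 + profile x) ^ ?N = (1 + profile x) ^ (?N - 2) * (1 + profile x)\<^sup>2" by (rule p)+
    ultimately show ?thesis
      by (simp add: divide_inverse power2_eq_square numeral_2_eq_2 mult_ac)
  qed
  from GDERIV_DERIV_compose[OF GDERIV_profile[OF dim] this]
  have "GDERIV (\<lambda>x::'a. - c / (1 + profile x) ^ (?N - 1)) x :> (c * real (?N - 1) / (1 + profile x) ^ ?N) *\<^sub>R grad_profile x" .
  moreover have "GDERIV (\<lambda>x. x \<bullet> b) x :> b"
    unfolding gderiv_def by (auto intro!: derivative_eq_intros)
  ultimately have "GDERIV (\<lambda>x. (- c / (1 + profile x) ^ (?N - 1)) * (x \<bullet> b)) x :>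
     (- c / (1 + profile x) ^ (?N - 1)) *\<^sub>R b + (x \<bullet> b) *\<^sub>R (c * real (?N - 1) / (1 + profile x) ^ ?N) *\<^sub>R grad_profile x"
    by (rule GDERIV_mult)
  then show "GDERIV (\<lambda>x. liouville_field x \<bullet> b) x :> L b x"
    by (simp add: liouville_field_def grad_v_field[OF dim] L_def c_def add.commute)
  show "continuous_on UNIV (L b)"
    unfolding L_def by (intro continuous_intros continuous_grad_profile continuous_profile dim) auto
  have "(\<Sum>b\<in>Basis. L b x \<bullet> b)
      = (c * real (?N - 1) / (1 + profile x) ^ ?N) * (\<Sum>b\<in>Basis. (x \<bullet> b) * (grad_profile x \<bullet> b)) + (\<Sum>b\<in>(Basis::'a set). - c / (1 + profile x) ^ (?N - 1))"
    unfolding sum_distrib_left sum.distrib[symmetric]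
    by (intro sum.cong refl) (simp add: L_def inner_add_left inner_diff_left mult_ac)
  also have "(\<Sum>b\<in>Basis. (x \<bullet> b) * (grad_profile x \<bullet> b)) = ?q * profile x"
    using inner_grad_profile[OF dim, of x] by (simp add: euclidean_inner[of x "grad_profile x"])
  also have "(c * real (?N - 1) / (1 + profile x) ^ ?N) * (?q * profile x) + (\<Sum>b\<in>(Basis::'a set). - c / (1 + profile x) ^ (?N - 1))
     = c * (real (?N - 1) * ?q) * profile x / (1 + profile x) ^ ?N - real ?N * c * (1 + profile x) / (1 + profile x) ^ ?N"
    using p(3)[of "1 + profile x"] by (simp add: mult_ac)
  also have "\<dots> = - (real ?N * c) / (1 + profile x) ^ ?N"
    unfolding conj_exp(3)[OF dim] by (simp add: diff_divide_distrib[symmetric] algebra_simps)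
  also have "\<dots> = - (omega_tilde TYPE('a) / real ?N) * mu_dens x"
    using ball_volume_pos[where 'a='a] p(3)[of "real ?N"]
    by (simp add: mu_dens_eq omega_tilde_eq c_def power_mult_distrib field_simps)
  finally show "(\<Sum>b\<in>Basis. L b x \<bullet> b) = - (omega_tilde TYPE('a) / real ?N) * mu_dens x" .
qed

section \<open>Integration by parts\<close>

text \<open>Integration by parts for a pair of a function and its weak gradient against every \<open>C\<^sup>1\<close>
  function, not only against test functions.\<close>
definition by_parts :: "('a::euclidean_space \<Rightarrow> real) \<Rightarrow> ('a \<Rightarrow> 'a) \<Rightarrow> bool" where
  "by_parts f Z \<longleftrightarrow> (\<forall>l D. (\<forall>x. GDERIV l x :> D x) \<longrightarrow> continuous_on UNIV D \<longrightarrow>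
     integrable lborel (\<lambda>x. f x *\<^sub>R D x + l x *\<^sub>R Z x) \<and> (\<integral>x. f x *\<^sub>R D x + l x *\<^sub>R Z x \<partial>lborel) = 0)"

lemma by_partsD:
  assumes "by_parts f Z" "\<And>x. GDERIV l x :> D x" "continuous_on UNIV D"
  shows "integrable lborel (\<lambda>x. f x *\<^sub>R D x + l x *\<^sub>R Z x)" "(\<integral>x. f x *\<^sub>R D x + l x *\<^sub>R Z x \<partial>lborel) = 0"
  using assms unfolding by_parts_def by blast+

lemma by_parts_add:
  assumes "by_parts f Z" "by_parts g W"
  shows "by_parts (\<lambda>x. f x + g x) (\<lambda>x. Z x + W x)"
  unfolding by_parts_def
proof (intro allI impI)
  fix l :: "'a \<Rightarrow> real" and D assume "\<forall>x. GDERIV l x :> D x" "continuous_on UNIV D"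
  then have l: "\<And>x. GDERIV l x :> D x" "continuous_on UNIV D" by auto
  have e: "(f x + g x) *\<^sub>R D x + l x *\<^sub>R (Z x + W x) = (f x *\<^sub>R D x + l x *\<^sub>R Z x) + (g x *\<^sub>R D x + l x *\<^sub>R W x)" for x
    by (simp add: algebra_simps)
  show "integrable lborel (\<lambda>x. (f x + g x) *\<^sub>R D x + l x *\<^sub>R (Z x + W x)) \<and>
     (\<integral>x. (f x + g x) *\<^sub>R D x + l x *\<^sub>R (Z x + W x) \<partial>lborel) = 0"
    unfolding e using by_partsD[OF assms(1) l] by_partsD[OF assms(2) l]
    by (auto simp: Bochner_Integration.integral_add)
qed

lemma lipschitz_by_parts:
  assumes f: "lipschitz_on_balls f" "\<And>x. norm x > K \<Longrightarrow> f x = 0" "AE x in lborel. GDERIV f x :> Z x" "Z \<in> borel_measurable borel"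
  shows "by_parts f Z"
  unfolding by_parts_def
proof (intro allI impI)
  fix l :: "'a \<Rightarrow> real" and D assume "\<forall>x. GDERIV l x :> D x" and D: "continuous_on UNIV D"
  then have l: "\<And>x. GDERIV l x :> D x" by auto
  have L: "lipschitz_on_balls l" by (rule C1_lipschitz_on_balls[OF l D])
  have [measurable]: "f \<in> borel_measurable borel" "l \<in> borel_measurable borel" "D \<in> borel_measurable borel" "Z \<in> borel_measurable borel"
    using lipschitz_on_balls_continuous[OF f(1)] lipschitz_on_balls_continuous[OF L] D f(4)
    by (auto intro: borel_measurable_continuous_onI)
  have 1: "lipschitz_on_balls (\<lambda>x. f x * l x)" by (rule lipschitz_on_balls_mult[OF f(1) L])
  have 2: "f x * l x = 0" if "norm x > K" for x using f(2)[OF that] by simp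
  have 3: "AE x in lborel. GDERIV (\<lambda>x. f x * l x) x :> f x *\<^sub>R D x + l x *\<^sub>R Z x"
    using f(3) by eventually_elim (intro GDERIV_mult l)
  have 4: "(\<lambda>x. f x *\<^sub>R D x + l x *\<^sub>R Z x) \<in> borel_measurable borel" by measurable
  show "integrable lborel (\<lambda>x. f x *\<^sub>R D x + l x *\<^sub>R Z x) \<and> (\<integral>x. f x *\<^sub>R D x + l x *\<^sub>R Z x \<partial>lborel) = 0"
    using integral_gradient_eq_0[OF 1 2 3 4] by blast
qed

text \<open>The cutoff is moved to the test side: \<open>\<eta>\<close> times l is Lipschitz with
  bounded support, so the weak chain rule for F(u) applies to it even though l is an arbitrary C^1
  function.\<close>

lemma weak_chain_by_parts:
  fixes u :: "'a::euclidean_space \<Rightarrow> real"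
  assumes u: "has_weak_grad UNIV u G"
    and F: "\<And>t. (F has_real_derivative F' t) (at t)" "continuous_on UNIV F'" "\<And>t. \<bar>F' t\<bar> \<le> c"
    and e: "\<And>x. GDERIV \<eta> x :> E x" "continuous_on UNIV E" "\<And>x. norm x > K \<Longrightarrow> \<eta> x = 0"
  shows "by_parts (\<lambda>x. \<eta> x * F (u x)) (\<lambda>x. F (u x) *\<^sub>R E x + (\<eta> x * F' (u x)) *\<^sub>R G x)"
  unfolding by_parts_def
proof (intro allI impI)
  fix l :: "'a \<Rightarrow> real" and D assume "\<forall>x. GDERIV l x :> D x" and D: "continuous_on UNIV D"
  then have l: "\<And>x. GDERIV l x :> D x" by auto
  have L: "lipschitz_on_balls l" "lipschitz_on_balls \<eta>"
    by (rule C1_lipschitz_on_balls[OF l D], rule C1_lipschitz_on_balls[OF e(1,2)])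
  have [measurable]: "\<eta> \<in> borel_measurable borel" "l \<in> borel_measurable borel" "D \<in> borel_measurable borel" "E \<in> borel_measurable borel"
    using lipschitz_on_balls_continuous[OF L(1)] lipschitz_on_balls_continuous[OF L(2)] D e(2)
    by (auto intro: borel_measurable_continuous_onI)
  have 1: "lipschitz_on_balls (\<lambda>x. \<eta> x * l x)" by (rule lipschitz_on_balls_mult[OF L(2,1)])
  have 2: "\<eta> x * l x = 0" if "norm x > K" for x using e(3)[OF that] by simp
  have 3: "AE x in lborel. GDERIV (\<lambda>x. \<eta> x * l x) x :> \<eta> x *\<^sub>R D x + l x *\<^sub>R E x"
    by (intro AE_I2 GDERIV_mult l e)
  have 4: "(\<lambda>x. \<eta> x *\<^sub>R D x + l x *\<^sub>R E x) \<in> borel_measurable borel" by measurable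
  have eq: "F (u x) *\<^sub>R (\<eta> x *\<^sub>R D x + l x *\<^sub>R E x) + (\<eta> x * l x * F' (u x)) *\<^sub>R G x
     = (\<eta> x * F (u x)) *\<^sub>R D x + l x *\<^sub>R (F (u x) *\<^sub>R E x + (\<eta> x * F' (u x)) *\<^sub>R G x)" for x
    by (simp add: algebra_simps)
  show "integrable lborel (\<lambda>x. (\<eta> x * F (u x)) *\<^sub>R D x + l x *\<^sub>R (F (u x) *\<^sub>R E x + (\<eta> x * F' (u x)) *\<^sub>R G x)) \<and>
     (\<integral>x. (\<eta> x * F (u x)) *\<^sub>R D x + l x *\<^sub>R (F (u x) *\<^sub>R E x + (\<eta> x * F' (u x)) *\<^sub>R G x) \<partial>lborel) = 0"
    using weak_chain_rule_integral[OF u F 1 2 3 4] unfolding eq by blast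
qed

lemma by_parts_has_weak_grad:
  assumes "by_parts f Z" and f: "locally_integrable_on f UNIV" and Z: "locally_integrable_on Z UNIV"
  shows "has_weak_grad UNIV f Z"
proof (rule has_weak_gradI[OF f Z])
  fix \<phi> :: "'a \<Rightarrow> real" assume \<phi>: "\<phi> \<in> test_functions UNIV"
  obtain K where K: "compact K" "K \<subseteq> UNIV" and z: "\<And>x. x \<notin> K \<Longrightarrow> \<phi> x = 0" "\<And>x. x \<notin> K \<Longrightarrow> grad \<phi> x = 0"
    and c: "continuous_on UNIV \<phi>" "continuous_on UNIV (grad \<phi>)"
    using test_functionsE[OF \<phi>] by metis
  have "(\<integral>x. f x *\<^sub>R grad \<phi> x + \<phi> x *\<^sub>R Z x \<partial>lborel) = 0"
    by (rule by_partsD(2)[OF assms(1) test_functions_GDERIV[OF \<phi>] c(2)])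
  then show "(\<integral>x. f x *\<^sub>R grad \<phi> x \<partial>lborel) = - (\<integral>x. \<phi> x *\<^sub>R Z x \<partial>lborel)"
    using integrable_test_scaleR[OF f K c(2) z(2)] integrable_test_scaleR'[OF Z K c(1) z(1)]
    by (simp add: eq_neg_iff_add_eq_0)
qed

text \<open>Integration by parts against the b-component of the field, read in direction b and
  summed over b, produces the divergence. This is the identity by which the linear part of H cancels
  the mean in I.\<close>

lemma liouville_by_parts:
  fixes f :: "'a::euclidean_space \<Rightarrow> real"
  assumes dim: "DIM('a) \<ge> 2" and "by_parts f Z" and i: "integrable lborel (\<lambda>x. f x * mu_dens x)"
  shows "integrable lborel (\<lambda>x. liouville_field x \<bullet> Z x)"
    "real DIM('a) * (\<integral>x. liouville_field x \<bullet> Z x \<partial>lborel) = omega_tilde TYPE('a) * (\<integral>x. f x * mu_dens x \<partial>lborel)"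
proof -
  define c where "c = (real DIM('a) * conj_exp TYPE('a)) ^ (DIM('a) - 1)"
  define L :: "'a \<Rightarrow> 'a \<Rightarrow> 'a" where "L b x = (x \<bullet> b) *\<^sub>R (c * real (DIM('a) - 1) / (1 + profile x) ^ DIM('a)) *\<^sub>R grad_profile x
     + (- c / (1 + profile x) ^ (DIM('a) - 1)) *\<^sub>R b" for b x
  note X = liouville_field_component[OF dim, folded c_def, folded L_def]
  let ?om = "omega_tilde TYPE('a)" and ?N = "real DIM('a)"
  have "integrable lborel (\<lambda>x. (f x *\<^sub>R L b x + (liouville_field x \<bullet> b) *\<^sub>R Z x) \<bullet> b)"
    "(\<integral>x. (f x *\<^sub>R L b x + (liouville_field x \<bullet> b) *\<^sub>R Z x) \<bullet> b \<partial>lborel) = 0" for b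
    using by_partsD[OF assms(2) X(1,2), of b] by (auto simp del: inner_add_left)
  then have S: "integrable lborel (\<lambda>x. \<Sum>b\<in>Basis. (f x *\<^sub>R L b x + (liouville_field x \<bullet> b) *\<^sub>R Z x) \<bullet> b)"
    "(\<integral>x. (\<Sum>b\<in>Basis. (f x *\<^sub>R L b x + (liouville_field x \<bullet> b) *\<^sub>R Z x) \<bullet> b) \<partial>lborel) = 0"
    by (auto intro!: Bochner_Integration.integrable_sum simp del: inner_add_left)
  have eq: "(\<Sum>b\<in>Basis. (f x *\<^sub>R L b x + (liouville_field x \<bullet> b) *\<^sub>R Z x) \<bullet> b)
     = liouville_field x \<bullet> Z x - ?om / ?N * (f x * mu_dens x)" for x
  proof -
    have "(\<Sum>b\<in>Basis. (f x *\<^sub>R L b x + (liouville_field x \<bullet> b) *\<^sub>R Z x) \<bullet> b)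
      = f x * (\<Sum>b\<in>Basis. L b x \<bullet> b) + (\<Sum>b\<in>Basis. (liouville_field x \<bullet> b) * (Z x \<bullet> b))"
      by (simp add: inner_add_left sum.distrib sum_distrib_left)
    also have "(\<Sum>b\<in>Basis. (liouville_field x \<bullet> b) * (Z x \<bullet> b)) = liouville_field x \<bullet> Z x"
      by (rule euclidean_inner[symmetric])
    finally show ?thesis unfolding X(3) by simp
  qed
  have "integrable lborel (\<lambda>x. (liouville_field x \<bullet> Z x - ?om / ?N * (f x * mu_dens x)) + ?om / ?N * (f x * mu_dens x))"
    using S(1)[unfolded eq] i by (intro Bochner_Integration.integrable_add integrable_mult_right)
  then show iX: "integrable lborel (\<lambda>x. liouville_field x \<bullet> Z x)" by simp
  have "(\<integral>x. liouville_field x \<bullet> Z x \<partial>lborel) - ?om / ?N * (\<integral>x. f x * mu_dens x \<partial>lborel) = 0"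
    using S(2)[unfolded eq] iX i by (simp del: times_divide_eq_left)
  then show "?N * (\<integral>x. liouville_field x \<bullet> Z x \<partial>lborel) = ?om * (\<integral>x. f x * mu_dens x \<partial>lborel)"
    by (simp add: field_simps)
qed

section \<open>Truncation of v at a sphere\<close>

definition v_at :: "'a::euclidean_space itself \<Rightarrow> real \<Rightarrow> real" where
  "v_at T R = - ln (ball_volume T) - real DIM('a) * ln (1 + R powr conj_exp T)"

text \<open>Since v decreases radially, the positive part equals v - v(R) on the ball and 0 outside;
  in the form with \<open>max\<close> its Lipschitz property is immediate.\<close>

definition plateau :: "real \<Rightarrow> 'a::euclidean_space \<Rightarrow> real" where
  "plateau R x = max (v x - v_at TYPE('a) R) 0"

lemma v_v_at:
  fixes x :: "'a::euclidean_space"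
  assumes dim: "DIM('a) \<ge> 2" and R: "R \<ge> 0"
  shows "norm x < R \<Longrightarrow> v x > v_at TYPE('a) R" "norm x > R \<Longrightarrow> v x < v_at TYPE('a) R" "norm x = R \<Longrightarrow> v x = v_at TYPE('a) R"
proof -
  have q: "conj_exp TYPE('a) > 0" using conj_exp(1)[OF dim] by simp
  have s: "1 + R powr conj_exp TYPE('a) > 0" using powr_ge_zero[of R "conj_exp TYPE('a)"] by linarith
  have "norm x < R \<Longrightarrow> profile x < R powr conj_exp TYPE('a)" "norm x > R \<Longrightarrow> profile x > R powr conj_exp TYPE('a)"
    using R q by (auto simp: profile_def intro: powr_less_mono2)
  moreover have "ln (1 + profile x) < ln (1 + R powr conj_exp TYPE('a))" if "profile x < R powr conj_exp TYPE('a)"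
    by (rule ln_less_cancel_iff[THEN iffD2, OF profile_add_pos(1) s]) (use that in simp)
  moreover have "ln (1 + R powr conj_exp TYPE('a)) < ln (1 + profile x)" if "profile x > R powr conj_exp TYPE('a)"
    by (rule ln_less_cancel_iff[THEN iffD2, OF s profile_add_pos(1)]) (use that in simp)
  ultimately show "norm x < R \<Longrightarrow> v x > v_at TYPE('a) R" "norm x > R \<Longrightarrow> v x < v_at TYPE('a) R"
    by (auto simp: v_eq v_at_def)
  show "norm x = R \<Longrightarrow> v x = v_at TYPE('a) R" by (auto simp: v_eq v_at_def profile_def)
qed

lemma plateau_simps:
  fixes x :: "'a::euclidean_space"
  assumes dim: "DIM('a) \<ge> 2" and R: "R \<ge> 0"
  shows "norm x \<le> R \<Longrightarrow> plateau R x = v x - v_at TYPE('a) R" "norm x \<ge> R \<Longrightarrow> plateau R x = 0"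
  using v_v_at[OF dim R, of x] by (auto simp: plateau_def max_def less_eq_real_def)

lemma GDERIV_grad_v: "DIM('a::euclidean_space) \<ge> 2 \<Longrightarrow> GDERIV v x :> grad v (x::'a)"
  using GDERIV_v[of x] grad_v[of x] by simp

lemma v_lipschitz_on_balls:
  assumes dim: "DIM('a::euclidean_space) \<ge> 2" shows "lipschitz_on_balls (v :: 'a \<Rightarrow> real)" "continuous_on UNIV (v :: 'a \<Rightarrow> real)"
proof -
  show "lipschitz_on_balls (v :: 'a \<Rightarrow> real)"
    by (rule C1_lipschitz_on_balls[OF GDERIV_grad_v[OF dim] continuous_grad_v[OF dim]])
  then show "continuous_on UNIV (v :: 'a \<Rightarrow> real)" by (rule lipschitz_on_balls_continuous)
qed

lemma GDERIV_transform_open: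
  assumes "GDERIV f x :> D" "open S" "x \<in> S" "\<And>y. y \<in> S \<Longrightarrow> f y = g y"
  shows "GDERIV g x :> D"
  using has_derivative_transform_within_open[OF assms(1)[unfolded gderiv_def] assms(2,3)] assms(4)
  by (simp add: gderiv_def)

text \<open>Differentiability can fail only on the sphere of radius R, a null set.\<close>

lemma plateau_lipschitz:
  assumes dim: "DIM('a::euclidean_space) \<ge> 2" and R: "R \<ge> 0"
  shows "lipschitz_on_balls (plateau R :: 'a \<Rightarrow> real)"
    "AE x in lborel. GDERIV (plateau R) x :> indicator (cball 0 R) x *\<^sub>R grad v (x::'a)"
proof -
  show "lipschitz_on_balls (plateau R :: 'a \<Rightarrow> real)"
    unfolding plateau_def[abs_def]
    by (intro lipschitz_on_balls_max lipschitz_on_balls_diff lipschitz_on_balls_const v_lipschitz_on_balls dim)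
  show "AE x in lborel. GDERIV (plateau R) x :> indicator (cball 0 R) x *\<^sub>R grad v (x::'a)"
    using AE_not_on_sphere[of R]
  proof eventually_elim
    fix x :: 'a assume x: "norm x \<noteq> R"
    show "GDERIV (plateau R) x :> indicator (cball 0 R) x *\<^sub>R grad v x"
    proof (cases "norm x < R")
      case True
      have "GDERIV (\<lambda>x::'a. v x - v_at TYPE('a) R) x :> grad v x - 0"
        by (intro GDERIV_diff GDERIV_const GDERIV_grad_v dim)
      then have "GDERIV (plateau R) x :> grad v x"
        by (intro GDERIV_transform_open[of _ x _ "ball 0 R" "plateau R"])
           (use True plateau_simps(1)[OF dim R] in auto)
      then show ?thesis using True by simp
    next
      case False
      have "GDERIV (\<lambda>x::'a. 0) x :> 0" by (rule GDERIV_const)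
      then have "GDERIV (plateau R) x :> 0"
        by (intro GDERIV_transform_open[of "\<lambda>x. 0" x 0 "- cball 0 R" "plateau R"])
           (use False x plateau_simps(2)[OF dim R] in \<open>auto intro: open_Compl\<close>)
      then show ?thesis using False x by simp
    qed
  qed
qed

section \<open>Comparison on large balls\<close>

lemma power_add_le:
  fixes a b :: real
  assumes "a \<ge> 0" "b \<ge> 0"
  shows "(a + b) ^ n \<le> 2 ^ n * (a ^ n + b ^ n)"
proof -
  have "(a + b) ^ n \<le> (2 * max a b) ^ n" using assms by (intro power_mono) auto
  also have "\<dots> = 2 ^ n * (max a b) ^ n" by (rule power_mult_distrib)
  also have "\<dots> \<le> 2 ^ n * (a ^ n + b ^ n)"
    using assms by (intro mult_left_mono) (auto simp: max_def)
  finally show ?thesis .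
qed

text \<open>Exponential integrals stand under logarithms, so their strict positivity is needed
  repeatedly.\<close>

lemma integral_pos_lborel:
  fixes f :: "'a::euclidean_space \<Rightarrow> real"
  assumes i: "integrable lborel (\<lambda>x. indicator A x * f x)" and A: "A \<in> sets lborel" "emeasure lborel A \<noteq> 0"
    and f: "\<And>x. f x > 0"
  shows "(\<integral>x. indicator A x * f x \<partial>lborel) > 0"
proof -
  have nn: "0 \<le> indicator A x * f x" for x using f[of x] by simp
  have "(\<integral>x. indicator A x * f x \<partial>lborel) \<noteq> 0"
  proof
    assume "(\<integral>x. indicator A x * f x \<partial>lborel) = 0"
    then have "AE x in lborel. indicator A x * f x = 0"
      by (subst (asm) integral_nonneg_eq_0_iff_AE[OF i]) (simp_all only: nn AE_I2)
    then have "AE x in lborel. x \<notin> A"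
    proof eventually_elim
      fix x assume "indicator A x * f x = 0"
      then show "x \<notin> A" using f[of x] by (auto simp: indicator_def split: if_splits)
    qed
    then have "emeasure lborel A = 0" using A(1) by (subst (asm) AE_iff_measurable[of A]) auto
    then show False using A(2) by simp
  qed
  moreover have "(\<integral>x. indicator A x * f x \<partial>lborel) \<ge> 0"
    by (intro Bochner_Integration.integral_nonneg nn)
  ultimately show ?thesis by simp
qed

lemma borel_measurable_mu_dens:
  assumes "DIM('a::euclidean_space) \<ge> 2" shows "(mu_dens :: 'a \<Rightarrow> real) \<in> borel_measurable borel"
  using integrable_mu_dens[OF assms] by auto

lemma integral_mu:
  fixes f :: "'a::euclidean_space \<Rightarrow> real"
  assumes "DIM('a) \<ge> 2" and [measurable]: "f \<in> borel_measurable borel"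
  shows "(\<integral>x. f x \<partial>mu) = (\<integral>x. f x * mu_dens x \<partial>lborel)" "integrable mu f \<longleftrightarrow> integrable lborel (\<lambda>x. f x * mu_dens x)"
proof -
  note [measurable] = borel_measurable_mu_dens[OF assms(1)]
  have p: "0 \<le> mu_dens x" for x :: 'a using mu_dens_pos[of x] by simp
  show "(\<integral>x. f x \<partial>mu) = (\<integral>x. f x * mu_dens x \<partial>lborel)"
    unfolding mu_def by (subst integral_density) (auto simp: p mult.commute)
  show "integrable mu f \<longleftrightarrow> integrable lborel (\<lambda>x. f x * mu_dens x)"
    unfolding mu_def by (subst integrable_density) (auto simp: p mult.commute)
qed

lemma integrable_bounded_mu:
  fixes f :: "'a::euclidean_space \<Rightarrow> real"
  assumes dim: "DIM('a) \<ge> 2" and [measurable]: "f \<in> borel_measurable borel" and M: "\<And>x. \<bar>f x\<bar> \<le> M"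
  shows "integrable lborel (\<lambda>x. f x * mu_dens x)"
proof (rule Bochner_Integration.integrable_bound)
  note [measurable] = borel_measurable_mu_dens[OF dim]
  show "integrable lborel (\<lambda>x::'a. M * mu_dens x)" by (intro integrable_mult_right integrable_mu_dens dim)
  show "AE x in lborel. norm (f x * mu_dens x) \<le> norm (M * mu_dens x)"
    using M order_trans[OF M abs_ge_self] by (intro AE_I2) (auto simp: abs_mult intro!: mult_right_mono)
  show "(\<lambda>x. f x * mu_dens x) \<in> borel_measurable lborel" by measurable
qed

text \<open>N times \<open>liouville_field x\<close> is the gradient of the convex function |z|^N at
  z = grad v x, so this is its Bregman distance. With the second vector as an argument, H can be
  evaluated with any representative of the weak gradient.\<close>

definition bregman :: "'a::euclidean_space \<Rightarrow> 'a \<Rightarrow> real" where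
  "bregman x z = norm (grad v x + z) ^ DIM('a) - norm (grad v x) ^ DIM('a) - real DIM('a) * (liouville_field x \<bullet> z)"

lemma H_eq_bregman: "H u x = bregman x (weak_grad UNIV u x)"
  by (simp add: H_def bregman_def liouville_field_def)

text \<open>Off the ball Z and the integrand vanish. On it the integrand is |W|^N - |grad v|^N - N X
  . Z, where W is the gradient of f plus the truncated v; the integral of the last term cancels the
  mean of f.\<close>

lemma energy_identity:
  fixes f :: "'a::euclidean_space \<Rightarrow> real"
  assumes dim: "DIM('a) \<ge> 2" and R: "R > 0" and bp: "by_parts f Z"
    and [measurable]: "f \<in> borel_measurable borel" "Z \<in> borel_measurable borel"
    and f: "\<And>x. \<bar>f x\<bar> \<le> M"
    and Z: "\<And>x. norm x > R \<Longrightarrow> Z x = 0" "integrable lborel (\<lambda>x. norm (Z x) ^ DIM('a))"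
  defines "W \<equiv> \<lambda>x. Z x + indicator (cball 0 R) x *\<^sub>R grad v x"
  shows "integrable lborel (\<lambda>x. norm (W x) ^ DIM('a))"
    "1 / omega_tilde TYPE('a) * (\<integral>x. bregman x (Z x) \<partial>lborel) + (\<integral>x. f x * mu_dens x \<partial>lborel)
      = 1 / omega_tilde TYPE('a) * (\<integral>x. norm (W x) ^ DIM('a) \<partial>lborel) - energy_value TYPE('a) R"
proof -
  let ?N = "DIM('a)" and ?om = "omega_tilde TYPE('a)"
  let ?g = "\<lambda>x::'a. indicator (cball 0 R) x * norm (grad v x) ^ ?N"
  have om: "?om > 0" by (rule omega_tilde_pos[OF dim])
  have [measurable]: "grad v \<in> borel_measurable (borel :: 'a measure)"
    using continuous_grad_v[OF dim] by (rule borel_measurable_continuous_onI)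
  have ig: "integrable lborel ?g" by (rule energy_grad_v(1)[OF dim R])
  show iW: "integrable lborel (\<lambda>x. norm (W x) ^ ?N)"
  proof (rule Bochner_Integration.integrable_bound)
    show "integrable lborel (\<lambda>x. 2 ^ ?N * (norm (Z x) ^ ?N + ?g x))"
      by (intro integrable_mult_right Bochner_Integration.integrable_add Z ig)
    show "(\<lambda>x. norm (W x) ^ ?N) \<in> borel_measurable lborel" unfolding W_def by measurable
    show "AE x in lborel. norm (norm (W x) ^ ?N) \<le> norm (2 ^ ?N * (norm (Z x) ^ ?N + ?g x))"
    proof (intro AE_I2)
      fix x
      have "norm (W x) ^ ?N \<le> (norm (Z x) + norm (indicator (cball 0 R) x *\<^sub>R grad v x)) ^ ?N"
        unfolding W_def by (intro power_mono norm_triangle_ineq) auto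
      also have "\<dots> \<le> 2 ^ ?N * (norm (Z x) ^ ?N + norm (indicator (cball 0 R) x *\<^sub>R grad v x) ^ ?N)"
        by (rule power_add_le) auto
      also have "norm (indicator (cball 0 R) x *\<^sub>R grad v x) ^ ?N = ?g x" by (auto simp: indicator_def)
      finally show "norm (norm (W x) ^ ?N) \<le> norm (2 ^ ?N * (norm (Z x) ^ ?N + ?g x))" by simp
    qed
  qed
  have ifm: "integrable lborel (\<lambda>x. f x * mu_dens x)" by (rule integrable_bounded_mu[OF dim _ f]) measurable
  note X = liouville_by_parts[OF dim bp ifm]
  have eq: "bregman x (Z x) = norm (W x) ^ ?N - ?g x - real ?N * (liouville_field x \<bullet> Z x)" for x
    using Z(1)[of x] by (cases "norm x \<le> R") (auto simp: bregman_def W_def add.commute)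
  have "(\<integral>x. bregman x (Z x) \<partial>lborel)
     = (\<integral>x. norm (W x) ^ ?N \<partial>lborel) - (\<integral>x. ?g x \<partial>lborel) - real ?N * (\<integral>x. liouville_field x \<bullet> Z x \<partial>lborel)"
    unfolding eq using iW ig X(1) by simp
  then have "1 / ?om * (\<integral>x. bregman x (Z x) \<partial>lborel) = 1 / ?om * (\<integral>x. norm (W x) ^ ?N \<partial>lborel) - 1 / ?om * (\<integral>x. ?g x \<partial>lborel)
      - 1 / ?om * (?om * (\<integral>x. f x * mu_dens x \<partial>lborel))"
    unfolding X(2) by (simp only: right_diff_distrib)
  then show "1 / ?om * (\<integral>x. bregman x (Z x) \<partial>lborel) + (\<integral>x. f x * mu_dens x \<partial>lborel)
      = 1 / ?om * (\<integral>x. norm (W x) ^ ?N \<partial>lborel) - energy_value TYPE('a) R"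
    unfolding energy_grad_v(2)[OF dim R] using om by simp
qed

text \<open>On the ball, exp f times the density is exp (v + f), and v is its boundary value plus
  \<open>plateau R\<close>. Outside, f vanishes and the tail of mu remains.\<close>

lemma exp_identity:
  fixes f :: "'a::euclidean_space \<Rightarrow> real"
  assumes dim: "DIM('a) \<ge> 2" and R: "R > 0"
    and [measurable]: "f \<in> borel_measurable borel"
    and f: "\<And>x. \<bar>f x\<bar> \<le> M" "\<And>x. norm x > R \<Longrightarrow> f x = 0"
  shows "(\<integral>x. exp (f x) * mu_dens x \<partial>lborel)
      = exp (v_at TYPE('a) R) * (\<integral>x. indicator (cball 0 R) x * exp (plateau R x + f x) \<partial>lborel)
        + (\<integral>x. indicator (- cball 0 R) x * mu_dens (x::'a) \<partial>lborel)"
proof -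
  note [measurable] = borel_measurable_mu_dens[OF dim]
  have i: "integrable lborel (\<lambda>x. exp (f x) * mu_dens x)"
    by (rule integrable_bounded_mu[OF dim, of _ "exp M"]) (use f(1) in \<open>auto intro: abs_le_D1\<close>)
  have eq: "indicator (cball 0 R) x * (exp (f x) * mu_dens x) = exp (v_at TYPE('a) R) * (indicator (cball 0 R) x * exp (plateau R x + f x))" for x
  proof (cases "norm x \<le> R")
    case True
    have "exp (v_at TYPE('a) R) * exp (plateau R x + f x) = exp (v x) * exp (f x)"
      using plateau_simps(1)[OF dim less_imp_le[OF R] True] by (simp add: exp_add[symmetric])
    then show ?thesis using True by (simp add: exp_v mult.commute)
  qed simp
  have i1: "integrable lborel (\<lambda>x. indicator (cball 0 R) x * (exp (f x) * mu_dens x))"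
    using integrable_mult_indicator[OF _ i, of "cball 0 R"] by simp
  have i2: "integrable lborel (\<lambda>x::'a. indicator (- cball 0 R) x * mu_dens x)"
    using integrable_mult_indicator[OF _ integrable_mu_dens[OF dim], of "- cball 0 R"] by simp
  have "exp (f x) * mu_dens x = indicator (cball 0 R) x * (exp (f x) * mu_dens x) + indicator (- cball 0 R) x * mu_dens x" for x
    using f(2)[of x] by (auto simp: indicator_def)
  then have "(\<integral>x. exp (f x) * mu_dens x \<partial>lborel)
     = (\<integral>x. indicator (cball 0 R) x * (exp (f x) * mu_dens x) + indicator (- cball 0 R) x * mu_dens x \<partial>lborel)"
    by (rule arg_cong[OF ext])
  also have "\<dots> = (\<integral>x. indicator (cball 0 R) x * (exp (f x) * mu_dens x) \<partial>lborel) + (\<integral>x. indicator (- cball 0 R) x * mu_dens (x::'a) \<partial>lborel)"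
    using i1 i2 by simp
  finally show ?thesis unfolding eq by simp
qed

text \<open>What rescaling to the unit ball costs: \<open>I(f) = J(z) + gap R\<close> up to the logarithm of the ratio of
  exponential integrals.\<close>
definition gap :: "'a::euclidean_space itself \<Rightarrow> real \<Rightarrow> real" where
  "gap T R = - energy_value T R - v_at T R - real DIM('a) * ln R - ln (ball_volume T)"

text \<open>As (N - 1) q = N, the term (N - 1) ln (R^q) equals N ln R. The divergent parts cancel
  and (N - 1) ln (1 + 1/R^q) is left beside the finite sum.\<close>

lemma gap_tendsto:
  assumes dim: "DIM('a::euclidean_space) \<ge> 2"
  shows "(\<lambda>n. gap TYPE('a) (real (Suc n))) \<longlonglongrightarrow> (\<Sum>k = 1..DIM('a) - 1. 1 / real k)"
proof -
  let ?N = "DIM('a)" and ?q = "conj_exp TYPE('a)"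
  let ?S = "\<lambda>n. real (Suc n) powr ?q"
  have q: "?q > 0" using conj_exp(1)[OF dim] by simp
  have lim0: "(\<lambda>n. 1 / ?S n) \<longlonglongrightarrow> 0"
  proof -
    have "(\<lambda>n. real (Suc n) powr (- ?q)) \<longlonglongrightarrow> 0"
      using q by (intro tendsto_neg_powr filterlim_compose[OF filterlim_real_sequentially filterlim_Suc]) auto
    then show ?thesis by (simp add: powr_minus inverse_eq_divide)
  qed
  have eq: "gap TYPE('a) (real (Suc n)) = (real ?N - 1) * ln (1 + 1 / ?S n) + (\<Sum>k = 1..?N - 1. (1 / (1 + 1 / ?S n)) ^ k / real k)" for n
  proof -
    have S: "?S n > 0" by simp
    have a: "ln (1 + ?S n) = ln (?S n) + ln (1 + 1 / ?S n)"
    proof -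
      have "1 + ?S n = ?S n * (1 + 1 / ?S n)" using S by (simp add: field_simps)
      moreover have "1 + 1 / ?S n > 0" using S by (intro add_pos_pos divide_pos_pos) auto
      ultimately show ?thesis using S by (simp only: ln_mult_pos)
    qed
    have b: "(real ?N - 1) * ln (?S n) = real ?N * ln (real (Suc n))"
      using conj_exp(2)[OF dim] by (simp add: ln_powr mult.assoc[symmetric] del: of_nat_Suc)
    have c: "?S n / (1 + ?S n) = 1 / (1 + 1 / ?S n)" using S by (simp add: field_simps)
    have "gap TYPE('a) (real (Suc n)) = (real ?N - 1) * ln (1 + ?S n) - real ?N * ln (real (Suc n)) + (\<Sum>k = 1..?N - 1. (?S n / (1 + ?S n)) ^ k / real k)"
      unfolding gap_def energy_value_def v_at_def by (simp add: algebra_simps del: of_nat_Suc)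
    also have "(real ?N - 1) * ln (1 + ?S n) - real ?N * ln (real (Suc n)) = (real ?N - 1) * ln (1 + 1 / ?S n)"
      unfolding a b[symmetric] by (simp only: distrib_left add_diff_cancel_left')
    finally show ?thesis unfolding c .
  qed
  have "(\<lambda>n. (real ?N - 1) * ln (1 + 1 / ?S n) + (\<Sum>k = 1..?N - 1. (1 / (1 + 1 / ?S n)) ^ k / real k))
     \<longlonglongrightarrow> (real ?N - 1) * ln (1 + 0) + (\<Sum>k = 1..?N - 1. (1 / (1 + 0)) ^ k / real k)"
    by (intro tendsto_intros lim0) auto
  then show ?thesis unfolding eq by simp
qed

text \<open>For large R the function f + \<open>plateau R\<close> is admissible on the ball of
  radius R. Its bound becomes a bound for f in which \<open>Q\<close> is diminished by the tail of
  mu outside the ball; as R grows with f fixed, the tail disappears.\<close>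

lemma lower_bound_compact_support:
  fixes f :: "'a::euclidean_space \<Rightarrow> real"
  assumes dim: "DIM('a) \<ge> 2" and bp: "by_parts f Z"
    and m: "\<And>\<phi>. \<phi> \<in> test_functions (ball 0 1) \<Longrightarrow> m \<le> J_fun (\<phi> :: 'a \<Rightarrow> real)"
    and fm [measurable]: "f \<in> borel_measurable borel" and Zm [measurable]: "Z \<in> borel_measurable borel"
    and Zl: "locally_integrable_on Z UNIV"
    and f: "\<And>x. \<bar>f x\<bar> \<le> M" "\<And>x. norm x > K \<Longrightarrow> f x = 0"
    and Z: "\<And>x. norm x > K \<Longrightarrow> Z x = 0" "integrable lborel (\<lambda>x. norm (Z x) ^ DIM('a))"
  shows "m + (\<Sum>k = 1..DIM('a) - 1. 1 / real k) \<le> 1 / omega_tilde TYPE('a) * (\<integral>x. bregman x (Z x) \<partial>lborel)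
    + (\<integral>x. f x * mu_dens x \<partial>lborel) - ln (\<integral>x. exp (f x) * mu_dens x \<partial>lborel)"
proof -
  let ?N = "DIM('a)" and ?om = "omega_tilde TYPE('a)" and ?V = "ball_volume TYPE('a)"
  note mum [measurable] = borel_measurable_mu_dens[OF dim]
  have V: "?V > 0" by (rule ball_volume_pos)
  define Q where "Q = (\<integral>x. exp (f x) * mu_dens x \<partial>lborel)"
  define E where "E = 1 / ?om * (\<integral>x. bregman x (Z x) \<partial>lborel) + (\<integral>x. f x * mu_dens x \<partial>lborel)"
  define \<epsilon> where "\<epsilon> n = (\<integral>x. indicator (- cball 0 (real (Suc n))) x * mu_dens (x::'a) \<partial>lborel)" for n
  have iexp: "integrable lborel (\<lambda>x. exp (f x) * mu_dens x)"
    by (rule integrable_bounded_mu[OF dim, of _ "exp M"]) (use f(1) in \<open>auto intro: abs_le_D1\<close>)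
  have Q: "Q > 0"
    using integral_pos_lborel[of UNIV "\<lambda>x. exp (f x) * mu_dens x"] iexp by (simp add: Q_def mu_dens_pos)
  have \<epsilon>lim: "\<epsilon> \<longlonglongrightarrow> 0"
  proof -
    have "(\<lambda>n. \<integral>x. indicator (- cball 0 (real (Suc n))) x * mu_dens (x::'a) \<partial>lborel) \<longlonglongrightarrow> (\<integral>x. 0 \<partial>(lborel :: 'a measure))"
    proof (rule integral_dominated_convergence[OF _ _ integrable_mu_dens[OF dim]])
      show "AE x in lborel. (\<lambda>n. indicator (- cball 0 (real (Suc n))) x * mu_dens (x::'a)) \<longlonglongrightarrow> 0"
      proof (intro AE_I2 tendsto_eventually)
        fix x :: 'a
        show "eventually (\<lambda>n. indicator (- cball 0 (real (Suc n))) x * mu_dens x = 0) sequentially"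
          using eventually_norm_le[of x] by eventually_elim auto
      qed
      show "AE x in lborel. norm (indicator (- cball 0 (real (Suc n))) x * mu_dens (x::'a)) \<le> mu_dens x" for n
        using mu_dens_pos by (intro AE_I2) (auto simp: indicator_def abs_of_pos intro: less_imp_le)
    qed measurable
    then show ?thesis by (simp add: \<epsilon>_def[abs_def])
  qed
  have lf: "locally_integrable_on f UNIV"
    by (rule locally_integrable_bounded) (use f(1) in auto)
  have ev: "eventually (\<lambda>n. m \<le> E - gap TYPE('a) (real (Suc n)) - ln (Q - \<epsilon> n)) sequentially"
  proof -
    \<comment> \<open>Two demands on R: the diminished integral must stay positive under the
      logarithm, and the ball must contain the support of f.\<close>
    have "eventually (\<lambda>n. \<epsilon> n < Q) sequentially" by (rule order_tendstoD(2)[OF \<epsilon>lim Q])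
    moreover have "eventually (\<lambda>n. K \<le> real n) sequentially"
      using eventually_ge_at_top[of "nat \<lceil>K\<rceil>"] by eventually_elim (auto simp: nat_le_iff ceiling_le_iff)
    ultimately show ?thesis
    proof eventually_elim
      fix n assume \<epsilon>Q: "\<epsilon> n < Q" and "K \<le> real n"
      define R where "R = real (Suc n)"
      have R: "R > 0" "K \<le> R" using \<open>K \<le> real n\<close> by (auto simp: R_def)
      have fR: "f x = 0" "Z x = 0" if "norm x > R" for x using that f(2) Z(1) R(2) by auto
      let ?W = "\<lambda>x. Z x + indicator (cball 0 R) x *\<^sub>R grad v x"
      let ?z = "\<lambda>x. f x + plateau R x"
      let ?B = "\<integral>x. indicator (cball 0 R) x * exp (?z x) \<partial>lborel"
      note en = energy_identity[OF dim R(1) bp fm Zm f(1) fR(2) Z(2), folded E_def]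
      have gm [measurable]: "grad v \<in> borel_measurable (borel :: 'a measure)"
        using continuous_grad_v[OF dim] by (rule borel_measurable_continuous_onI)
      note pl = plateau_lipschitz[OF dim less_imp_le[OF R(1)]]
      have pc: "continuous_on UNIV (plateau R :: 'a \<Rightarrow> real)" by (rule lipschitz_on_balls_continuous[OF pl(1)])
      have p0: "plateau R x = 0" if "norm x > R" for x :: 'a
        using that plateau_simps(2)[OF dim less_imp_le[OF R(1)], of x] by simp
      have Wm: "(\<lambda>x::'a. indicator (cball 0 R) x *\<^sub>R grad v x) \<in> borel_measurable borel" by measurable
      have bpz: "by_parts ?z ?W" by (intro by_parts_add bp lipschitz_by_parts[OF pl(1) p0 pl(2) Wm])
      obtain B0 where B0: "\<And>x::'a. norm (plateau R x) \<le> B0" using continuous_bounded_support[OF pc p0] by blast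
      have zb: "norm (?z x) \<le> M + B0" for x
        using f(1)[of x] B0[of x] norm_triangle_ineq[of "f x" "plateau R x"] by simp
      have [measurable]: "(plateau R :: 'a \<Rightarrow> real) \<in> borel_measurable borel" using pc by (rule borel_measurable_continuous_onI)
      have lz: "locally_integrable_on ?z UNIV"
        by (rule locally_integrable_bounded) (use zb in \<open>auto simp del: real_norm_def\<close>)
      have lW: "locally_integrable_on ?W UNIV"
        unfolding locally_integrable_on_def
      proof (intro allI impI, elim conjE)
        fix C :: "'a set" assume C: "compact C"
        have "locally_integrable_on (grad v :: 'a \<Rightarrow> 'a) UNIV"
          by (rule continuous_imp_locally_integrable[OF continuous_grad_v[OF dim]])
        then have gC: "integrable lborel (\<lambda>x. indicator C x *\<^sub>R grad v (x::'a))"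
          by (rule locally_integrable_indicator[OF _ C]) simp
        have "integrable lborel (\<lambda>x::'a. indicator (cball 0 R) x *\<^sub>R indicator C x *\<^sub>R grad v x)"
          using integrable_mult_indicator[OF _ gC, of "cball 0 R"] by simp
        moreover have "integrable lborel (\<lambda>x. indicator C x *\<^sub>R Z x)"
          by (rule locally_integrable_indicator[OF Zl C]) simp
        ultimately have "integrable lborel (\<lambda>x. indicator C x *\<^sub>R Z x + indicator (cball 0 R) x *\<^sub>R indicator C x *\<^sub>R grad v x)"
          by (intro Bochner_Integration.integrable_add)
        then show "set_integrable lborel C ?W"
          unfolding set_integrable_def by (simp add: scaleR_add_right mult.commute)
      qed
      have wg: "has_weak_grad UNIV ?z ?W" by (rule by_parts_has_weak_grad[OF bpz lz lW])
      have z0: "?z x = 0" if "norm x > R" for x using fR(1)[OF that] p0[OF that] by simp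
      have "m \<le> 1 / ?om * (\<integral>x. norm (?W x) ^ ?N \<partial>lborel) - ln (1 / (?V * R ^ ?N) * ?B)"
        by (rule J_bound_extends[OF dim m wg zb z0 R(1) en(1)])
      moreover have "1 / ?om * (\<integral>x. norm (?W x) ^ ?N \<partial>lborel) = E + energy_value TYPE('a) R" using en(2) by simp
      moreover have "ln (1 / (?V * R ^ ?N) * ?B) = ln (Q - \<epsilon> n) - v_at TYPE('a) R - ln ?V - real ?N * ln R"
      proof -
        have "Q = exp (v_at TYPE('a) R) * ?B + \<epsilon> n"
          using exp_identity[OF dim R(1) fm f(1) fR(1)] by (simp add: Q_def \<epsilon>_def R_def add.commute)
        then have "?B = (Q - \<epsilon> n) / exp (v_at TYPE('a) R)" by simp
        then have "1 / (?V * R ^ ?N) * ?B = (Q - \<epsilon> n) / (exp (v_at TYPE('a) R) * (?V * R ^ ?N))" by simp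
        then show ?thesis
          using \<epsilon>Q V R(1) by (simp add: ln_div ln_mult ln_realpow)
      qed
      ultimately show "m \<le> E - gap TYPE('a) (real (Suc n)) - ln (Q - \<epsilon> n)"
        unfolding gap_def R_def[symmetric] by linarith
    qed
  qed
  have "(\<lambda>n. E - gap TYPE('a) (real (Suc n)) - ln (Q - \<epsilon> n)) \<longlonglongrightarrow> E - (\<Sum>k = 1..?N - 1. 1 / real k) - ln (Q - 0)"
    using Q by (intro tendsto_intros gap_tendsto[OF dim] \<epsilon>lim) auto
  from tendsto_lowerbound[OF this ev] have "m \<le> E - (\<Sum>k = 1..?N - 1. 1 / real k) - ln Q" by simp
  then show ?thesis by (simp add: E_def Q_def)
qed

lemma liouville_field_borel:
  assumes dim: "DIM('a::euclidean_space) \<ge> 2"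
  shows "(liouville_field :: 'a \<Rightarrow> 'a) \<in> borel_measurable borel" "(grad v :: 'a \<Rightarrow> 'a) \<in> borel_measurable borel"
proof -
  show [measurable]: "(grad v :: 'a \<Rightarrow> 'a) \<in> borel_measurable borel"
    using continuous_grad_v[OF dim] by (rule borel_measurable_continuous_onI)
  show "(liouville_field :: 'a \<Rightarrow> 'a) \<in> borel_measurable borel"
    unfolding liouville_field_def[abs_def] by measurable
qed

lemma bregman_borel:
  fixes Z :: "'a::euclidean_space \<Rightarrow> 'a"
  assumes dim: "DIM('a::euclidean_space) \<ge> 2" and [measurable]: "Z \<in> borel_measurable borel"
  shows "(\<lambda>x. bregman x (Z x)) \<in> borel_measurable borel"
proof -
  note [measurable] = liouville_field_borel[OF dim]
  show ?thesis unfolding bregman_def by measurable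
qed

lemma weak_grad_UNIV_borel: "weakly_differentiable UNIV u \<Longrightarrow> weak_grad UNIV u \<in> borel_measurable borel"
  using has_weak_gradD(2)[OF has_weak_grad_weak_grad] locally_integrable_borel by blast

lemma grad_test_eq_0:
  assumes "\<phi> \<in> test_functions (ball 0 1)" "\<not> norm x < 1"
  shows "\<phi> x = 0" "grad \<phi> x = 0"
proof -
  obtain K where "K \<subseteq> ball 0 1" "\<And>x. x \<notin> K \<Longrightarrow> \<phi> x = 0" "\<And>x. x \<notin> K \<Longrightarrow> grad \<phi> x = 0"
    using test_functionsE[OF assms(1)] by metis
  moreover have "x \<notin> K" using \<open>K \<subseteq> ball 0 1\<close> assms(2) by auto
  ultimately show "\<phi> x = 0" "grad \<phi> x = 0" by blast+
qed

lemma J_fun_test: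
  fixes \<phi> :: "'a::euclidean_space \<Rightarrow> real"
  assumes \<phi>: "\<phi> \<in> test_functions (ball 0 1)"
  shows "J_fun \<phi> = 1 / omega_tilde TYPE('a) * (\<integral>x. norm (grad \<phi> x) ^ DIM('a) \<partial>lborel)
     - ln (1 / ball_volume TYPE('a) * (\<integral>x. indicator (ball 0 1) x * exp (\<phi> x) \<partial>lborel))"
proof -
  have "norm (indicator (ball 0 1) x *\<^sub>R grad \<phi> x) ^ DIM('a) = norm (grad \<phi> x) ^ DIM('a)" for x
    using grad_test_eq_0(2)[OF \<phi>, of x] by (auto simp: indicator_def)
  then show ?thesis using J_fun_eq[OF test_functions_has_weak_grad[OF \<phi>, of "ball 0 1"]] by simp
qed

text \<open>The competitor inverts the substitution: it is the dilated test function minus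
  \<open>plateau R\<close>, so that v + f is a constant plus the dilated \<open>\<phi>\<close> on
  the ball, and the field W of the energy identity is the gradient of the dilated
  \<open>\<phi>\<close> alone.\<close>

lemma upper_bound_test:
  fixes \<phi> :: "'a::euclidean_space \<Rightarrow> real"
  assumes dim: "DIM('a) \<ge> 2" and \<phi>: "\<phi> \<in> test_functions (ball 0 1)" and R: "R > 0"
  shows "\<exists>u\<in>W_mu. I_fun (u :: 'a \<Rightarrow> real) \<le> J_fun \<phi> + gap TYPE('a) R"
proof -
  let ?N = "DIM('a)" and ?om = "omega_tilde TYPE('a)" and ?V = "ball_volume TYPE('a)"
  have V: "?V > 0" by (rule ball_volume_pos)
  note [measurable] = borel_measurable_mu_dens[OF dim] liouville_field_borel[OF dim]
  have c: "continuous_on UNIV \<phi>" "continuous_on UNIV (grad \<phi>)" using test_functionsE[OF \<phi>] by metis+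
  define \<psi> where "\<psi> x = \<phi> ((1 / R) *\<^sub>R x)" for x
  define G where "G x = (1 / R) *\<^sub>R grad \<phi> ((1 / R) *\<^sub>R x)" for x
  have G: "GDERIV \<psi> x :> G x" for x
    using GDERIV_affine[of \<phi> 0 "1 / R" x] test_functions_GDERIV[OF \<phi>] by (simp add: \<psi>_def[abs_def] G_def)
  have cG: "continuous_on UNIV G"
    unfolding G_def[abs_def] by (intro continuous_intros continuous_on_compose2[OF c(2)]) auto
  have \<psi>0: "\<psi> x = 0" "G x = 0" if "norm x > R" for x
    using that R grad_test_eq_0[OF \<phi>, of "(1 / R) *\<^sub>R x"] by (auto simp: \<psi>_def G_def divide_simps)
  have l\<psi>: "lipschitz_on_balls \<psi>" by (rule C1_lipschitz_on_balls[OF G cG])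
  note pl = plateau_lipschitz[OF dim less_imp_le[OF R]]
  have p0: "plateau R x = 0" if "norm x > R" for x :: 'a
    using that plateau_simps(2)[OF dim less_imp_le[OF R], of x] by simp
  define f where "f x = \<psi> x - plateau R x" for x
  define Z where "Z x = G x - indicator (cball 0 R) x *\<^sub>R grad v x" for x
  have lf: "lipschitz_on_balls f" unfolding f_def[abs_def] by (rule lipschitz_on_balls_diff[OF l\<psi> pl(1)])
  have f0: "f x = 0" "Z x = 0" if "norm x > R" for x using \<psi>0[OF that] p0[OF that] that by (auto simp: f_def Z_def)
  have GZ: "AE x in lborel. GDERIV f x :> Z x"
    using pl(2) unfolding f_def[abs_def] Z_def by eventually_elim (intro GDERIV_diff G)
  have cf: "continuous_on UNIV f" by (rule lipschitz_on_balls_continuous[OF lf])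
  have [measurable]: "f \<in> borel_measurable borel" "G \<in> borel_measurable borel"
    using cf cG by (auto intro: borel_measurable_continuous_onI)
  have Zm [measurable]: "Z \<in> borel_measurable borel" unfolding Z_def[abs_def] by measurable
  obtain M where M: "\<And>x. \<bar>f x\<bar> \<le> M" using continuous_bounded_support[OF cf f0(1)] by (metis real_norm_def)
  obtain B where B: "AE x in lborel. norm x \<le> R \<longrightarrow> norm (Z x) \<le> B"
    using lipschitz_on_balls_gradient_bounded[OF lf GZ] by blast
  obtain B2 where B2: "\<And>x::'a. norm x \<le> R \<Longrightarrow> norm (grad v x) \<le> B2"
  proof -
    have "compact (grad v ` cball (0::'a) R)"
      by (intro compact_continuous_image continuous_on_subset[OF continuous_grad_v[OF dim]]) auto
    then obtain b where "\<And>y. y \<in> grad v ` cball (0::'a) R \<Longrightarrow> norm y \<le> b"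
      using compact_imp_bounded bounded_iff by metis
    then show ?thesis by (intro that[of b]) auto
  qed
  have iZ: "integrable lborel (\<lambda>x. norm (Z x) ^ ?N)"
  proof (rule integrable_bounded_cball[where r = R])
    show "AE x in lborel. norm (norm (Z x) ^ ?N) \<le> (max B 0) ^ ?N"
      using B
    proof eventually_elim
      fix x assume "norm x \<le> R \<longrightarrow> norm (Z x) \<le> B"
      then have "norm (Z x) \<le> max B 0" using f0(2)[of x] by (cases "norm x \<le> R") auto
      then have "norm (Z x) ^ ?N \<le> (max B 0) ^ ?N" by (intro power_mono) auto
      then show "norm (norm (Z x) ^ ?N) \<le> (max B 0) ^ ?N" by simp
    qed
  qed (use f0(2) in auto)
  have iZ2: "integrable lborel (\<lambda>x. (norm (Z x))\<^sup>2 * norm (grad v x) ^ (?N - 2))"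
  proof (rule integrable_bounded_cball[where r = R])
    show "AE x in lborel. norm ((norm (Z x))\<^sup>2 * norm (grad v x) ^ (?N - 2)) \<le> (max B 0)\<^sup>2 * (max B2 0) ^ (?N - 2)"
      using B
    proof eventually_elim
      fix x assume b: "norm x \<le> R \<longrightarrow> norm (Z x) \<le> B"
      show "norm ((norm (Z x))\<^sup>2 * norm (grad v x) ^ (?N - 2)) \<le> (max B 0)\<^sup>2 * (max B2 0) ^ (?N - 2)"
      proof (cases "norm x \<le> R")
        case True
        then have "norm (Z x) \<le> max B 0" "norm (grad v x) \<le> max B2 0" using b B2[of x] by auto
        then have "(norm (Z x))\<^sup>2 * norm (grad v x) ^ (?N - 2) \<le> (max B 0)\<^sup>2 * (max B2 0) ^ (?N - 2)"
          by (intro mult_mono power_mono) auto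
        then show ?thesis by simp
      qed (use f0(2)[of x] in simp)
    qed
  qed (use f0(2) in auto)
  have Wf: "has_weak_grad UNIV f Z" by (rule lipschitz_has_weak_grad[OF lf GZ Zm])
  then have wd: "weakly_differentiable UNIV f" unfolding weakly_differentiable_def by blast
  have ae: "AE x in lborel. weak_grad UNIV f x = Z x" using weak_grad_eq_AE[OF Wf open_UNIV] by simp
  have [measurable]: "weak_grad UNIV f \<in> borel_measurable borel" by (rule weak_grad_UNIV_borel[OF wd])
  have ifm: "integrable lborel (\<lambda>x. f x * mu_dens x)" by (rule integrable_bounded_mu[OF dim _ M]) measurable
  have fW: "f \<in> W_mu"
    unfolding W_mu_def
  proof (intro CollectI conjI wd)
    show "integrable mu f" using ifm integral_mu(2)[OF dim, of f] by simp
    show "integrable lborel (\<lambda>x. norm (weak_grad UNIV f x) ^ ?N)"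
      by (rule integrable_cong_AE[THEN iffD1, OF _ _ _ iZ]) (use ae in auto)
    show "integrable lborel (\<lambda>x. (norm (weak_grad UNIV f x))\<^sup>2 * norm (grad v x) ^ (?N - 2))"
      by (rule integrable_cong_AE[THEN iffD1, OF _ _ _ iZ2]) (use ae in auto)
  qed
  have fm: "f \<in> borel_measurable borel" by measurable
  have "(\<integral>x. H f x \<partial>lborel) = (\<integral>x. bregman x (Z x) \<partial>lborel)"
    unfolding H_eq_bregman
  proof (rule integral_cong_AE)
    show "(\<lambda>x. bregman x (weak_grad UNIV f x)) \<in> borel_measurable lborel" "(\<lambda>x. bregman x (Z x)) \<in> borel_measurable lborel"
      using bregman_borel[OF dim] by auto
    show "AE x in lborel. bregman x (weak_grad UNIV f x) = bregman x (Z x)" using ae by eventually_elim simp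
  qed
  define Q where "Q = (\<integral>x. exp (f x) * mu_dens x \<partial>lborel)"
  have "by_parts f Z" by (rule lipschitz_by_parts[OF lf f0(1) GZ Zm])
  note en = energy_identity[OF dim R this fm Zm M f0(2) iZ]
  have eqW: "Z x + indicator (cball 0 R) x *\<^sub>R grad v x = G x" for x by (simp add: Z_def)
  have en2: "1 / ?om * (\<integral>x. bregman x (Z x) \<partial>lborel) + (\<integral>x. f x * mu_dens x \<partial>lborel)
      = 1 / ?om * (\<integral>x. norm (G x) ^ ?N \<partial>lborel) - energy_value TYPE('a) R"
    using en(2) unfolding eqW .
  have [measurable]: "\<phi> \<in> borel_measurable borel" "grad \<phi> \<in> borel_measurable borel"
    using c by (auto intro: borel_measurable_continuous_onI)
  have "(\<integral>x. norm (G x) ^ ?N \<partial>lborel) = (1 / R) ^ ?N * (\<integral>x. norm (grad \<phi> (0 + (1 / R) *\<^sub>R x)) ^ ?N \<partial>lborel)"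
    using R by (simp add: G_def power_divide)
  also have "\<dots> = (\<integral>x. norm (grad \<phi> x) ^ ?N \<partial>lborel)"
    using integral_lborel_affine[of "\<lambda>x. norm (grad \<phi> x) ^ ?N" "1 / R" 0] R by simp
  finally have GN: "(\<integral>x. norm (G x) ^ ?N \<partial>lborel) = (\<integral>x. norm (grad \<phi> x) ^ ?N \<partial>lborel)" .
  define b where "b = (\<integral>x. indicator (ball 0 1) x * exp (\<phi> x) \<partial>lborel)"
  have \<phi>0: "\<phi> x = 0" if "norm x > 1" for x using grad_test_eq_0(1)[OF \<phi>, of x] that by simp
  obtain M' where M': "\<And>x. norm (\<phi> x) \<le> M'"
    using continuous_bounded_support[OF c(1) \<phi>0] by blast
  have b: "b > 0"
    unfolding b_def
  proof (rule integral_pos_lborel)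
    show "integrable lborel (\<lambda>x. indicator (ball 0 1) x * exp (\<phi> x))"
      by (rule integrable_bounded_cball[where r = 1 and B = "exp M'"])
         (use M' in \<open>auto split: split_indicator intro: abs_le_D1\<close>)
    show "emeasure lborel (ball (0::'a) 1) \<noteq> 0"
      using V by (simp add: emeasure_ball ball_volume_eq[symmetric])
  qed auto
  have "(\<integral>x. indicator (cball 0 R) x * exp (plateau R x + f x) \<partial>lborel) = R ^ ?N * b"
  proof -
    have "b = (\<integral>x. indicator (cball 0 1) x * exp (\<phi> x) \<partial>lborel)"
      unfolding b_def
    proof (rule integral_cong_AE)
      show "AE x in lborel. indicator (ball 0 1) x * exp (\<phi> x) = indicator (cball 0 1) x * exp (\<phi> x)"
        using AE_not_on_sphere[of 1] by eventually_elim (auto simp: indicator_def)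
    qed measurable
    also have "\<dots> = (1 / R) ^ ?N * (\<integral>x. indicator (cball 0 1) ((1 / R) *\<^sub>R x) * exp (\<psi> x) \<partial>lborel)"
      using integral_lborel_affine[of "\<lambda>x. indicator (cball 0 1) x * exp (\<phi> x)" "1 / R" 0] R by (simp add: \<psi>_def)
    also have "(\<integral>x. indicator (cball 0 1) ((1 / R) *\<^sub>R x) * exp (\<psi> x) \<partial>lborel)
        = (\<integral>x. indicator (cball 0 R) x * exp (plateau R x + f x) \<partial>lborel)"
      using R by (intro Bochner_Integration.integral_cong refl) (auto simp: indicator_def f_def divide_simps)
    finally show ?thesis using R by (simp add: power_divide)
  qed
  then have "Q = exp (v_at TYPE('a) R) * (R ^ ?N * b) + (\<integral>x. indicator (- cball 0 R) x * mu_dens (x::'a) \<partial>lborel)"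
    using exp_identity[OF dim R fm M f0(1)] by (simp add: Q_def)
  \<comment> \<open>The tail of mu is discarded here. Its sign is favourable: a larger
    \<open>Q\<close> lowers I.\<close>
  moreover have "(\<integral>x. indicator (- cball 0 R) x * mu_dens (x::'a) \<partial>lborel) \<ge> 0"
    by (intro Bochner_Integration.integral_nonneg) (simp add: less_imp_le[OF mu_dens_pos])
  ultimately have "exp (v_at TYPE('a) R) * (R ^ ?N * b) \<le> Q" by simp
  moreover have "exp (v_at TYPE('a) R) * (R ^ ?N * b) > 0" using R b by simp
  ultimately have "ln (exp (v_at TYPE('a) R) * (R ^ ?N * b)) \<le> ln Q" by simp
  then have lnQ: "v_at TYPE('a) R + real ?N * ln R + ln b \<le> ln Q" using R b by (simp add: ln_mult ln_realpow)
  have "I_fun f = 1 / ?om * (\<integral>x. bregman x (Z x) \<partial>lborel) + (\<integral>x. f x * mu_dens x \<partial>lborel) - ln Q"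
    unfolding I_fun_def \<open>(\<integral>x. H f x \<partial>lborel) = _\<close> Q_def by (simp add: integral_mu(1)[OF dim])
  also have "\<dots> \<le> 1 / ?om * (\<integral>x. norm (grad \<phi> x) ^ ?N \<partial>lborel) - energy_value TYPE('a) R - (v_at TYPE('a) R + real ?N * ln R + ln b)"
    unfolding en2 GN using lnQ by simp
  also have "\<dots> = J_fun \<phi> + gap TYPE('a) R"
    unfolding J_fun_test[OF \<phi>] gap_def b_def[symmetric] using b V by (simp add: ln_div)
  finally show ?thesis using fW by blast
qed

section \<open>Approximation in \<open>sobolev0\<close>\<close>

text \<open>Fatou's lemma, with integrability of the limit as a separate conclusion: without it a
  bound on the Bochner integral would say nothing about the function.\<close>

lemma fatou_bounded:
  fixes g :: "'a \<Rightarrow> real"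
  assumes gk: "\<And>k. integrable M (gk k)" "\<And>k x. gk k x \<ge> 0"
    and g: "g \<in> borel_measurable M" "\<And>x. g x \<ge> 0"
    and lim: "AE x in M. (\<lambda>k. gk k x) \<longlonglongrightarrow> g x"
    and c: "\<And>k. (\<integral>x. gk k x \<partial>M) \<le> ck k" "ck \<longlonglongrightarrow> c"
  shows "integrable M g" "(\<integral>x. g x \<partial>M) \<le> c"
proof -
  have m: "(\<lambda>x. ennreal (gk k x)) \<in> borel_measurable M" for k using gk(1) by auto
  have nn0: "0 \<le> (\<integral>x. gk k x \<partial>M)" for k by (intro Bochner_Integration.integral_nonneg gk)
  have c0: "c \<ge> 0" by (rule LIMSEQ_le_const[OF c(2)]) (use order_trans[OF nn0 c(1)] in blast)
  have "(\<integral>\<^sup>+x. ennreal (g x) \<partial>M) = (\<integral>\<^sup>+x. liminf (\<lambda>k. ennreal (gk k x)) \<partial>M)"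
  proof (rule nn_integral_cong_AE)
    show "AE x in M. ennreal (g x) = liminf (\<lambda>k. ennreal (gk k x))"
      using lim by eventually_elim (simp add: lim_imp_Liminf[symmetric] tendsto_ennrealI)
  qed
  also have "\<dots> \<le> liminf (\<lambda>k. \<integral>\<^sup>+x. ennreal (gk k x) \<partial>M)" by (rule nn_integral_liminf[OF m])
  also have "(\<lambda>k. \<integral>\<^sup>+x. ennreal (gk k x) \<partial>M) = (\<lambda>k. ennreal (\<integral>x. gk k x \<partial>M))"
    using gk by (intro ext nn_integral_eq_integral) auto
  also have "liminf (\<lambda>k. ennreal (\<integral>x. gk k x \<partial>M)) \<le> liminf (\<lambda>k. ennreal (ck k))"
    by (intro Liminf_mono always_eventually allI ennreal_leI c)
  also have "\<dots> = ennreal c" by (intro lim_imp_Liminf tendsto_ennrealI c) simp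
  finally have le: "(\<integral>\<^sup>+x. ennreal (g x) \<partial>M) \<le> ennreal c" .
  show i: "integrable M g"
    using g le by (intro integrableI_nonneg) (auto intro: le_less_trans)
  show "(\<integral>x. g x \<partial>M) \<le> c"
    using le c0 g(2) by (simp add: nn_integral_eq_integral[OF i] ennreal_le_iff)
qed

text \<open>Convexity applied to s + t = (1 - \<theta>) (s/(1 - \<theta>)) + \<theta> (t/\<theta>),
  with the tangent at s + t. The coefficient of s^n tends to 1 with \<theta>, so this can stand in
  for Minkowski's inequality.\<close>

lemma power_add_weighted:
  fixes s t :: real
  assumes "s \<ge> 0" "t \<ge> 0" "0 < \<theta>" "\<theta> < 1"
  shows "(s + t) ^ n \<le> (1 - \<theta>) * (s / (1 - \<theta>)) ^ n + \<theta> * (t / \<theta>) ^ n"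
proof -
  let ?p = "s + t"
  have 1: "?p ^ n + real n * ?p ^ (n - 1) * (s / (1 - \<theta>) - ?p) \<le> (s / (1 - \<theta>)) ^ n"
    and 2: "?p ^ n + real n * ?p ^ (n - 1) * (t / \<theta> - ?p) \<le> (t / \<theta>) ^ n"
    using assms by (intro power_tangent_le; simp)+
  have "(1 - \<theta>) * (?p ^ n + real n * ?p ^ (n - 1) * (s / (1 - \<theta>) - ?p)) + \<theta> * (?p ^ n + real n * ?p ^ (n - 1) * (t / \<theta> - ?p))
     = ?p ^ n + real n * ?p ^ (n - 1) * (((1 - \<theta>) * (s / (1 - \<theta>)) + \<theta> * (t / \<theta>)) - ?p)"
    by (simp add: algebra_simps)
  also have "(1 - \<theta>) * (s / (1 - \<theta>)) + \<theta> * (t / \<theta>) = ?p" using assms by simp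
  finally have "?p ^ n = (1 - \<theta>) * (?p ^ n + real n * ?p ^ (n - 1) * (s / (1 - \<theta>) - ?p)) + \<theta> * (?p ^ n + real n * ?p ^ (n - 1) * (t / \<theta> - ?p))"
    by simp
  also have "\<dots> \<le> (1 - \<theta>) * (s / (1 - \<theta>)) ^ n + \<theta> * (t / \<theta>) ^ n"
    using 1 2 assms by (intro add_mono mult_left_mono) auto
  finally show ?thesis .
qed

lemma indicator_norm_power:
  fixes y :: "'b::real_normed_vector"
  assumes "n > 0"
  shows "indicator A x *\<^sub>R (norm y ^ n) = norm (indicator A x *\<^sub>R y) ^ n"
  using assms by (auto simp: indicator_def)

lemma borel_measurable_norm_power:
  "g \<in> borel_measurable borel \<Longrightarrow> (\<lambda>x. norm (g x) ^ n) \<in> borel_measurable lborel"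
  by simp

lemma test_functions_sobolev0:
  fixes \<phi> :: "'a::euclidean_space \<Rightarrow> real"
  assumes \<phi>: "\<phi> \<in> test_functions (ball 0 1)"
  shows "\<phi> \<in> sobolev0 DIM('a) (ball 0 1)"
proof -
  let ?N = "DIM('a)" and ?B = "ball (0::'a) 1"
  have N: "?N > 0" by simp
  have c: "continuous_on UNIV \<phi>" "continuous_on UNIV (grad \<phi>)" using test_functionsE[OF \<phi>] by metis+
  have W: "has_weak_grad ?B \<phi> (grad \<phi>)" by (rule test_functions_has_weak_grad[OF \<phi>])
  then have wd: "weakly_differentiable ?B \<phi>" unfolding weakly_differentiable_def by blast
  have z: "\<phi> x = 0" "grad \<phi> x = 0" if "norm x > 1" for x using grad_test_eq_0[OF \<phi>, of x] that by auto
  have [measurable]: "\<phi> \<in> borel_measurable borel" "grad \<phi> \<in> borel_measurable borel"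
    using c by (auto intro: borel_measurable_continuous_onI)
  obtain M1 where M1: "\<And>x. norm (\<phi> x) \<le> M1" using continuous_bounded_support[OF c(1) z(1)] by blast
  obtain M2 where M2: "\<And>x. norm (grad \<phi> x) \<le> M2" using continuous_bounded_support[OF c(2) z(2)] by blast
  have wm: "(\<lambda>x. indicator ?B x *\<^sub>R weak_grad ?B u x) \<in> borel_measurable borel" if "weakly_differentiable ?B u" for u
    by (rule locally_integrable_ball_borel[OF has_weak_gradD(2)[OF has_weak_grad_weak_grad[OF that]]])
  have i1: "set_integrable lborel ?B (\<lambda>x. \<bar>\<phi> x\<bar> ^ ?N)"
    unfolding set_integrable_def
    by (rule integrable_bounded_cball[where r = 1 and B = "M1 ^ ?N"])
       (use M1 order_trans[OF norm_ge_zero M1] in \<open>auto split: split_indicator intro!: power_mono\<close>)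
  have i2: "integrable lborel (\<lambda>x. norm (indicator ?B x *\<^sub>R grad \<phi> x) ^ ?N)"
    by (rule integrable_bounded_cball[where r = 1 and B = "M2 ^ ?N"])
       (use M2 order_trans[OF norm_ge_zero M2] in \<open>auto split: split_indicator intro!: power_mono\<close>)
  have "integrable lborel (\<lambda>x. norm (indicator ?B x *\<^sub>R weak_grad ?B \<phi> x) ^ ?N)"
  proof (rule integrable_cong_AE[THEN iffD1, OF _ _ _ i2])
    show "AE x in lborel. norm (indicator ?B x *\<^sub>R grad \<phi> x) ^ ?N = norm (indicator ?B x *\<^sub>R weak_grad ?B \<phi> x) ^ ?N"
      using weak_grad_eq_AE[OF W open_ball] by eventually_elim (auto simp: indicator_def)
    show "(\<lambda>x. norm (indicator ?B x *\<^sub>R grad \<phi> x) ^ ?N) \<in> borel_measurable lborel" by measurable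
  qed (rule borel_measurable_norm_power[OF wm[OF wd]])
  then have sob: "\<phi> \<in> sobolev ?N ?B"
    unfolding sobolev_def using wd i1 by (simp add: set_integrable_def indicator_norm_power del: norm_scaleR real_scaleR_def)
  \<comment> \<open>A test function approximates itself, but the chosen weak gradient of the zero
    function is 0 only almost everywhere.\<close>
  have "sobolev_norm ?N ?B (\<lambda>x. \<phi> x - \<phi> x) = 0"
  proof -
    have W0: "has_weak_grad ?B (\<lambda>x. \<phi> x - \<phi> x) (\<lambda>x. grad \<phi> x - grad \<phi> x)" by (rule has_weak_grad_diff[OF W W])
    then have wd0: "weakly_differentiable ?B (\<lambda>x. \<phi> x - \<phi> x)" unfolding weakly_differentiable_def by blast
    have e: "(\<integral>x. norm (indicator ?B x *\<^sub>R weak_grad ?B (\<lambda>x. \<phi> x - \<phi> x) x) ^ ?N \<partial>lborel) = (\<integral>x. 0 \<partial>(lborel :: 'a measure))"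
    proof (rule integral_cong_AE)
      show "AE x in lborel. norm (indicator ?B x *\<^sub>R weak_grad ?B (\<lambda>x. \<phi> x - \<phi> x) x) ^ ?N = 0"
        using weak_grad_eq_AE[OF W0 open_ball] by eventually_elim (auto simp: indicator_def)
    qed (simp_all only: borel_measurable_norm_power[OF wm[OF wd0]] borel_measurable_const)
    show ?thesis
      unfolding sobolev_norm_def set_lebesgue_integral_def indicator_norm_power[OF N] e by (simp add: power_0_left)
  qed
  then show ?thesis unfolding sobolev0_def using sob \<phi> by force
qed

text \<open>Convergence in the Sobolev norm is split: the gradients converge in L^N, and along a
  subsequence the functions converge almost everywhere, as Fatou's lemma requires.\<close>

lemma sobolev0_approx:
  fixes u :: "'a::euclidean_space \<Rightarrow> real"
  assumes u: "u \<in> sobolev0 DIM('a) (ball 0 1)"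
  defines "G \<equiv> weak_grad (ball 0 1) u"
  obtains \<phi> where "\<And>k. \<phi> k \<in> test_functions (ball 0 1)"
    "AE x in lborel. x \<in> ball 0 1 \<longrightarrow> (\<lambda>k. \<phi> k x) \<longlonglongrightarrow> u x"
    "\<And>k::nat. integrable lborel (\<lambda>x. norm (indicator (ball 0 1) x *\<^sub>R (G x - grad (\<phi> k) x)) ^ DIM('a))"
    "(\<lambda>k. \<integral>x. norm (indicator (ball 0 1) x *\<^sub>R (G x - grad (\<phi> k) x)) ^ DIM('a) \<partial>lborel) \<longlonglongrightarrow> 0"
proof -
  let ?N = "DIM('a)" and ?B = "ball (0::'a) 1"
  have N: "?N > 0" by simp
  have sob: "u \<in> sobolev ?N ?B" using u unfolding sobolev0_def by auto
  then have wd: "weakly_differentiable ?B u"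
    and "integrable lborel (\<lambda>x. indicator ?B x *\<^sub>R (norm (u x) ^ ?N))" "integrable lborel (\<lambda>x. indicator ?B x *\<^sub>R (norm (G x) ^ ?N))"
    unfolding sobolev_def G_def set_integrable_def real_norm_def by blast+
  then have iu: "integrable lborel (\<lambda>x. norm (indicator ?B x *\<^sub>R u x) ^ ?N)"
    and iG: "integrable lborel (\<lambda>x. norm (indicator ?B x *\<^sub>R G x) ^ ?N)"
    by (simp_all only: indicator_norm_power[OF N])
  have W: "has_weak_grad ?B u G" unfolding G_def by (rule has_weak_grad_weak_grad[OF wd])
  have "\<exists>\<psi>\<in>test_functions ?B. sobolev_norm ?N ?B (\<lambda>x. u x - \<psi> x) < 1 / real (Suc k)" for k
    using u unfolding sobolev0_def by (auto simp del: of_nat_Suc)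
  then obtain \<psi> where \<psi>: "\<And>k. \<psi> k \<in> test_functions ?B" "\<And>k. sobolev_norm ?N ?B (\<lambda>x. u x - \<psi> k x) < 1 / real (Suc k)"
    by metis
  have c: "continuous_on UNIV (\<psi> k)" "continuous_on UNIV (grad (\<psi> k))" for k using test_functionsE[OF \<psi>(1)] by metis+
  have z: "\<psi> k x = 0" "grad (\<psi> k) x = 0" if "norm x > 1" for x k using grad_test_eq_0[OF \<psi>(1), of x] that by auto
  have [measurable]: "\<psi> k \<in> borel_measurable borel" "grad (\<psi> k) \<in> borel_measurable borel" for k
    using c by (auto intro: borel_measurable_continuous_onI)
  have [measurable]: "(\<lambda>x. indicator ?B x *\<^sub>R u x) \<in> borel_measurable borel" "(\<lambda>x. indicator ?B x *\<^sub>R G x) \<in> borel_measurable borel"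
    using locally_integrable_ball_borel has_weak_gradD[OF W] by blast+
  define a where "a k = (\<integral>x. norm (indicator ?B x *\<^sub>R (u x - \<psi> k x)) ^ ?N \<partial>lborel)" for k
  define e where "e k = (\<integral>x. norm (indicator ?B x *\<^sub>R (G x - grad (\<psi> k) x)) ^ ?N \<partial>lborel)" for k
  have idiff: "integrable lborel (\<lambda>x. norm (indicator ?B x *\<^sub>R (g x - h x)) ^ ?N)"
    if g: "integrable lborel (\<lambda>x. norm (indicator ?B x *\<^sub>R g x) ^ ?N)" "(\<lambda>x. indicator ?B x *\<^sub>R g x) \<in> borel_measurable borel"
      and h: "continuous_on UNIV h" "\<And>x. norm x > 1 \<Longrightarrow> h x = 0" for g h :: "'a \<Rightarrow> 'b::euclidean_space"
  proof (rule Bochner_Integration.integrable_bound)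
    have [measurable]: "h \<in> borel_measurable borel" using h(1) by (rule borel_measurable_continuous_onI)
    note [measurable] = g(2)
    obtain M where M: "\<And>x. norm (h x) \<le> M" using continuous_bounded_support[OF h] by blast
    have ih: "integrable lborel (\<lambda>x. norm (h x) ^ ?N)"
      by (rule integrable_bounded_cball[where r = 1 and B = "M ^ ?N"]) (use M h(2) in \<open>auto intro!: power_mono\<close>)
    show "integrable lborel (\<lambda>x. 2 ^ ?N * (norm (indicator ?B x *\<^sub>R g x) ^ ?N + norm (h x) ^ ?N))"
      by (intro integrable_mult_right Bochner_Integration.integrable_add g ih)
    have e: "indicator ?B x *\<^sub>R (g x - h x) = indicator ?B x *\<^sub>R g x - indicator ?B x *\<^sub>R h x" for x by (rule scaleR_diff_right)
    show "(\<lambda>x. norm (indicator ?B x *\<^sub>R (g x - h x)) ^ ?N) \<in> borel_measurable lborel"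
      unfolding e by measurable
    show "AE x in lborel. norm (norm (indicator ?B x *\<^sub>R (g x - h x)) ^ ?N) \<le> norm (2 ^ ?N * (norm (indicator ?B x *\<^sub>R g x) ^ ?N + norm (h x) ^ ?N))"
    proof (intro AE_I2)
      fix x
      have "norm (indicator ?B x *\<^sub>R (g x - h x)) \<le> norm (indicator ?B x *\<^sub>R g x) + norm (h x)"
        using norm_triangle_ineq4[of "g x" "h x"] by (auto simp: indicator_def)
      then have "norm (indicator ?B x *\<^sub>R (g x - h x)) ^ ?N \<le> (norm (indicator ?B x *\<^sub>R g x) + norm (h x)) ^ ?N"
        by (intro power_mono) auto
      also have "\<dots> \<le> 2 ^ ?N * (norm (indicator ?B x *\<^sub>R g x) ^ ?N + norm (h x) ^ ?N)" by (rule power_add_le) auto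
      finally have "norm (indicator ?B x *\<^sub>R (g x - h x)) ^ ?N \<le> 2 ^ ?N * (norm (indicator ?B x *\<^sub>R g x) ^ ?N + norm (h x) ^ ?N)" .
      moreover have "0 \<le> a \<Longrightarrow> a \<le> b \<Longrightarrow> norm a \<le> norm b" for a b :: real by simp
      ultimately show "norm (norm (indicator ?B x *\<^sub>R (g x - h x)) ^ ?N) \<le> norm (2 ^ ?N * (norm (indicator ?B x *\<^sub>R g x) ^ ?N + norm (h x) ^ ?N))"
        by (meson norm_ge_zero zero_le_power)
    qed
  qed
  have ia: "integrable lborel (\<lambda>x. norm (indicator ?B x *\<^sub>R (u x - \<psi> k x)) ^ ?N)" for k
    by (rule idiff[OF iu _ c(1) z(1)]) measurable
  have ie: "integrable lborel (\<lambda>x. norm (indicator ?B x *\<^sub>R (G x - grad (\<psi> k) x)) ^ ?N)" for k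
    by (rule idiff[OF iG _ c(2) z(2)]) measurable
  have a0: "a k \<ge> 0" and e0: "e k \<ge> 0" for k unfolding a_def e_def by (auto intro!: Bochner_Integration.integral_nonneg)
  \<comment> \<open>The N-th power of the Sobolev norm is the sum of the two errors, and both are
    non-negative, so each tends to 0.\<close>
  have ae: "a k + e k \<le> (1 / real (Suc k)) ^ ?N" for k
  proof -
    have Wd: "has_weak_grad ?B (\<lambda>x. u x - \<psi> k x) (\<lambda>x. G x - grad (\<psi> k) x)"
      by (rule has_weak_grad_diff[OF W test_functions_has_weak_grad[OF \<psi>(1)]])
    have wm: "(\<lambda>x. indicator ?B x *\<^sub>R weak_grad ?B (\<lambda>x. u x - \<psi> k x) x) \<in> borel_measurable borel"
      by (rule locally_integrable_ball_borel[OF has_weak_gradD(2)[OF has_weak_grad_weak_grad]])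
         (use Wd in \<open>auto simp: weakly_differentiable_def\<close>)
    have "e k = (\<integral>x. norm (indicator ?B x *\<^sub>R weak_grad ?B (\<lambda>x. u x - \<psi> k x) x) ^ ?N \<partial>lborel)"
      unfolding e_def
    proof (rule integral_cong_AE)
      show "AE x in lborel. norm (indicator ?B x *\<^sub>R (G x - grad (\<psi> k) x)) ^ ?N = norm (indicator ?B x *\<^sub>R weak_grad ?B (\<lambda>x. u x - \<psi> k x) x) ^ ?N"
        using weak_grad_eq_AE[OF Wd open_ball] by eventually_elim (auto simp: indicator_def)
    qed (rule borel_measurable_integrable[OF ie] borel_measurable_norm_power[OF wm])+
    then have "sobolev_norm ?N ?B (\<lambda>x. u x - \<psi> k x) = root ?N (a k + e k)"
      unfolding sobolev_norm_def set_lebesgue_integral_def a_def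
      unfolding real_norm_def[symmetric] indicator_norm_power[OF N] by (simp only:)
    then have "root ?N (a k + e k) \<le> 1 / real (Suc k)" using \<psi>(2)[of k] by simp
    then have "(root ?N (a k + e k)) ^ ?N \<le> (1 / real (Suc k)) ^ ?N"
      using a0[of k] e0[of k] by (intro power_mono) auto
    then show ?thesis using a0[of k] e0[of k] N by (simp del: of_nat_Suc)
  qed
  have lim: "(\<lambda>k. (1 / real (Suc k)) ^ ?N) \<longlonglongrightarrow> 0"
    using tendsto_power[OF LIMSEQ_inverse_real_of_nat, of ?N] by (simp add: inverse_eq_divide power_0_left)
  have alim: "a \<longlonglongrightarrow> 0"
    by (rule tendsto_sandwich[OF _ _ tendsto_const lim]) (use a0 e0 ae order_trans[OF _ ae] in \<open>auto intro!: always_eventually\<close>)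
  have elim: "e \<longlonglongrightarrow> 0"
    by (rule tendsto_sandwich[OF _ _ tendsto_const lim]) (use a0 e0 ae order_trans[OF _ ae] in \<open>auto intro!: always_eventually\<close>)
  have "(\<lambda>k. \<integral>x. norm (norm (indicator ?B x *\<^sub>R (u x - \<psi> k x)) ^ ?N) \<partial>lborel) \<longlonglongrightarrow> 0"
    using alim by (simp add: a_def[abs_def])
  from tendsto_L1_AE_subseq[OF ia this] obtain r :: "nat \<Rightarrow> nat" where r: "strict_mono r"
    "AE x in lborel. (\<lambda>k. norm (indicator ?B x *\<^sub>R (u x - \<psi> (r k) x)) ^ ?N) \<longlonglongrightarrow> 0" by blast
  have "AE x in lborel. x \<in> ?B \<longrightarrow> (\<lambda>k. \<psi> (r k) x) \<longlonglongrightarrow> u x"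
    using r(2)
  proof eventually_elim
    fix x assume l: "(\<lambda>k. norm (indicator ?B x *\<^sub>R (u x - \<psi> (r k) x)) ^ ?N) \<longlonglongrightarrow> 0"
    show "x \<in> ?B \<longrightarrow> (\<lambda>k. \<psi> (r k) x) \<longlonglongrightarrow> u x"
    proof
      assume x: "x \<in> ?B"
      from tendsto_real_root[OF l, of ?N] x have "(\<lambda>k. \<bar>u x - \<psi> (r k) x\<bar>) \<longlonglongrightarrow> 0"
        by (simp add: real_root_power_cancel)
      then have "(\<lambda>k. u x - \<psi> (r k) x) \<longlonglongrightarrow> 0" by (simp add: tendsto_rabs_zero_iff)
      from tendsto_diff[OF tendsto_const[of "u x"] this] show "(\<lambda>k. \<psi> (r k) x) \<longlonglongrightarrow> u x" by simp
    qed
  qed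
  moreover have "(\<lambda>k. e (r k)) \<longlonglongrightarrow> 0" using LIMSEQ_subseq_LIMSEQ[OF elim r(1)] by (simp add: comp_def)
  ultimately show ?thesis using \<psi>(1) ie unfolding e_def by (intro that[of "\<lambda>k. \<psi> (r k)"]) auto
qed

text \<open>The bound for a test function is read as an upper bound on its exponential integral. The
  energies of the approximants are compared with that of u through a parameter \<theta>; Fatou's
  lemma is applied with \<theta> fixed, and \<theta> tends to 0 afterwards.\<close>

lemma J_bound_extends_sobolev0:
  fixes u :: "'a::euclidean_space \<Rightarrow> real"
  assumes dim: "DIM('a) \<ge> 2" and u: "u \<in> sobolev0 DIM('a) (ball 0 1)"
    and m: "\<And>\<phi>. \<phi> \<in> test_functions (ball 0 1) \<Longrightarrow> m \<le> J_fun (\<phi> :: 'a \<Rightarrow> real)"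
  shows "m \<le> J_fun u"
proof -
  let ?N = "DIM('a)" and ?B = "ball (0::'a) 1" and ?om = "omega_tilde TYPE('a)" and ?V = "ball_volume TYPE('a)"
  have N: "?N > 0" by simp
  have V: "?V > 0" by (rule ball_volume_pos)
  have om: "?om > 0" by (rule omega_tilde_pos[OF dim])
  define G where "G = weak_grad ?B u"
  have sob: "u \<in> sobolev ?N ?B" using u unfolding sobolev0_def by auto
  then have wd: "weakly_differentiable ?B u"
    and "integrable lborel (\<lambda>x. indicator ?B x *\<^sub>R (norm (G x) ^ ?N))"
    unfolding sobolev_def G_def set_integrable_def by blast+
  then have iG: "integrable lborel (\<lambda>x. norm (indicator ?B x *\<^sub>R G x) ^ ?N)"
    by (simp only: indicator_norm_power[OF N])
  have W: "has_weak_grad ?B u G" unfolding G_def by (rule has_weak_grad_weak_grad[OF wd])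
  obtain \<phi> where \<phi>: "\<And>k. \<phi> k \<in> test_functions ?B"
    and lim: "AE x in lborel. x \<in> ?B \<longrightarrow> (\<lambda>k. \<phi> k x) \<longlonglongrightarrow> u x"
    and ie: "\<And>k::nat. integrable lborel (\<lambda>x. norm (indicator ?B x *\<^sub>R (G x - grad (\<phi> k) x)) ^ ?N)"
    and elim: "(\<lambda>k. \<integral>x. norm (indicator ?B x *\<^sub>R (G x - grad (\<phi> k) x)) ^ ?N \<partial>lborel) \<longlonglongrightarrow> 0"
    using sobolev0_approx[OF u] unfolding G_def by blast
  define e where "e k = (\<integral>x. norm (indicator ?B x *\<^sub>R (G x - grad (\<phi> k) x)) ^ ?N \<partial>lborel)" for k
  define g where "g = (\<integral>x. norm (indicator ?B x *\<^sub>R G x) ^ ?N \<partial>lborel)"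
  define b where "b = (\<integral>x. indicator ?B x * exp (u x) \<partial>lborel)"
  have c: "continuous_on UNIV (\<phi> k)" "continuous_on UNIV (grad (\<phi> k))" for k using test_functionsE[OF \<phi>] by metis+
  have z: "\<phi> k x = 0" "grad (\<phi> k) x = 0" if "norm x > 1" for x k using grad_test_eq_0[OF \<phi>, of x] that by auto
  have [measurable]: "\<phi> k \<in> borel_measurable borel" "grad (\<phi> k) \<in> borel_measurable borel" for k
    using c by (auto intro: borel_measurable_continuous_onI)
  have um [measurable]: "(\<lambda>x. indicator ?B x *\<^sub>R u x) \<in> borel_measurable borel"
    using locally_integrable_ball_borel has_weak_gradD[OF W] by blast
  have eqexp: "indicator ?B x * exp (u x) = indicator ?B x * exp (indicator ?B x *\<^sub>R u x)" for x by (auto simp: indicator_def)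
  have em: "(\<lambda>x. indicator ?B x * exp (u x)) \<in> borel_measurable lborel" unfolding eqexp by measurable
  have ik: "integrable lborel (\<lambda>x. indicator ?B x * exp (\<phi> k x))" for k
  proof -
    obtain M where M: "\<And>x. norm (\<phi> k x) \<le> M" using continuous_bounded_support[OF c(1) z(1)] by blast
    show ?thesis
      by (rule integrable_bounded_cball[where r = 1 and B = "exp M"])
         (use M in \<open>auto split: split_indicator intro: abs_le_D1\<close>)
  qed
  have Bne: "emeasure lborel ?B \<noteq> 0" using V by (simp add: emeasure_ball ball_volume_eq[symmetric])
  have key: "integrable lborel (\<lambda>x. indicator ?B x * exp (u x)) \<and>
      b \<le> ?V * exp (1 / ?om * ((1 - \<theta>) * (g / (1 - \<theta>) ^ ?N)) - m)" if \<theta>: "0 < \<theta>" "\<theta> < 1" for \<theta>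
  proof -
    let ?c = "\<lambda>k. ?V * exp (1 / ?om * ((1 - \<theta>) * (g / (1 - \<theta>) ^ ?N) + \<theta> * (e k / \<theta> ^ ?N)) - m)"
    have ck: "(\<integral>x. indicator ?B x * exp (\<phi> k x) \<partial>lborel) \<le> ?c k" for k
    proof -
      define bk where "bk = (\<integral>x. indicator ?B x * exp (\<phi> k x) \<partial>lborel)"
      have bk: "bk > 0" unfolding bk_def by (rule integral_pos_lborel[OF ik _ Bne]) auto
      have "m \<le> J_fun (\<phi> k)" by (rule m[OF \<phi>])
      then have "ln (bk / ?V) \<le> 1 / ?om * (\<integral>x. norm (grad (\<phi> k) x) ^ ?N \<partial>lborel) - m"
        unfolding J_fun_test[OF \<phi>] bk_def by simp
      moreover have "(\<integral>x. norm (grad (\<phi> k) x) ^ ?N \<partial>lborel) \<le> (1 - \<theta>) * (g / (1 - \<theta>) ^ ?N) + \<theta> * (e k / \<theta> ^ ?N)"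
      proof -
        have igk: "integrable lborel (\<lambda>x. norm (grad (\<phi> k) x) ^ ?N)"
        proof -
          obtain M where M: "\<And>x. norm (grad (\<phi> k) x) \<le> M" using continuous_bounded_support[OF c(2) z(2)] by blast
          show ?thesis
            by (rule integrable_bounded_cball[where r = 1 and B = "M ^ ?N"]) (use M z in \<open>auto intro!: power_mono\<close>)
        qed
        have "(\<integral>x. norm (grad (\<phi> k) x) ^ ?N \<partial>lborel)
          \<le> (\<integral>x. (1 - \<theta>) * (norm (indicator ?B x *\<^sub>R G x) ^ ?N / (1 - \<theta>) ^ ?N)
            + \<theta> * (norm (indicator ?B x *\<^sub>R (G x - grad (\<phi> k) x)) ^ ?N / \<theta> ^ ?N) \<partial>lborel)"
        proof (rule Bochner_Integration.integral_mono[OF igk])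
          show "integrable lborel (\<lambda>x. (1 - \<theta>) * (norm (indicator ?B x *\<^sub>R G x) ^ ?N / (1 - \<theta>) ^ ?N)
            + \<theta> * (norm (indicator ?B x *\<^sub>R (G x - grad (\<phi> k) x)) ^ ?N / \<theta> ^ ?N))"
            by (intro Bochner_Integration.integrable_add integrable_mult_right integrable_divide_zero iG ie)
          fix x
          have "grad (\<phi> k) x = indicator ?B x *\<^sub>R G x - indicator ?B x *\<^sub>R (G x - grad (\<phi> k) x)"
            using grad_test_eq_0(2)[OF \<phi>, of x] by (auto simp: indicator_def)
          then have "norm (grad (\<phi> k) x) \<le> norm (indicator ?B x *\<^sub>R G x) + norm (indicator ?B x *\<^sub>R (G x - grad (\<phi> k) x))"
            by (metis norm_triangle_ineq4)
          then have "norm (grad (\<phi> k) x) ^ ?N \<le> (norm (indicator ?B x *\<^sub>R G x) + norm (indicator ?B x *\<^sub>R (G x - grad (\<phi> k) x))) ^ ?N"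
            by (intro power_mono) auto
          also have "\<dots> \<le> (1 - \<theta>) * (norm (indicator ?B x *\<^sub>R G x) / (1 - \<theta>)) ^ ?N
            + \<theta> * (norm (indicator ?B x *\<^sub>R (G x - grad (\<phi> k) x)) / \<theta>) ^ ?N"
            using \<theta> by (intro power_add_weighted) auto
          finally show "norm (grad (\<phi> k) x) ^ ?N \<le> (1 - \<theta>) * (norm (indicator ?B x *\<^sub>R G x) ^ ?N / (1 - \<theta>) ^ ?N)
            + \<theta> * (norm (indicator ?B x *\<^sub>R (G x - grad (\<phi> k) x)) ^ ?N / \<theta> ^ ?N)"
            by (simp only: power_divide)
        qed
        also have "\<dots> = (1 - \<theta>) * (g / (1 - \<theta>) ^ ?N) + \<theta> * (e k / \<theta> ^ ?N)"
          unfolding g_def e_def using iG ie[of k] by (simp del: norm_scaleR times_divide_eq_right)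
        finally show ?thesis .
      qed
      ultimately have "ln (bk / ?V) \<le> 1 / ?om * ((1 - \<theta>) * (g / (1 - \<theta>) ^ ?N) + \<theta> * (e k / \<theta> ^ ?N)) - m"
        using om by (smt (verit) divide_nonneg_nonneg mult_left_mono)
      then have "exp (ln (bk / ?V)) \<le> exp (1 / ?om * ((1 - \<theta>) * (g / (1 - \<theta>) ^ ?N) + \<theta> * (e k / \<theta> ^ ?N)) - m)"
        by (simp only: exp_le_cancel_iff)
      moreover have "exp (ln (bk / ?V)) = bk / ?V" using bk V by (intro exp_ln) auto
      ultimately have "bk / ?V \<le> exp (1 / ?om * ((1 - \<theta>) * (g / (1 - \<theta>) ^ ?N) + \<theta> * (e k / \<theta> ^ ?N)) - m)" by simp
      then show ?thesis unfolding bk_def[symmetric] using V by (simp only: pos_divide_le_eq mult.commute)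
    qed
    have climit: "?c \<longlonglongrightarrow> ?V * exp (1 / ?om * ((1 - \<theta>) * (g / (1 - \<theta>) ^ ?N) + \<theta> * (0 / \<theta> ^ ?N)) - m)"
      using \<theta> elim unfolding e_def[symmetric] by (intro tendsto_intros) auto
    have elimexp: "AE x in lborel. (\<lambda>k. indicator ?B x * exp (\<phi> k x)) \<longlonglongrightarrow> indicator ?B x * exp (u x)"
      using lim
    proof eventually_elim
      fix x assume l: "x \<in> ?B \<longrightarrow> (\<lambda>k. \<phi> k x) \<longlonglongrightarrow> u x"
      show "(\<lambda>k. indicator ?B x * exp (\<phi> k x)) \<longlonglongrightarrow> indicator ?B x * exp (u x)"
        using l by (cases "x \<in> ?B") (auto intro!: tendsto_intros)
    qed
    note f = fatou_bounded[OF ik _ em _ elimexp ck climit]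
    have "integrable lborel (\<lambda>x. indicator ?B x * exp (u x))" by (rule f(1)) simp_all
    moreover have "b \<le> ?V * exp (1 / ?om * ((1 - \<theta>) * (g / (1 - \<theta>) ^ ?N) + \<theta> * (0 / \<theta> ^ ?N)) - m)"
      unfolding b_def by (rule f(2)) simp_all
    ultimately show ?thesis by simp
  qed
  \<comment> \<open>Any \<theta> yields integrability of the exponential; 1/2 is an arbitrary
    choice.\<close>
  have bpos: "b > 0" unfolding b_def using key[of "1/2"] by (intro integral_pos_lborel[OF _ _ Bne]) auto
  have ble: "b \<le> ?V * exp (1 / ?om * g - m)"
  proof (rule LIMSEQ_le_const)
    \<comment> \<open>The shift by 2 keeps \<theta> = 1/(n + 2) strictly between 0 and 1 from n = 0
      on.\<close>
    have t0: "(\<lambda>n. 1 / real (n + 2)) \<longlonglongrightarrow> 0"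
      using LIMSEQ_ignore_initial_segment[OF lim_1_over_n, of 2] by simp
    have "(\<lambda>n. ?V * exp (1 / ?om * ((1 - 1 / real (n + 2)) * (g / (1 - 1 / real (n + 2)) ^ ?N)) - m))
       \<longlonglongrightarrow> ?V * exp (1 / ?om * ((1 - 0) * (g / (1 - 0) ^ ?N)) - m)"
      by (intro tendsto_intros t0) auto
    then show "(\<lambda>n. ?V * exp (1 / ?om * ((1 - 1 / real (n + 2)) * (g / (1 - 1 / real (n + 2)) ^ ?N)) - m))
       \<longlonglongrightarrow> ?V * exp (1 / ?om * g - m)" by simp
    show "\<exists>N. \<forall>n\<ge>N. b \<le> ?V * exp (1 / ?om * ((1 - 1 / real (n + 2)) * (g / (1 - 1 / real (n + 2)) ^ ?N)) - m)"
      using key[of "1 / real (_ + 2)"] by (auto simp del: of_nat_add)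
  qed
  have "b / ?V \<le> exp (1 / ?om * g - m)" using ble V by (simp add: pos_divide_le_eq mult.commute)
  then have "ln (b / ?V) \<le> ln (exp (1 / ?om * g - m))" using bpos V by (subst ln_le_cancel_iff) auto
  then have "m \<le> 1 / ?om * g - ln (b / ?V)" by simp
  then show ?thesis unfolding J_fun_eq[OF W] g_def b_def by simp
qed

text \<open>Expressing the inner product by norms leaves a problem in one variable: with A = |grad
  v|, B = |grad v + z| and s = |z|, the quantity is the tangent remainder of t^N between A and B
  plus (N/2) A^(N-2) (s^2 - (B - A)^2), and both terms are non-negative. The majorant consists of
  the two gradient integrands of \<open>W_mu\<close>; the constant is crude.\<close>

lemma bregman_bounds:
  fixes x z :: "'a::euclidean_space"
  assumes dim: "DIM('a) \<ge> 2"
  shows "0 \<le> bregman x z"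
    "bregman x z \<le> 2 * real DIM('a) ^ 2 * 2 ^ DIM('a) * (norm (grad v x) ^ (DIM('a) - 2) * (norm z)\<^sup>2 + norm z ^ DIM('a))"
proof -
  let ?N = "DIM('a)"
  define A B s where "A = norm (grad v x)" and "B = norm (grad v x + z)" and "s = norm z"
  have nn: "A \<ge> 0" "B \<ge> 0" "s \<ge> 0" by (auto simp: A_def B_def s_def)
  have BA: "\<bar>B - A\<bar> \<le> s"
    using norm_triangle_ineq3[of "grad v x + z" "grad v x"] by (simp add: A_def B_def s_def)
  have BA2: "(B - A)\<^sup>2 \<le> s\<^sup>2" using BA nn by (simp add: abs_le_square_iff[symmetric])
  note p = power_split[OF dim]
  define r where "r = B ^ ?N - A ^ ?N - real ?N * A ^ (?N - 1) * (B - A)"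
  have inner: "2 * (grad v x \<bullet> z) = B\<^sup>2 - A\<^sup>2 - s\<^sup>2"
    by (simp add: A_def B_def s_def power2_norm_eq_inner inner_add inner_commute)
  have eq: "bregman x z = r + real ?N / 2 * A ^ (?N - 2) * (s\<^sup>2 - (B - A)\<^sup>2)"
  proof -
    have "liouville_field x \<bullet> z = A ^ (?N - 2) * ((B\<^sup>2 - A\<^sup>2 - s\<^sup>2) / 2)"
      using inner by (simp add: liouville_field_def A_def)
    then have "bregman x z = B ^ ?N - A ^ ?N - real ?N * (A ^ (?N - 2) * ((B\<^sup>2 - A\<^sup>2 - s\<^sup>2) / 2))"
      by (simp add: bregman_def A_def B_def)
    then show ?thesis unfolding r_def p(1)[of A] by (simp add: power2_eq_square field_simps)
  qed
  have r0: "0 \<le> r" using power_tangent_le[OF nn(1,2), of ?N] by (simp add: r_def)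
  then show "0 \<le> bregman x z" unfolding eq using BA2 nn by simp
  define M where "M = A + s"
  have M: "A \<le> M" "B \<le> M" "0 \<le> M" using BA nn by (auto simp: M_def)
  \<comment> \<open>The tangent inequality at B bounds the remainder by the symmetrised Bregman
    distance N (B^(N-1) - A^(N-1)) (B - A).\<close>
  have r1: "r \<le> real ?N * ((B ^ (?N - 1) - A ^ (?N - 1)) * (B - A))"
    using power_tangent_le[OF nn(2,1), of ?N] by (simp add: r_def algebra_simps)
  have diff: "\<bar>b ^ (?N - 1) - a ^ (?N - 1)\<bar> \<le> real ?N * M ^ (?N - 2) * \<bar>b - a\<bar>"
    if ab: "0 \<le> a" "0 \<le> b" "a \<le> M" "b \<le> M" "a \<le> b" for a b
  proof -
    have "b ^ (?N - 1) - a ^ (?N - 1) \<le> real (?N - 1) * b ^ (?N - 1 - 1) * (b - a)"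
      using power_tangent_le[OF ab(2,1), of "?N - 1"] by (simp add: algebra_simps)
    also have "?N - 1 - 1 = ?N - 2" by simp
    also have "real (?N - 1) * b ^ (?N - 2) * (b - a) \<le> real ?N * M ^ (?N - 2) * (b - a)"
      using ab by (intro mult_right_mono mult_mono power_mono) auto
    finally show ?thesis using power_mono[OF ab(5,1), of "?N - 1"] ab by simp
  qed
  have "\<bar>B ^ (?N - 1) - A ^ (?N - 1)\<bar> \<le> real ?N * M ^ (?N - 2) * \<bar>B - A\<bar>"
    using diff[of A B] diff[of B A] M nn by (cases "A \<le> B") (auto simp: abs_minus_commute)
  then have "\<bar>B ^ (?N - 1) - A ^ (?N - 1)\<bar> * \<bar>B - A\<bar> \<le> real ?N * M ^ (?N - 2) * \<bar>B - A\<bar> * \<bar>B - A\<bar>"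
    by (intro mult_right_mono) auto
  also have "\<dots> = real ?N * M ^ (?N - 2) * (B - A)\<^sup>2" by (simp add: power2_eq_square)
  also have "\<dots> \<le> real ?N * M ^ (?N - 2) * s\<^sup>2" using BA2 M by (intro mult_left_mono) auto
  finally have "(B ^ (?N - 1) - A ^ (?N - 1)) * (B - A) \<le> real ?N * M ^ (?N - 2) * s\<^sup>2"
    by (rule order_trans[OF abs_ge_self[of "(B ^ (?N - 1) - A ^ (?N - 1)) * (B - A)", unfolded abs_mult]])
  then have "real ?N * ((B ^ (?N - 1) - A ^ (?N - 1)) * (B - A)) \<le> real ?N * (real ?N * M ^ (?N - 2) * s\<^sup>2)"
    by (rule mult_left_mono) simp
  with r1 have r2: "r \<le> real ?N * (real ?N * M ^ (?N - 2) * s\<^sup>2)" by (rule order_trans)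
  have "M ^ (?N - 2) \<le> 2 ^ (?N - 2) * (A ^ (?N - 2) + s ^ (?N - 2))"
    unfolding M_def by (rule power_add_le) (use nn in auto)
  also have "\<dots> \<le> 2 ^ ?N * (A ^ (?N - 2) + s ^ (?N - 2))"
    using nn by (intro mult_right_mono power_increasing) auto
  finally have "M ^ (?N - 2) * s\<^sup>2 \<le> 2 ^ ?N * (A ^ (?N - 2) + s ^ (?N - 2)) * s\<^sup>2" by (intro mult_right_mono) auto
  also have "\<dots> = 2 ^ ?N * (A ^ (?N - 2) * s\<^sup>2 + s ^ ?N)" by (simp add: p(2)[of s] algebra_simps)
  finally have Ms: "M ^ (?N - 2) * s\<^sup>2 \<le> 2 ^ ?N * (A ^ (?N - 2) * s\<^sup>2 + s ^ ?N)" .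
  let ?T = "A ^ (?N - 2) * s\<^sup>2 + s ^ ?N"
  have T: "A ^ (?N - 2) * s\<^sup>2 \<le> ?T" "0 \<le> ?T" using nn by auto
  have "r \<le> real ?N ^ 2 * (2 ^ ?N * ?T)"
  proof -
    have "real ?N * (real ?N * M ^ (?N - 2) * s\<^sup>2) = real ?N ^ 2 * (M ^ (?N - 2) * s\<^sup>2)"
      by (simp add: power2_eq_square)
    also have "\<dots> \<le> real ?N ^ 2 * (2 ^ ?N * ?T)" by (rule mult_left_mono[OF Ms]) simp
    finally show ?thesis using r2 by (rule order_trans[rotated])
  qed
  moreover have "real ?N / 2 * A ^ (?N - 2) * (s\<^sup>2 - (B - A)\<^sup>2) \<le> real ?N ^ 2 * (2 ^ ?N * ?T)"
  proof -
    have "real ?N / 2 * A ^ (?N - 2) * (s\<^sup>2 - (B - A)\<^sup>2) \<le> real ?N / 2 * A ^ (?N - 2) * s\<^sup>2"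
      using nn by (intro mult_left_mono) auto
    also have "\<dots> = real ?N / 2 * (A ^ (?N - 2) * s\<^sup>2)" by simp
    also have "\<dots> \<le> real ?N / 2 * ?T" using T by (intro mult_left_mono) auto
    also have "\<dots> \<le> (real ?N ^ 2 * 2 ^ ?N) * ?T"
    proof (rule mult_right_mono[OF _ T(2)])
      have "real ?N / 2 \<le> real ?N ^ 2" using dim by (simp add: power2_eq_square)
      also have "\<dots> \<le> real ?N ^ 2 * 2 ^ ?N" by simp
      finally show "real ?N / 2 \<le> real ?N ^ 2 * 2 ^ ?N" .
    qed
    finally show ?thesis by (simp only: mult.assoc)
  qed
  ultimately have "r + real ?N / 2 * A ^ (?N - 2) * (s\<^sup>2 - (B - A)\<^sup>2) \<le> real ?N ^ 2 * (2 ^ ?N * ?T) + real ?N ^ 2 * (2 ^ ?N * ?T)"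
    by (rule add_mono)
  also have "\<dots> = 2 * real ?N ^ 2 * 2 ^ ?N * ?T" by (simp only: mult.assoc mult_2 distrib_right)
  finally show "bregman x z \<le> 2 * real ?N ^ 2 * 2 ^ ?N * (norm (grad v x) ^ (?N - 2) * (norm z)\<^sup>2 + norm z ^ ?N)"
    unfolding eq A_def[symmetric] s_def[symmetric] .
qed

section \<open>Approximation in \<open>W_mu\<close>\<close>

text \<open>A cutoff scale growing like an iterated logarithm: its gradient has finite \<open>N\<close>-energy, so no
  estimate of the cutoff terms is needed beyond dominated convergence.\<close>
definition log_scale :: "'a::euclidean_space \<Rightarrow> real" where
  "log_scale x = ln (1 + ln (1 + profile x))"

definition grad_log_scale :: "'a::euclidean_space \<Rightarrow> 'a" where
  "grad_log_scale x = (1 / (1 + ln (1 + profile x)) * (1 / (1 + profile x))) *\<^sub>R grad_profile x"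

lemma ln_profile_nonneg [simp]: "0 \<le> ln (1 + profile x)"
  by simp

lemma log_scale_nonneg [simp]: "0 \<le> log_scale x"
  unfolding log_scale_def by (intro ln_ge_zero) simp

lemma GDERIV_log_scale:
  assumes dim: "DIM('a::euclidean_space) \<ge> 2"
  shows "GDERIV log_scale x :> grad_log_scale (x::'a)" "continuous_on UNIV (grad_log_scale :: 'a \<Rightarrow> 'a)"
proof -
  have p: "1 + ln (1 + profile y) > 0" for y :: 'a using ln_profile_nonneg[of y] by linarith
  have 1: "DERIV (\<lambda>s. 1 + s) t :> 1" for t :: real by (auto intro!: derivative_eq_intros)
  have "DERIV (\<lambda>s. ln (1 + s)) (profile x) :> 1 / (1 + profile x) * 1"
    by (rule DERIV_chain2[OF DERIV_ln_divide 1]) simp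
  then have "DERIV (\<lambda>s. 1 + ln (1 + s)) (profile x) :> 0 + 1 / (1 + profile x) * 1" by (intro DERIV_add DERIV_const)
  from DERIV_chain2[OF DERIV_ln_divide[OF p[of x]] this]
  have "DERIV (\<lambda>s. ln (1 + ln (1 + s))) (profile x) :> 1 / (1 + ln (1 + profile x)) * (1 / (1 + profile x))" by simp
  from GDERIV_DERIV_compose[OF GDERIV_profile[OF dim] this]
  show "GDERIV log_scale x :> grad_log_scale x" by (simp add: log_scale_def[abs_def] grad_log_scale_def)
  have "1 + ln (1 + profile y) \<noteq> 0" for y :: 'a using p[of y] by linarith
  then show "continuous_on UNIV (grad_log_scale :: 'a \<Rightarrow> 'a)"
    unfolding grad_log_scale_def[abs_def]
    by (intro continuous_intros continuous_grad_profile continuous_profile dim) auto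
qed

text \<open>Both gradients are multiples of \<open>grad_profile\<close>; away from the origin the
  ratio of their lengths is N (1 + ln (1 + profile x)).\<close>

lemma norm_grad_log_scale:
  fixes x :: "'a::euclidean_space"
  assumes dim: "DIM('a) \<ge> 2"
  shows "norm (grad_log_scale x) \<le> norm (grad v x) / (1 + ln (1 + profile x))"
proof -
  have p: "1 + ln (1 + profile x) > 0" using ln_profile_nonneg[of x] by linarith
  have "norm (grad v x) = real DIM('a) / (1 + profile x) * norm (grad_profile x)"
    by (simp add: grad_v[OF dim])
  moreover have "1 / (1 + profile x) * norm (grad_profile x) \<le> real DIM('a) / (1 + profile x) * norm (grad_profile x)"
    using dim by (intro mult_right_mono divide_right_mono) (auto simp: less_imp_le)
  ultimately have "1 / (1 + profile x) * norm (grad_profile x) \<le> norm (grad v x)" by simp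
  from divide_right_mono[OF this less_imp_le[OF p]] show ?thesis
    using p by (simp add: grad_log_scale_def abs_of_pos mult.commute)
qed

text \<open>Two factors keep the logarithm and the remaining N - 2 are bounded by |grad v|; as N >=
  2 this always yields the squared logarithm that integrability requires.\<close>

lemma integrable_grad_log_scale:
  assumes dim: "DIM('a::euclidean_space) \<ge> 2"
  shows "integrable lborel (\<lambda>x::'a. norm (grad_log_scale x) ^ DIM('a))"
    "integrable lborel (\<lambda>x::'a. norm (grad v x) ^ (DIM('a) - 2) * (norm (grad_log_scale x))\<^sup>2)"
proof -
  let ?N = "DIM('a)"
  note [measurable] = liouville_field_borel[OF dim]
  have [measurable]: "(grad_log_scale :: 'a \<Rightarrow> 'a) \<in> borel_measurable borel"
    using GDERIV_log_scale(2)[OF dim] by (rule borel_measurable_continuous_onI)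
  have 2: "norm (grad v x) ^ (?N - 2) * (norm (grad_log_scale x))\<^sup>2 \<le> norm (grad v x) ^ ?N / (1 + ln (1 + profile x))\<^sup>2" for x :: 'a
  proof -
    have "norm (grad v x) ^ (?N - 2) * (norm (grad_log_scale x))\<^sup>2 \<le> norm (grad v x) ^ (?N - 2) * (norm (grad v x) / (1 + ln (1 + profile x)))\<^sup>2"
      using norm_grad_log_scale[OF dim, of x] by (intro mult_left_mono power_mono) auto
    then show ?thesis by (simp add: power_split(2)[OF dim, of "norm (grad v x)"] power_divide)
  qed
  have 1: "norm (grad_log_scale x) ^ ?N \<le> norm (grad v x) ^ ?N / (1 + ln (1 + profile x))\<^sup>2" for x :: 'a
  proof -
    have p: "1 + ln (1 + profile x) \<ge> 1" using ln_profile_nonneg[of x] by linarith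
    have "norm (grad_log_scale x) \<le> norm (grad v x)"
    proof (rule order_trans[OF norm_grad_log_scale[OF dim]])
      have "norm (grad v x) / (1 + ln (1 + profile x)) \<le> norm (grad v x) / 1"
        using p by (intro divide_left_mono) (auto intro: add_pos_nonneg)
      then show "norm (grad v x) / (1 + ln (1 + profile x)) \<le> norm (grad v x)" by simp
    qed
    then have "norm (grad_log_scale x) ^ (?N - 2) * (norm (grad_log_scale x))\<^sup>2 \<le> norm (grad v x) ^ (?N - 2) * (norm (grad_log_scale x))\<^sup>2"
      by (intro mult_right_mono power_mono) auto
    also note 2
    finally show ?thesis by (simp add: power_split(2)[OF dim, of "norm (grad_log_scale x)"])
  qed
  show "integrable lborel (\<lambda>x::'a. norm (grad_log_scale x) ^ ?N)"
  proof (rule Bochner_Integration.integrable_bound[OF integrable_grad_v_log[OF dim]])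
    show "AE x in lborel. norm (norm (grad_log_scale (x::'a)) ^ ?N) \<le> norm (norm (grad v x) ^ ?N / (1 + ln (1 + profile x))\<^sup>2)"
      using 1 by (intro AE_I2) (simp add: abs_of_nonneg)
  qed measurable
  show "integrable lborel (\<lambda>x::'a. norm (grad v x) ^ (?N - 2) * (norm (grad_log_scale x))\<^sup>2)"
  proof (rule Bochner_Integration.integrable_bound[OF integrable_grad_v_log[OF dim]])
    show "AE x in lborel. norm (norm (grad v x) ^ (?N - 2) * (norm (grad_log_scale (x::'a)))\<^sup>2) \<le> norm (norm (grad v x) ^ ?N / (1 + ln (1 + profile x))\<^sup>2)"
      using 2 by (intro AE_I2) (simp add: abs_of_nonneg)
  qed measurable
qed

text \<open>The radius solves |x|^q = exp (exp k); the two summands 1 in \<open>log_scale\<close>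
  only increase the value.\<close>

lemma log_scale_large:
  fixes x :: "'a::euclidean_space"
  assumes dim: "DIM('a) \<ge> 2" and "k \<ge> 0" "norm x > exp (exp k) powr (1 / conj_exp TYPE('a))"
  shows "log_scale x \<ge> k"
proof -
  have q: "conj_exp TYPE('a) > 0" using conj_exp(1)[OF dim] by simp
  have "(exp (exp k) powr (1 / conj_exp TYPE('a))) powr conj_exp TYPE('a) \<le> profile x"
    unfolding profile_def using assms(3) q by (intro powr_mono2) auto
  then have "exp (exp k) \<le> 1 + profile x" using q by (simp add: powr_powr)
  then have "exp k \<le> ln (1 + profile x)" by (subst ln_ge_iff) auto
  then have "exp k \<le> 1 + ln (1 + profile x)" by simp
  then show ?thesis unfolding log_scale_def by (subst ln_ge_iff) (auto intro: add_pos_nonneg)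
qed

text \<open>Squaring removes the corner of the positive part, so cutoffs built from it are C^1, as
  integration by parts demands.\<close>

lemma max0_square_deriv: "DERIV (\<lambda>t::real. (max 0 t)\<^sup>2) t :> 2 * max 0 t"
proof (cases "t = 0")
  case True
  have "((\<lambda>h::real. ((max 0 h)\<^sup>2 - 0) / h) \<longlongrightarrow> max 0 0) (at 0)"
  proof (rule Lim_transform_eventually)
    show "((\<lambda>h::real. max 0 h) \<longlongrightarrow> max 0 0) (at 0)" by (intro tendsto_intros)
    show "eventually (\<lambda>h::real. max 0 h = ((max 0 h)\<^sup>2 - 0) / h) (at 0)"
      by (auto simp: eventually_at_filter max_def power2_eq_square)
  qed
  then show ?thesis using True by (simp add: DERIV_def)
next
  case False
  show ?thesis
  proof (cases "t > 0")
    case True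
    have "DERIV (\<lambda>t::real. t\<^sup>2) t :> 2 * t" by (auto intro!: derivative_eq_intros)
    then have "DERIV (\<lambda>t::real. (max 0 t)\<^sup>2) t :> 2 * t"
      by (rule has_field_derivative_transform_within_open[of _ _ _ "{0<..}"]) (use True in auto)
    then show ?thesis using True by simp
  next
    case f: False
    have "DERIV (\<lambda>t::real. 0) t :> 0" by simp
    then have "DERIV (\<lambda>t::real. (max 0 t)\<^sup>2) t :> 0"
      by (rule has_field_derivative_transform_within_open[of _ _ _ "{..<0}"]) (use False f in auto)
    then show ?thesis using f by simp
  qed
qed

text \<open>A smooth truncation at height of order k, with slope between 0 and 1; the values stay
  below k pi/2 < 2 k. Clipping would satisfy the bounds but is not differentiable.\<close>

lemma scaled_arctan:
  fixes k t :: real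
  assumes k: "k > 0"
  shows "DERIV (\<lambda>t. k * arctan (t / k)) t :> 1 / (1 + (t / k)\<^sup>2)" "\<bar>1 / (1 + (t / k)\<^sup>2)\<bar> \<le> 1"
    "\<bar>k * arctan (t / k)\<bar> \<le> \<bar>t\<bar>" "\<bar>k * arctan (t / k)\<bar> \<le> 2 * k"
proof -
  have d: "DERIV (\<lambda>t. k * arctan (t / k)) t :> 1 / (1 + (t / k)\<^sup>2)" for t
  proof -
    have "DERIV (\<lambda>t. t / k) t :> 1 / k" using DERIV_cdivide[OF DERIV_ident, of k] by simp
    from DERIV_cmult[OF DERIV_chain2[OF DERIV_arctan this], of k] show ?thesis using k by (simp add: inverse_eq_divide)
  qed
  show "DERIV (\<lambda>t. k * arctan (t / k)) t :> 1 / (1 + (t / k)\<^sup>2)" by (rule d)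
  have b: "\<bar>1 / (1 + (t / k)\<^sup>2)\<bar> \<le> 1" for t
  proof -
    have p: "1 + (t / k)\<^sup>2 \<ge> 1" by simp
    then have "1 / (1 + (t / k)\<^sup>2) \<le> 1" by (subst divide_le_eq_1_pos) linarith+
    moreover have "0 \<le> 1 / (1 + (t / k)\<^sup>2)" using p by (intro divide_nonneg_nonneg) linarith+
    ultimately show ?thesis by (simp only: abs_of_nonneg)
  qed
  show "\<bar>1 / (1 + (t / k)\<^sup>2)\<bar> \<le> 1" by (rule b)
  have "\<bar>k * arctan (t / k) - k * arctan (0 / k)\<bar> \<le> 1 * \<bar>t - 0\<bar>"
    using field_differentiable_bound[of UNIV "\<lambda>t. k * arctan (t / k)" "\<lambda>t. 1 / (1 + (t / k)\<^sup>2)" 1 t 0] d b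
    by (auto intro: has_field_derivative_at_within)
  then show "\<bar>k * arctan (t / k)\<bar> \<le> \<bar>t\<bar>" by simp
  have "\<bar>arctan (t / k)\<bar> \<le> 2" using arctan_bounded[of "t / k"] pi_less_4 by (simp add: abs_le_iff)
  then show "\<bar>k * arctan (t / k)\<bar> \<le> 2 * k" using k by (simp add: abs_mult)
qed

text \<open>u is replaced by a cutoff times a truncation, both at the same scale k. The growth of
  the truncation is matched by the decay of the cutoff's gradient, so one function dominates all
  gradients and the Bregman terms converge. The exponential integrals are handled by Fatou's
  lemma.\<close>

lemma lower_bound_W_mu:
  fixes u :: "'a::euclidean_space \<Rightarrow> real"
  assumes dim: "DIM('a) \<ge> 2" and u: "u \<in> W_mu"
    and m: "\<And>\<phi>. \<phi> \<in> test_functions (ball 0 1) \<Longrightarrow> m \<le> J_fun (\<phi> :: 'a \<Rightarrow> real)"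
  shows "m + (\<Sum>k = 1..DIM('a) - 1. 1 / real k) \<le> I_fun u"
proof -
  let ?N = "DIM('a)" and ?om = "omega_tilde TYPE('a)"
  let ?S = "\<Sum>k = 1..DIM('a) - 1. 1 / real k"
  have om: "?om > 0" by (rule omega_tilde_pos[OF dim])
  define G where "G = weak_grad UNIV u"
  have wd: "weakly_differentiable UNIV u" and iu: "integrable mu u"
    and iG: "integrable lborel (\<lambda>x. norm (G x) ^ ?N)"
    and iG2: "integrable lborel (\<lambda>x. (norm (G x))\<^sup>2 * norm (grad v x) ^ (?N - 2))"
    using u unfolding W_mu_def G_def by auto
  have W: "has_weak_grad UNIV u G" unfolding G_def by (rule has_weak_grad_weak_grad[OF wd])
  note w = has_weak_gradD[OF W]
  have um [measurable]: "u \<in> borel_measurable borel" and Gm [measurable]: "G \<in> borel_measurable borel"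
    using w locally_integrable_borel by blast+
  note mm [measurable] = liouville_field_borel[OF dim] borel_measurable_mu_dens[OF dim]
  have ium: "integrable lborel (\<lambda>x. u x * mu_dens x)" using iu integral_mu(2)[OF dim um] by simp
  note GL = GDERIV_log_scale[OF dim]
  have Lm [measurable]: "(grad_log_scale :: 'a \<Rightarrow> 'a) \<in> borel_measurable borel"
    using GL(2) by (rule borel_measurable_continuous_onI)
  have cL: "continuous_on UNIV (log_scale :: 'a \<Rightarrow> real)"
    using C1_lipschitz_on_balls[OF GL] by (rule lipschitz_on_balls_continuous)
  have lm [measurable]: "(log_scale :: 'a \<Rightarrow> real) \<in> borel_measurable borel"
    using cL by (rule borel_measurable_continuous_onI)
  define K where "K k = exp (exp (real (Suc k))) powr (1 / conj_exp TYPE('a))" for k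
  define c where "c k x = max 0 (1 - log_scale x / real (Suc k))" for k and x :: 'a
  define \<eta> where "\<eta> k x = (c k x)\<^sup>2" for k and x :: 'a
  define E where "E k x = (2 * c k x) *\<^sub>R (- (1 / real (Suc k)) *\<^sub>R grad_log_scale x)" for k and x :: 'a
  define F where "F k t = real (Suc k) * arctan (t / real (Suc k))" for k t
  define F' where "F' k t = 1 / (1 + (t / real (Suc k))\<^sup>2)" for k t
  define f where "f k x = \<eta> k x * F k (u x)" for k x
  define Z where "Z k x = F k (u x) *\<^sub>R E k x + (\<eta> k x * F' k (u x)) *\<^sub>R G x" for k x
  \<comment> \<open>The 4 is the product of the bound 2 k on the truncation and the factor 2/k in
    the gradient of the squared cutoff, with k standing for \<open>Suc k\<close>.\<close>
  define D where "D x = norm (G x) + 4 * norm (grad_log_scale x)" for x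
  have Fk: "DERIV (F k) t :> F' k t" "\<bar>F' k t\<bar> \<le> 1" "\<bar>F k t\<bar> \<le> \<bar>t\<bar>" "\<bar>F k t\<bar> \<le> 2 * real (Suc k)" for k t
    unfolding F_def[abs_def] F'_def using scaled_arctan[of "real (Suc k)" t] by auto
  have cF': "continuous_on UNIV (F' k)" for k
  proof -
    have "1 + (t / real (Suc k))\<^sup>2 \<noteq> 0" for t using zero_le_power2[of "t / real (Suc k)"] by linarith
    then show ?thesis unfolding F'_def[abs_def] by (intro continuous_intros) (auto simp del: of_nat_Suc)
  qed
  have cF: "continuous_on UNIV (F k)" for k
    unfolding F_def[abs_def] by (intro continuous_intros) (auto simp del: of_nat_Suc)
  have c01: "0 \<le> c k x" "c k x \<le> 1" for k x by (auto simp: c_def)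
  have c0: "c k x = 0" if "norm x > K k" for k x
    using log_scale_large[OF dim, of "real (Suc k)" x] that unfolding K_def c_def by (simp add: divide_simps del: of_nat_Suc)
  have \<eta>0: "\<eta> k x = 0" "E k x = 0" if "norm x > K k" for k x using c0[OF that] by (simp_all add: \<eta>_def E_def)
  have \<eta>1: "0 \<le> \<eta> k x" "\<eta> k x \<le> 1" for k x using c01[of k x] by (auto simp: \<eta>_def power_le_one)
  have cc: "continuous_on UNIV (c k)" for k
    unfolding c_def[abs_def] by (intro continuous_intros cL) (auto simp del: of_nat_Suc)
  have cE: "continuous_on UNIV (E k)" for k
    unfolding E_def[abs_def] by (intro continuous_intros cc GL(2))
  have GE: "GDERIV (\<eta> k) x :> E k x" for k x
  proof -
    have "DERIV (\<lambda>l. 1 - l / real (Suc k)) (log_scale x) :> 0 - 1 / real (Suc k)"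
      by (intro DERIV_diff DERIV_const DERIV_cdivide DERIV_ident)
    from GDERIV_DERIV_compose[OF GL(1) this]
    have "GDERIV (\<lambda>x::'a. 1 - log_scale x / real (Suc k)) x :> - (1 / real (Suc k)) *\<^sub>R grad_log_scale x" by simp
    from GDERIV_DERIV_compose[OF this max0_square_deriv]
    show ?thesis by (simp add: \<eta>_def[abs_def] c_def[abs_def] E_def del: of_nat_Suc)
  qed
  have [measurable]: "c k \<in> borel_measurable borel" "E k \<in> borel_measurable borel" "F k \<in> borel_measurable borel" "F' k \<in> borel_measurable borel" for k
    using cc cE cF cF' by (auto intro: borel_measurable_continuous_onI)
  have [measurable]: "\<eta> k \<in> borel_measurable borel" for k unfolding \<eta>_def[abs_def] by measurable
  have fm: "f k \<in> borel_measurable borel" and Zm: "Z k \<in> borel_measurable borel" for k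
    unfolding f_def[abs_def] Z_def[abs_def] by measurable
  note [measurable] = fm Zm
  have bp: "by_parts (f k) (Z k)" for k
    unfolding f_def[abs_def] Z_def[abs_def] by (rule weak_chain_by_parts[OF W Fk(1) cF' Fk(2) GE cE \<eta>0(1)])
  have f0: "f k x = 0" "Z k x = 0" if "norm x > K k" for k x using \<eta>0[OF that] by (simp_all add: f_def Z_def)
  have fu: "\<bar>f k x\<bar> \<le> \<bar>u x\<bar>" for k x
    using mult_mono[OF \<eta>1(2)[of k x] Fk(3)[of k "u x"]] \<eta>1(1)[of k x] by (simp add: f_def abs_mult)
  have fb: "\<bar>f k x\<bar> \<le> 2 * real (Suc k)" for k x
    using mult_mono[OF \<eta>1(2)[of k x] Fk(4)[of k "u x"]] \<eta>1(1)[of k x] by (simp add: f_def abs_mult)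
  have ZD: "norm (Z k x) \<le> D x" for k x
  proof -
    have "norm (E k x) \<le> 2 / real (Suc k) * norm (grad_log_scale x)"
    proof -
      have "norm (E k x) = c k x * (2 / real (Suc k) * norm (grad_log_scale x))"
        using c01(1)[of k x] by (simp add: E_def abs_mult)
      also have "\<dots> \<le> 1 * (2 / real (Suc k) * norm (grad_log_scale x))" using c01 by (intro mult_right_mono) auto
      finally show ?thesis by simp
    qed
    then have "\<bar>F k (u x)\<bar> * norm (E k x) \<le> (2 * real (Suc k)) * (2 / real (Suc k) * norm (grad_log_scale x))"
      using Fk(4)[of k "u x"] by (intro mult_mono) auto
    also have "\<dots> = 4 * norm (grad_log_scale x)" by (simp del: of_nat_Suc)
    finally have 1: "norm (F k (u x) *\<^sub>R E k x) \<le> 4 * norm (grad_log_scale x)" by simp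
    have "\<eta> k x * \<bar>F' k (u x)\<bar> \<le> 1 * 1" using \<eta>1 Fk(2) by (intro mult_mono) auto
    then have "norm ((\<eta> k x * F' k (u x)) *\<^sub>R G x) \<le> 1 * norm (G x)"
      unfolding norm_scaleR using \<eta>1(1)[of k x] by (intro mult_right_mono) (auto simp: abs_mult)
    then show ?thesis unfolding Z_def D_def using 1 by (intro norm_triangle_le) simp
  qed
  have D0: "0 \<le> D x" for x by (simp add: D_def)
  have Dm [measurable]: "D \<in> borel_measurable borel" unfolding D_def[abs_def] by measurable
  note iL = integrable_grad_log_scale[OF dim]
  have iDN: "integrable lborel (\<lambda>x. D x ^ ?N)"
  proof (rule Bochner_Integration.integrable_bound)
    show "integrable lborel (\<lambda>x. 2 ^ ?N * (norm (G x) ^ ?N + 4 ^ ?N * norm (grad_log_scale x) ^ ?N))"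
      by (intro integrable_mult_right Bochner_Integration.integrable_add iG iL)
    show "AE x in lborel. norm (D x ^ ?N) \<le> norm (2 ^ ?N * (norm (G x) ^ ?N + 4 ^ ?N * norm (grad_log_scale x) ^ ?N))"
      using power_add_le[of "norm (G _)" "4 * norm (grad_log_scale _)" ?N] D0
      by (intro AE_I2) (simp add: D_def power_mult_distrib)
  qed measurable
  \<comment> \<open>The weighted square needed for dominating the Bregman term comes from the last
    condition in \<open>W_mu\<close> and from the second integrability statement for the cutoff
    scale.\<close>
  have iD2: "integrable lborel (\<lambda>x. norm (grad v x) ^ (?N - 2) * (D x)\<^sup>2)"
  proof (rule Bochner_Integration.integrable_bound)
    show "integrable lborel (\<lambda>x. 4 * ((norm (G x))\<^sup>2 * norm (grad v x) ^ (?N - 2)) + 64 * (norm (grad v x) ^ (?N - 2) * (norm (grad_log_scale x))\<^sup>2))"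
      by (intro integrable_mult_right Bochner_Integration.integrable_add iG2 iL)
    show "AE x in lborel. norm (norm (grad v x) ^ (?N - 2) * (D x)\<^sup>2)
       \<le> norm (4 * ((norm (G x))\<^sup>2 * norm (grad v x) ^ (?N - 2)) + 64 * (norm (grad v x) ^ (?N - 2) * (norm (grad_log_scale x))\<^sup>2))"
    proof (intro AE_I2)
      fix x
      have "(D x)\<^sup>2 \<le> 2\<^sup>2 * ((norm (G x))\<^sup>2 + (4 * norm (grad_log_scale x))\<^sup>2)"
        unfolding D_def by (rule power_add_le) auto
      then have "norm (grad v x) ^ (?N - 2) * (D x)\<^sup>2 \<le> norm (grad v x) ^ (?N - 2) * (2\<^sup>2 * ((norm (G x))\<^sup>2 + (4 * norm (grad_log_scale x))\<^sup>2))"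
        by (intro mult_left_mono) auto
      also have "\<dots> = 4 * ((norm (G x))\<^sup>2 * norm (grad v x) ^ (?N - 2)) + 64 * (norm (grad v x) ^ (?N - 2) * (norm (grad_log_scale x))\<^sup>2)"
        by (simp add: power_mult_distrib algebra_simps)
      finally show "norm (norm (grad v x) ^ (?N - 2) * (D x)\<^sup>2)
       \<le> norm (4 * ((norm (G x))\<^sup>2 * norm (grad v x) ^ (?N - 2)) + 64 * (norm (grad v x) ^ (?N - 2) * (norm (grad_log_scale x))\<^sup>2))"
        by simp
    qed
  qed measurable
  have iZ: "integrable lborel (\<lambda>x. norm (Z k x) ^ ?N)" for k
    by (rule Bochner_Integration.integrable_bound[OF iDN]) (use power_mono[OF ZD norm_ge_zero] D0 in auto)
  have lZ: "locally_integrable_on (Z k) UNIV" for k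
    unfolding locally_integrable_on_def
  proof (intro allI impI, elim conjE)
    fix C :: "'a set" assume C: "compact C"
    have [measurable]: "C \<in> sets borel" using C by (simp add: borel_compact)
    have "integrable lborel (\<lambda>x. indicator C x *\<^sub>R G x)"
      by (rule locally_integrable_indicator[OF w(2) C]) simp
    moreover have "integrable lborel (\<lambda>x. indicator C x *\<^sub>R grad_log_scale (x::'a))"
      by (rule locally_integrable_indicator[OF continuous_imp_locally_integrable[OF GL(2)] C]) simp
    ultimately have "integrable lborel (\<lambda>x. norm (indicator C x *\<^sub>R G x) + 4 * norm (indicator C x *\<^sub>R grad_log_scale (x::'a)))"
      by (intro Bochner_Integration.integrable_add integrable_mult_right integrable_norm)
    then show "set_integrable lborel C (Z k)"
      unfolding set_integrable_def
    proof (rule Bochner_Integration.integrable_bound)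
      show "AE x in lborel. norm (indicator C x *\<^sub>R Z k x) \<le> norm (norm (indicator C x *\<^sub>R G x) + 4 * norm (indicator C x *\<^sub>R grad_log_scale x))"
        using ZD[of k] by (intro AE_I2) (auto simp: D_def indicator_def)
    qed measurable
  qed
  define q where "q k = (\<integral>x. exp (f k x) * mu_dens x \<partial>lborel)" for k
  define a where "a k = 1 / ?om * (\<integral>x. bregman x (Z k x) \<partial>lborel) + (\<integral>x. f k x * mu_dens x \<partial>lborel)" for k
  have low: "m + ?S \<le> a k - ln (q k)" for k
    unfolding a_def q_def
    by (rule lower_bound_compact_support[OF dim bp m fm Zm lZ fb f0(1) f0(2) iZ])
  have mu0: "0 \<le> mu_dens x" for x :: 'a using mu_dens_pos[of x] by simp
  have iq: "integrable lborel (\<lambda>x. exp (f k x) * mu_dens x)" for k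
    by (rule integrable_bounded_mu[OF dim, of _ "exp (2 * real (Suc k))"])
       (use fm fb[of k] in \<open>auto intro: abs_le_D1 simp del: of_nat_Suc\<close>)
  have qpos: "q k > 0" for k
    using integral_pos_lborel[of UNIV "\<lambda>x. exp (f k x) * mu_dens x"] iq by (simp add: q_def mu_dens_pos)
  have tk: "(\<lambda>k. t / real (Suc k)) \<longlonglongrightarrow> 0" for t
    using tendsto_mult[OF tendsto_const[of t] LIMSEQ_inverse_real_of_nat] by (simp add: divide_inverse)
  have F'lim: "(\<lambda>k. F' k t) \<longlonglongrightarrow> 1" for t
  proof -
    have "(\<lambda>k. F' k t) \<longlonglongrightarrow> 1 / (1 + 0\<^sup>2)" unfolding F'_def by (intro tendsto_intros tk) auto
    then show ?thesis by simp
  qed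
  \<comment> \<open>k arctan (t/k) is t times a difference quotient of arctan at 0; for t = 0 that
    quotient is undefined, hence the case distinction.\<close>
  have Flim: "(\<lambda>k. F k t) \<longlonglongrightarrow> t" for t
  proof (cases "t = 0")
    case False
    have "((\<lambda>h. (arctan (0 + h) - arctan 0) / h) \<longlongrightarrow> inverse (1 + 0\<^sup>2)) (at 0)"
      using DERIV_arctan[of 0] unfolding DERIV_def .
    then have "((\<lambda>h. arctan h / h) \<longlongrightarrow> 1) (at 0)" by simp
    moreover have "filterlim (\<lambda>k. t / real (Suc k)) (at 0) sequentially"
      unfolding filterlim_at using tk[of t] False by auto
    ultimately have "(\<lambda>k. arctan (t / real (Suc k)) / (t / real (Suc k))) \<longlonglongrightarrow> 1" by (rule filterlim_compose)
    from tendsto_mult[OF tendsto_const[of t] this] False show ?thesis by (simp add: F_def mult.commute del: of_nat_Suc)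
  qed (simp add: F_def)
  have clim: "(\<lambda>k. c k x) \<longlonglongrightarrow> 1" for x
  proof -
    have "(\<lambda>k. c k x) \<longlonglongrightarrow> max 0 (1 - 0)" unfolding c_def by (intro tendsto_intros tk)
    then show ?thesis by simp
  qed
  have \<eta>lim: "(\<lambda>k. \<eta> k x) \<longlonglongrightarrow> 1" for x using tendsto_power[OF clim, of x 2] by (simp add: \<eta>_def)
  have Elim: "(\<lambda>k. E k x) \<longlonglongrightarrow> 0" for x
  proof -
    have "(\<lambda>k. E k x) \<longlonglongrightarrow> (2 * 1) *\<^sub>R (- 0 *\<^sub>R grad_log_scale x)"
      unfolding E_def by (intro tendsto_intros clim tk)
    then show ?thesis by simp
  qed
  have flim: "(\<lambda>k. f k x) \<longlonglongrightarrow> u x" for x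
    using tendsto_mult[OF \<eta>lim[of x] Flim[of "u x"]] by (simp add: f_def)
  have Zlim: "(\<lambda>k. Z k x) \<longlonglongrightarrow> G x" for x
  proof -
    have "(\<lambda>k. Z k x) \<longlonglongrightarrow> u x *\<^sub>R 0 + (1 * 1) *\<^sub>R G x"
      unfolding Z_def by (intro tendsto_intros Flim Elim \<eta>lim F'lim)
    then show ?thesis by simp
  qed
  let ?C = "2 * real ?N ^ 2 * 2 ^ ?N"
  have blim: "(\<lambda>k. \<integral>x. bregman x (Z k x) \<partial>lborel) \<longlonglongrightarrow> (\<integral>x. bregman x (G x) \<partial>lborel)"
  proof (rule integral_dominated_convergence)
    show "integrable lborel (\<lambda>x. ?C * (norm (grad v x) ^ (?N - 2) * (D x)\<^sup>2 + D x ^ ?N))"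
      by (intro integrable_mult_right Bochner_Integration.integrable_add iD2 iDN)
    show "(\<lambda>x. bregman x (G x)) \<in> borel_measurable lborel" "(\<lambda>x. bregman x (Z k x)) \<in> borel_measurable lborel" for k
      using bregman_borel[OF dim Gm] bregman_borel[OF dim Zm] by auto
    show "AE x in lborel. (\<lambda>k. bregman x (Z k x)) \<longlonglongrightarrow> bregman x (G x)"
      unfolding bregman_def by (intro AE_I2 tendsto_intros Zlim)
    show "AE x in lborel. norm (bregman x (Z k x)) \<le> ?C * (norm (grad v x) ^ (?N - 2) * (D x)\<^sup>2 + D x ^ ?N)" for k
    proof (intro AE_I2)
      fix x
      have "bregman x (Z k x) \<le> ?C * (norm (grad v x) ^ (?N - 2) * (norm (Z k x))\<^sup>2 + norm (Z k x) ^ ?N)"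
        by (rule bregman_bounds(2)[OF dim])
      also have "\<dots> \<le> ?C * (norm (grad v x) ^ (?N - 2) * (D x)\<^sup>2 + D x ^ ?N)"
        using ZD[of k x] by (intro mult_left_mono add_mono power_mono) auto
      finally show "norm (bregman x (Z k x)) \<le> ?C * (norm (grad v x) ^ (?N - 2) * (D x)\<^sup>2 + D x ^ ?N)"
        using bregman_bounds(1)[OF dim, of x "Z k x"] by simp
    qed
  qed
  have fmlim: "(\<lambda>k. \<integral>x. f k x * mu_dens x \<partial>lborel) \<longlonglongrightarrow> (\<integral>x. u x * mu_dens x \<partial>lborel)"
  proof (rule integral_dominated_convergence[OF _ _ integrable_norm[OF ium]])
    show "AE x in lborel. (\<lambda>k. f k x * mu_dens x) \<longlonglongrightarrow> u x * mu_dens x" by (intro AE_I2 tendsto_intros flim)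
    show "AE x in lborel. norm (f k x * mu_dens x) \<le> norm (u x * mu_dens x)" for k
      using fu[of k] mu0 by (intro AE_I2) (auto simp: abs_mult intro!: mult_right_mono)
  qed measurable
  define A where "A = 1 / ?om * (\<integral>x. bregman x (G x) \<partial>lborel) + (\<integral>x. u x * mu_dens x \<partial>lborel)"
  have alim: "a \<longlonglongrightarrow> A" unfolding a_def[abs_def] A_def by (intro tendsto_intros blim fmlim)
  \<comment> \<open>Solved for the exponential integral, the lower bound becomes an upper bound with
    a convergent right-hand side, the form required by \<open>fatou_bounded\<close>.\<close>
  have qle: "q k \<le> exp (a k - (m + ?S))" for k
  proof -
    have "ln (q k) \<le> a k - (m + ?S)" using low[of k] by linarith
    then have "exp (ln (q k)) \<le> exp (a k - (m + ?S))" by (simp only: exp_le_cancel_iff)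
    then show ?thesis using qpos[of k] by simp
  qed
  have fat: "integrable lborel (\<lambda>x. exp (u x) * mu_dens x)" "(\<integral>x. exp (u x) * mu_dens x \<partial>lborel) \<le> exp (A - (m + ?S))"
  proof -
    have lim: "AE x in lborel. (\<lambda>k. exp (f k x) * mu_dens x) \<longlonglongrightarrow> exp (u x) * mu_dens x"
      by (intro AE_I2 tendsto_intros flim)
    have cl: "(\<lambda>k. exp (a k - (m + ?S))) \<longlonglongrightarrow> exp (A - (m + ?S))" by (intro tendsto_intros alim)
    have em: "(\<lambda>x. exp (u x) * mu_dens x) \<in> borel_measurable lborel" by measurable
    note F = fatou_bounded[OF iq _ em _ lim qle[unfolded q_def] cl]
    show "integrable lborel (\<lambda>x. exp (u x) * mu_dens x)" by (rule F(1)) (simp_all add: mu0)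
    show "(\<integral>x. exp (u x) * mu_dens x \<partial>lborel) \<le> exp (A - (m + ?S))" by (rule F(2)) (simp_all add: mu0)
  qed
  have Qpos: "(\<integral>x. exp (u x) * mu_dens x \<partial>lborel) > 0"
    using integral_pos_lborel[of UNIV "\<lambda>x. exp (u x) * mu_dens x"] fat(1) by (simp add: mu_dens_pos)
  have "ln (\<integral>x. exp (u x) * mu_dens x \<partial>lborel) \<le> ln (exp (A - (m + ?S)))"
    using Qpos fat(2) by (subst ln_le_cancel_iff) auto
  then have "m + ?S \<le> A - ln (\<integral>x. exp (u x) * mu_dens x \<partial>lborel)" by simp
  also have "\<dots> = I_fun u"
    unfolding I_fun_def A_def H_eq_bregman G_def[symmetric] using integral_mu(1)[OF dim] by simp
  finally show ?thesis .
qed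

section \<open>The two infima\<close>

text \<open>If one of the two infima is real, it gives a lower bound of J on test functions, which
  extends to the opposite function space. The value -infinity makes the respective inequality
  trivial, and the zero test function excludes +infinity.\<close>

theorem theorem1p3:
  assumes "DIM('a::euclidean_space) \<ge> 2"
  shows "(INF u \<in> (W_mu :: ('a \<Rightarrow> real) set). ereal (I_fun u)) =
         (INF u \<in> sobolev0 DIM('a) (ball (0::'a) 1). ereal (J_fun u))
         + ereal (\<Sum>k = 1..DIM('a) - 1. 1 / real k)"
proof -
  let ?S = "\<Sum>k = 1..DIM('a) - 1. 1 / real k"
  define A where "A = (INF u \<in> (W_mu :: ('a \<Rightarrow> real) set). ereal (I_fun u))"
  define B where "B = (INF u \<in> sobolev0 DIM('a) (ball (0::'a) 1). ereal (J_fun u))"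
  have zero: "(\<lambda>x. 0) \<in> test_functions (ball (0::'a) 1)"
    by (rule test_functionsI[where r = 0]) (auto simp: C_k_const)
  have At: "A \<le> ereal (J_fun \<phi> + ?S)" if \<phi>: "\<phi> \<in> test_functions (ball 0 1)" for \<phi> :: "'a \<Rightarrow> real"
  proof (rule LIMSEQ_le_const)
    show "(\<lambda>n. ereal (J_fun \<phi> + gap TYPE('a) (real (Suc n)))) \<longlonglongrightarrow> ereal (J_fun \<phi> + ?S)"
      by (intro tendsto_ereal tendsto_intros gap_tendsto assms)
    show "\<exists>N. \<forall>n\<ge>N. A \<le> ereal (J_fun \<phi> + gap TYPE('a) (real (Suc n)))"
    proof (intro exI allI impI)
      fix n
      obtain u where "u \<in> W_mu" "I_fun (u :: 'a \<Rightarrow> real) \<le> J_fun \<phi> + gap TYPE('a) (real (Suc n))"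
        using upper_bound_test[OF assms \<phi>, of "real (Suc n)"] by auto
      then show "A \<le> ereal (J_fun \<phi> + gap TYPE('a) (real (Suc n)))"
        unfolding A_def by (intro INF_lower2[of u]) auto
    qed
  qed
  have Bt: "B \<le> ereal (J_fun \<phi>)" if "\<phi> \<in> test_functions (ball 0 1)" for \<phi> :: "'a \<Rightarrow> real"
    unfolding B_def by (rule INF_lower[OF test_functions_sobolev0[OF that]])
  have "A \<le> B + ereal ?S"
  proof (cases A)
    case (real a)
    have "a - ?S \<le> J_fun \<phi>" if "\<phi> \<in> test_functions (ball 0 1)" for \<phi> :: "'a \<Rightarrow> real"
      using At[OF that] real by simp
    then have "a - ?S \<le> J_fun u" if "u \<in> sobolev0 DIM('a) (ball (0::'a) 1)" for u
      using J_bound_extends_sobolev0[OF assms that] by blast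
    then have "ereal (a - ?S) \<le> B" unfolding B_def by (intro INF_greatest) simp
    then have "ereal (a - ?S) + ereal ?S \<le> B + ereal ?S" by (rule add_right_mono)
    then show ?thesis using real by simp
  qed (use At[OF zero] in auto)
  moreover have "B + ereal ?S \<le> A"
  proof (cases B)
    case (real b)
    have "b \<le> J_fun \<phi>" if "\<phi> \<in> test_functions (ball 0 1)" for \<phi> :: "'a \<Rightarrow> real"
      using Bt[OF that] real by simp
    then have "b + ?S \<le> I_fun u" if "u \<in> W_mu" for u :: "'a \<Rightarrow> real"
      using lower_bound_W_mu[OF assms that] by blast
    then show ?thesis unfolding A_def real by (intro INF_greatest) simp
  qed (use Bt[OF zero] in auto)
  ultimately show ?thesis unfolding A_def B_def by (rule antisym)
qed

end
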